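(* In the setting of killed Feller processes described in the context, assume that $G^D(C_b(D))\subset C_0(D)$. Then the following conditions (i) and (ii) are equivalent, and they imply the existence of a quasi-stationary distribution (QSD) for $(P_t^D)$: (i) there exists an open set $U\subset M$ which is $D$-accessible from all $x\in D$ and such that $\overline{U\cap K}\subset D$; (ii) there exist a function $\phi\in C_0(D)$, positive on $D$, and $\theta>0$ such that $G^D\phi\ge\theta\phi$.
   Context: $M$ is a separable, locally compact metric space with metric $d$; $D\subset M$ is a nonempty set with compact closure $K=\overline D$ such that $D$ is open relative to $K$; $\partial_KD=K\setminus D$. $(P_t)_{t\ge0}$ is a Markov Feller semigroup on $M$: a semigroup of Markov operators on $C_0(M)$ (sup-norm closure of continuous compactly supported functions) with $P_tf\to f$ uniformly as $t\to0$ for all $f\in C_0(M)$. $(X_t)$ is an associated càdlàg Markov process on a filtered space with right-continuous complete filtration, with laws $(\mathbb P_x)_{x\in M}$, $\mathbb P_x(X_0=x)=1$. For Borel $A$, $\tau_A^{out}=\inf\{t\ge0:X_t\notin A\}$. Standing hypothesis: $M\setminus K$ is accessible from every $x\in K$, i.e. for every $x\in K$ there is $t\ge0$ with $P_t(x,M\setminus K)>0$. $B(D)$: bounded measurable functions $D\to\mathbb R$; $C_b(D)$: bounded continuous functions on $D$; $C_0(D)$: sup-norm closure of the continuous compactly supported functions on $D$, equivalently those $f\in C_b(D)$ with $f(x)\to0$ when $d(x,\partial_KD)\to0$. Killed semigroup: $P_t^Df(x)=\mathbb E_x(f(X_t)\mathbf 1_{\tau_D^{out}>t})$ for $f\in B(D)$,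 $x\in D$, and $P_t^D(x,A)=P_t^D\mathbf 1_{A\cap D}(x)$. Green kernel: $G^Df(x)=\int_0^\infty P_t^Df(x)\,dt$ (a bounded operator on $B(D)$). An open set $U\subset M$ is $D$-accessible from $x\in D$ if $P_t^D(x,U)>0$ for some $t\ge0$. A QSD for $(P_t^D)$ is a probability measure $\mu$ on $D$ such that, for some $\lambda>0$, $\mu P_t^D=e^{-\lambda t}\mu$ for all $t\ge0$. *)

theory Defs
  imports "HOL-Probability.Probability"
begin

section \<open>Function spaces\<close>

text \<open>
  A function on a subset \<open>S\<close> of \<open>M\<close> is a total function of which only the values on \<open>S\<close> matter;
  topological notions on \<open>S\<close> refer to the subspace topology.
\<close>

definition Cb :: "'a::metric_space set \<Rightarrow> ('a \<Rightarrow> real) set" where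
  "Cb S = {f. continuous_on S f \<and> bounded (f ` S)}"

definition Cc :: "'a::metric_space set \<Rightarrow> ('a \<Rightarrow> real) set" where
  "Cc S = {f. continuous_on S f \<and> (\<exists>C. compact C \<and> C \<subseteq> S \<and> (\<forall>x\<in>S - C. f x = 0))}"

text \<open>The sup-norm closure of \<^term>\<open>Cc S\<close>.\<close>

definition C0 :: "'a::metric_space set \<Rightarrow> ('a \<Rightarrow> real) set" where
  "C0 S = {f. \<forall>e>0. \<exists>g\<in>Cc S. \<forall>x\<in>S. \<bar>f x - g x\<bar> \<le> e}"


section \<open>Feller semigroups and associated processes\<close>

definition markov_op :: "(real \<Rightarrow> 'a \<Rightarrow> 'a measure) \<Rightarrow> real \<Rightarrow> ('a \<Rightarrow> real) \<Rightarrow> 'a \<Rightarrow> real" where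
  "markov_op P t f x = (\<integral>y. f y \<partial>P t x)"

text \<open>
  The Markov operators are given by their probability kernels \<open>P t x\<close>. Time is real-valued, and
  only times \<open>t \<ge> 0\<close> are relevant. Separability of the metric space \<open>M\<close> is the sort constraint
  \<^class>\<open>second_countable_topology\<close>.
\<close>

locale markov_feller_semigroup =
  fixes P :: "real \<Rightarrow> 'a::{metric_space, second_countable_topology} \<Rightarrow> 'a measure"
  assumes kernel: "0 \<le> t \<Longrightarrow> P t \<in> borel \<rightarrow>\<^sub>M prob_algebra borel"
    and feller: "0 \<le> t \<Longrightarrow> f \<in> C0 UNIV \<Longrightarrow> markov_op P t f \<in> C0 UNIV"
    and op_zero: "f \<in> C0 UNIV \<Longrightarrow> markov_op P 0 f = f"
    and op_add: "0 \<le> s \<Longrightarrow> 0 \<le> t \<Longrightarrow> f \<in> C0 UNIV \<Longrightarrow>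
      markov_op P (s + t) f = markov_op P s (markov_op P t f)"
    and strongly_continuous: "f \<in> C0 UNIV \<Longrightarrow>
      uniform_limit UNIV (\<lambda>t. markov_op P t f) f (at_right 0)"

text \<open>
  \<open>\<Omega>\<close> serves only as the underlying measurable space; \<open>Pr x\<close> is the law started at \<open>x\<close>. Requiring
  the filtration at negative times as well is harmless: put \<open>F t = F 0\<close> there.

  Since there is one filtration for the whole family of laws, completeness means that it contains
  the sets that are negligible under every \<open>Pr x\<close> simultaneously. This is implied by the usual
  augmentation \<open>\<Inter>\<mu>. F\<^sub>t\<^sup>\<mu>\<close> over all initial laws; containing the negligible sets of each single
  \<open>Pr x\<close> would be far too strong.
\<close>

locale cadlag_markov_process =
  fixes P :: "real \<Rightarrow> 'a::{metric_space, second_countable_topology} \<Rightarrow> 'a measure"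
    and \<Omega> :: "'w measure"
    and F :: "real \<Rightarrow> 'w measure"
    and Pr :: "'a \<Rightarrow> 'w measure"
    and X :: "real \<Rightarrow> 'w \<Rightarrow> 'a"
  assumes filtration: "filtration (space \<Omega>) F"
    and subalgebra: "subalgebra \<Omega> (F t)"
    and right_continuous: "0 \<le> t \<Longrightarrow> sets (F t) = (\<Inter>s\<in>{t<..}. sets (F s))"
    and complete: "0 \<le> t \<Longrightarrow> (\<And>x. A \<in> null_sets (Pr x)) \<Longrightarrow> N \<subseteq> A \<Longrightarrow> N \<in> sets (F t)"
    and prob: "prob_space (Pr x)"
    and sets_Pr: "sets (Pr x) = sets \<Omega>"
    and adapted: "0 \<le> t \<Longrightarrow> X t \<in> F t \<rightarrow>\<^sub>M borel"
    and path_right: "\<omega> \<in> space \<Omega> \<Longrightarrow> 0 \<le> t \<Longrightarrow> ((\<lambda>s. X s \<omega>) \<longlongrightarrow> X t \<omega>) (at_right t)"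
    and path_left: "\<omega> \<in> space \<Omega> \<Longrightarrow> 0 < t \<Longrightarrow> \<exists>l. ((\<lambda>s. X s \<omega>) \<longlongrightarrow> l) (at_left t)"
    and start: "AE \<omega> in Pr x. X 0 \<omega> = x"
    and markov: "0 \<le> s \<Longrightarrow> 0 \<le> t \<Longrightarrow> f \<in> borel_measurable borel \<Longrightarrow> bounded (range f) \<Longrightarrow>
      AE \<omega> in Pr x. real_cond_exp (Pr x) (F t) (\<lambda>\<omega>. f (X (t + s) \<omega>)) \<omega> = markov_op P s f (X t \<omega>)"


section \<open>The killed process\<close>

definition exit_time :: "(real \<Rightarrow> 'w \<Rightarrow> 'a) \<Rightarrow> 'a set \<Rightarrow> 'w \<Rightarrow> ereal" where
  "exit_time X A \<omega> = (INF t\<in>{t. 0 \<le> t \<and> X t \<omega> \<notin> A}. ereal t)"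

definition killed_op ::
  "('a \<Rightarrow> 'w measure) \<Rightarrow> (real \<Rightarrow> 'w \<Rightarrow> 'a) \<Rightarrow> 'a set \<Rightarrow> real \<Rightarrow> ('a \<Rightarrow> real) \<Rightarrow> 'a \<Rightarrow> real" where
  "killed_op Pr X D t f x =
    (\<integral>\<omega>. f (X t \<omega>) * indicator {\<omega>. exit_time X D \<omega> > ereal t} \<omega> \<partial>Pr x)"

definition killed_kernel ::
  "('a \<Rightarrow> 'w measure) \<Rightarrow> (real \<Rightarrow> 'w \<Rightarrow> 'a) \<Rightarrow> 'a set \<Rightarrow> real \<Rightarrow> 'a \<Rightarrow> 'a set \<Rightarrow> real" where
  "killed_kernel Pr X D t x A = killed_op Pr X D t (indicator (A \<inter> D)) x"

definition green_op ::
  "('a \<Rightarrow> 'w measure) \<Rightarrow> (real \<Rightarrow> 'w \<Rightarrow> 'a) \<Rightarrow> 'a set \<Rightarrow> ('a \<Rightarrow> real) \<Rightarrow> 'a \<Rightarrow> real" where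
  "green_op Pr X D f x = (LBINT t:{0..}. killed_op Pr X D t f x)"

definition D_accessible ::
  "('a \<Rightarrow> 'w measure) \<Rightarrow> (real \<Rightarrow> 'w \<Rightarrow> 'a) \<Rightarrow> 'a set \<Rightarrow> 'a set \<Rightarrow> 'a \<Rightarrow> bool" where
  "D_accessible Pr X D U x \<longleftrightarrow> (\<exists>t\<ge>0. killed_kernel Pr X D t x U > 0)"

definition QSD ::
  "('a::topological_space \<Rightarrow> 'w measure) \<Rightarrow> (real \<Rightarrow> 'w \<Rightarrow> 'a) \<Rightarrow> 'a set \<Rightarrow> 'a measure \<Rightarrow> bool" where
  "QSD Pr X D \<mu> \<longleftrightarrow>
    prob_space \<mu> \<and> sets \<mu> = sets (restrict_space borel D) \<and>
    (\<exists>l>0. \<forall>t\<ge>0. \<forall>A\<in>sets \<mu>.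
      (\<integral>x. killed_kernel Pr X D t x A \<partial>\<mu>) = exp (- l * t) * measure \<mu> A)"

end

theory Submission
  imports Defs
begin

text \<open>
  Write \<open>P\<^sub>t\<close> for the killed semigroup and \<open>G\<close> for its Green operator. Three facts carry the proof.

  First, the killed semigroup is well behaved. The exit time is defined by uncountably many times, and
  the event that it exceeds \<open>t\<close> is not visibly measurable. It is compared with the event \<open>alive t\<close> that the
  path stays in a compact part of \<open>D\<close> until slightly after \<open>t\<close>, which depends on countably many
  coordinates. The two differ only on paths that jump into \<open>D\<close> from a left limit on the boundary. A Feller
  process almost surely does not do this (\<open>predictable_escape_null\<close>): just before such a jump
  it would be close to the boundary, and the strong continuity of the Feller semigroup makes it unlikely
  to move away in a short time. The
  exceptional set is null for every starting point, hence measurable by completeness. Events of the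
  form \<open>alive t\<close> are limits of finite-dimensional ones, so the Markov property extends to them and yields
  a jointly measurable semigroup of kernels (\<open>kern_measurable\<close>, \<open>kern_add\<close>). Since \<open>M - K\<close> is accessible and
  \<open>K\<close> is compact, the probability of survival decays exponentially and \<open>G 1\<close> is bounded
  (\<open>green_one_bounded\<close>).

  Secondly, conditions (i) and (ii) are equivalent. Given \<open>U\<close> as in (i), the potential \<open>\<phi> = G f\<close> of a cut-off \<open>f\<close>
  around \<open>U \<inter> K\<close> is positive and bounded below on the support of \<open>f\<close>, so \<open>f \<le> \<phi> / \<theta>\<close> and \<open>\<theta> \<phi> \<le> G \<phi>\<close>
  (\<open>lyapunov_if_accessible\<close>). Given \<open>\<phi>\<close> as in (ii), a set \<open>U\<close> of the form \<open>\<phi> > \<epsilon>\<close> works: from a point that does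
  not see \<open>U\<close> the process would forever remain near the boundary, where \<open>G 1\<close> is small, and \<open>\<theta> \<phi> \<le> G \<phi>\<close> would
  force \<open>\<phi> = 0\<close> there (\<open>accessible_if_lyapunov\<close>).

  Thirdly, (ii) yields a quasi-stationary distribution. The hypothesis on \<open>G\<close> makes it a positive operator
  on the continuous functions on the compact space \<open>K\<close>, with functions extended by zero to the boundary,
  and (ii) makes its spectral radius \<open>r\<close> positive. As for every positive operator on the continuous
  functions on a compact space, \<open>r\<close> is an eigenvalue of the adjoint: the resolvent blows up at \<open>r\<close>, and
  weak limits of its normalised rows are probability measures \<open>\<nu>\<close> with \<open>\<nu> G = r \<nu>\<close>
  (\<open>eigenmeasure_on_continuous\<close>). The compactness comes from the space and not from \<open>G\<close>, which need not be
  a compact operator. Because \<open>G\<close> ignores what happens off \<open>D\<close>, no mass of \<open>\<nu>\<close> is lost at the boundary. Finally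
  \<open>\<nu> G P\<^sub>t = r \<nu> P\<^sub>t\<close> says that \<open>\<nu> P\<^sub>t\<close> is proportional to its own tail integral in \<open>t\<close>, so
  \<open>\<nu> P\<^sub>t = exp (- t / r) \<nu>\<close> (\<open>QSD_if_eigenmeasure\<close>).
\<close>

section \<open>Weak compactness of probability measures on a compact metric space\<close>

text \<open>
  The first differing digit contributes \<open>(1/3)^m\<close> to the difference and all later digits together at most
  half of that, so nearby ternary sums with digits 0 and 1 share their first digits.
\<close>

lemma first_digit_gap:
  fixes a b :: "nat \<Rightarrow> real"
  assumes ab: "\<And>n. a n \<in> {0,1}" "\<And>n. b n \<in> {0,1}"
    and less: "\<bar>(\<Sum>n. a n * (1/3)^n) - (\<Sum>n. b n * (1/3)^n)\<bar> < (1/3)^N / 2"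
    and "n \<le> N"
  shows "a n = b n"
proof (rule ccontr)
  assume "a n \<noteq> b n"
  define m where "m = (LEAST i. a i \<noteq> b i)"
  have m: "a m \<noteq> b m" unfolding m_def by (rule LeastI) fact
  have "m \<le> n" unfolding m_def by (rule Least_le) fact
  have below: "a i = b i" if "i < m" for i using not_less_Least[of i "\<lambda>i. a i \<noteq> b i"] that by (auto simp: m_def)
  have geo: "summable (\<lambda>n. (1/3::real)^n)" by (rule summable_geometric) auto
  have sm: "summable (\<lambda>n. c n * (1/3)^n)" if "\<And>n. \<bar>c n\<bar> \<le> 1" for c :: "nat \<Rightarrow> real"
    by (rule summable_comparison_test'[OF geo, of 0]) (use that in \<open>auto simp: abs_mult intro: mult_left_le_one_le\<close>)
  define d where "d i = a i - b i" for i
  have d1: "\<bar>d i\<bar> \<le> 1" for i using ab(1)[of i] ab(2)[of i] by (auto simp: d_def)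
  have ab1: "\<bar>a i\<bar> \<le> 1" "\<bar>b i\<bar> \<le> 1" for i using ab(1)[of i] ab(2)[of i] by auto
  have sa: "summable (\<lambda>n. a n * (1/3)^n)" and sb: "summable (\<lambda>n. b n * (1/3)^n)"
    using sm ab1 by auto
  have "(\<Sum>n. a n * (1/3)^n) - (\<Sum>n. b n * (1/3)^n) = (\<Sum>n. d n * (1/3)^n)"
    using suminf_diff[OF sa sb] by (simp add: d_def algebra_simps)
  also have "\<dots> = (\<Sum>n. d (n + Suc m) * (1/3)^(n + Suc m)) + (\<Sum>i<Suc m. d i * (1/3)^i)"
    using suminf_split_initial_segment[OF sm[of d], of "Suc m"] d1 by auto
  also have "(\<Sum>i<Suc m. d i * (1/3)^i) = d m * (1/3)^m"
    using below by (simp add: d_def)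
  finally have eq: "(\<Sum>n. a n * (1/3)^n) - (\<Sum>n. b n * (1/3)^n) =
     (\<Sum>n. d (n + Suc m) * (1/3)^(n + Suc m)) + d m * (1/3)^m" .
  have "\<bar>\<Sum>n. d (n + Suc m) * (1/3)^(n + Suc m)\<bar> \<le> (\<Sum>n. (1/3)^(n + Suc m))"
  proof (rule order_trans[OF summable_rabs])
    have g2: "summable (\<lambda>n. (1/3::real)^(n + Suc m))" using geo by (rule summable_ignore_initial_segment)
    have le: "\<bar>d (n + Suc m) * (1/3)^(n + Suc m)\<bar> \<le> (1/3)^(n + Suc m)" for n
      using d1[of "n + Suc m"] by (auto simp: abs_mult intro: mult_left_le_one_le)
    show s: "summable (\<lambda>n. \<bar>d (n + Suc m) * (1/3)^(n + Suc m)\<bar>)"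
      by (rule summable_comparison_test'[OF g2, of 0]) (use le in auto)
    show "(\<Sum>n. \<bar>d (n + Suc m) * (1/3)^(n + Suc m)\<bar>) \<le> (\<Sum>n. (1/3)^(n + Suc m))"
      by (rule suminf_le[OF le s g2])
  qed
  also have "(\<Sum>n. (1/3::real)^(n + Suc m)) = (1/3)^(Suc m) * (\<Sum>n. (1/3)^n)"
    using geo by (subst suminf_mult[symmetric]) (auto simp: power_add algebra_simps)
  also have "\<dots> = (1/3)^m / 2" by (simp add: suminf_geometric)
  finally have 1: "\<bar>\<Sum>n. d (n + Suc m) * (1/3)^(n + Suc m)\<bar> \<le> (1/3)^m / 2" .
  have 2: "\<bar>d m * (1/3)^m\<bar> = (1/3)^m"
    using m ab(1)[of m] ab(2)[of m] by (auto simp: d_def abs_mult)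
  have "(1/3)^N \<le> (1/3::real)^m" using \<open>m \<le> n\<close> \<open>n \<le> N\<close> by (intro power_decreasing) auto
  with 1 2 less show False unfolding eq by linarith
qed

text \<open>
  The code of a point records, as ternary digits, to which members of a countable family of balls it
  belongs. For every radius the family contains finitely many balls of that radius covering \<open>K\<close>;
  points whose codes are close agree on the membership in all of them, hence are close themselves.
  Thus the code has a uniformly continuous inverse, although it is itself only Borel measurable.
\<close>

lemma borel_code_of_compact:
  fixes K :: "'a::metric_space set"
  assumes "compact K"
  obtains c :: "'a \<Rightarrow> real" where "c \<in> borel_measurable borel" "\<And>x. 0 \<le> c x" "\<And>x. c x \<le> 3/2"
    and "\<And>e. e > 0 \<Longrightarrow> \<exists>d>0. \<forall>x\<in>K. \<forall>y\<in>K. \<bar>c x - c y\<bar> < d \<longrightarrow> dist x y < e"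
proof -
  have "\<exists>F. finite F \<and> K \<subseteq> (\<Union>x\<in>F. ball x (1 / Suc k))" for k
    by (rule compactE_image[OF assms, of K "\<lambda>x. ball x (1 / Suc k)"]) auto
  then obtain F where F: "\<And>k. finite (F k)" "\<And>k. K \<subseteq> (\<Union>x\<in>F k. ball x (1 / Suc k))" by metis
  define \<B> where "\<B> = insert {} (\<Union>k. (\<lambda>x. ball x (1 / Suc k)) ` F k)"
  have cB: "countable \<B>" unfolding \<B>_def
    using F(1) by (intro countable_insert countable_UN) (auto intro: countable_finite)
  define B where "B = from_nat_into \<B>"
  have B: "range B = \<B>" unfolding B_def by (rule range_from_nat_into) (use cB in \<open>auto simp: \<B>_def\<close>)
  have oB: "open (B n)" for n
  proof -
    have "B n \<in> \<B>" using B by blast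
    then show ?thesis by (auto simp: \<B>_def)
  qed
  define c where "c x = (\<Sum>n. indicator (B n) x * (1/3::real)^n)" for x
  have geo: "summable (\<lambda>n. (1/3::real)^n)" by (rule summable_geometric) auto
  have sm: "summable (\<lambda>n. indicator (B n) x * (1/3::real)^n)" for x
    by (rule summable_comparison_test'[OF geo, of 0]) (auto simp: indicator_def)
  show ?thesis
  proof (rule that[of c])
    have [measurable]: "B n \<in> sets borel" for n using oB by auto
    show "c \<in> borel_measurable borel" unfolding c_def by measurable
    show "0 \<le> c x" for x unfolding c_def by (rule suminf_nonneg[OF sm]) auto
    have "c x \<le> (\<Sum>n. (1/3::real)^n)" for x unfolding c_def
      by (rule suminf_le[OF _ sm geo]) (auto simp: indicator_def)
    then show "c x \<le> 3/2" for x by (simp add: suminf_geometric)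
    fix e :: real assume "e > 0"
    then obtain k where k: "2 / Suc k < e" using reals_Archimedean[of "e/2"] by (auto simp: field_simps)
    have "\<exists>n. B n = ball x (1 / Suc k)" if "x \<in> F k" for x
    proof -
      have "ball x (1 / Suc k) \<in> range B" unfolding B \<B>_def using that by blast
      then show ?thesis by (metis rangeE)
    qed
    then obtain n where n: "\<And>x. x \<in> F k \<Longrightarrow> B (n x) = ball x (1 / Suc k)" by metis
    define N where "N = Max (insert 0 (n ` F k))"
    have N: "n x \<le> N" if "x \<in> F k" for x unfolding N_def using F(1) that by auto
    show "\<exists>d>0. \<forall>x\<in>K. \<forall>y\<in>K. \<bar>c x - c y\<bar> < d \<longrightarrow> dist x y < e"
    proof (intro exI[of _ "(1/3)^N/2"] conjI ballI impI)
      fix x y assume xy: "x \<in> K" "y \<in> K" and l: "\<bar>c x - c y\<bar> < (1/3)^N/2"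
      obtain p where p: "p \<in> F k" "x \<in> ball p (1 / Suc k)" using F(2)[of k] xy by blast
      have "(indicator (B (n p)) x::real) = indicator (B (n p)) y"
        using N[OF p(1)] l by (intro first_digit_gap[of _ _ N]) (auto simp: c_def indicator_def)
      with p n[OF p(1)] have "y \<in> ball p (1 / Suc k)" by (auto simp: indicator_def split: if_splits)
      with p have "dist x y < 1 / Suc k + 1 / Suc k" by (metis dist_commute dist_triangle_less_add mem_ball)
      with k show "dist x y < e" by simp
    qed auto
  qed
qed

text \<open>
  Prokhorov's theorem for a compact metric space, reduced to Helly's selection theorem on the line:
  the measures are transported by a Borel code of \<open>K\<close>, a weakly convergent subsequence is chosen there,
  and the limit is transported back by the continuous inverse of the code, which extends to the
  closure of its range. A continuous function on \<open>K\<close> becomes a continuous function on that closed set,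
  and Tietze's theorem extends it to the line.
\<close>

theorem compact_weak_sequential_compactness:
  fixes K :: "'a::metric_space set" and \<nu> :: "nat \<Rightarrow> 'a measure"
  assumes K: "compact K" "K \<noteq> {}"
    and prob: "\<And>j. prob_space (\<nu> j)" and sets: "\<And>j. sets (\<nu> j) = sets borel"
    and conc: "\<And>j. AE x in \<nu> j. x \<in> K"
  obtains r :: "nat \<Rightarrow> nat" and M where "strict_mono r" "prob_space M" "sets M = sets borel" "AE x in M. x \<in> K"
    and "\<And>f :: 'a \<Rightarrow> real. continuous_on K f \<Longrightarrow>
       (\<lambda>j. \<integral>x. indicator K x * f x \<partial>\<nu> (r j)) \<longlonglongrightarrow> (\<integral>x. indicator K x * f x \<partial>M)"
proof -
  obtain c :: "'a \<Rightarrow> real" where c[measurable]: "c \<in> borel_measurable borel"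
    and c0: "\<And>x. 0 \<le> c x" and c1: "\<And>x. c x \<le> 3/2"
    and sep: "\<And>e. e > 0 \<Longrightarrow> \<exists>d>0. \<forall>x\<in>K. \<forall>y\<in>K. \<bar>c x - c y\<bar> < d \<longrightarrow> dist x y < e"
    using borel_code_of_compact[OF K(1)] by blast
  note [measurable_cong] = sets
  have KB[measurable]: "K \<in> sets borel" by (rule borel_closed[OF compact_imp_closed[OF K(1)]])
  define \<mu> where "\<mu> j = distr (\<nu> j) borel c" for j
  have rd: "real_distribution (\<mu> j)" for j
  proof -
    interpret prob_space "\<nu> j" by (rule prob)
    show ?thesis unfolding \<mu>_def by (rule real_distribution_distr) measurable
  qed
  have m1: "Sigma_Algebra.measure (\<mu> n) {-1<..2} = 1" for n
  proof -
    interpret prob_space "\<nu> n" by (rule prob)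
    have "-1 < c x" "c x \<le> 2" for x using c0[of x] c1[of x] by linarith+
    then have "c -` {-1<..2} \<inter> space (\<nu> n) = space (\<nu> n)" by auto
    then show ?thesis by (simp add: \<mu>_def measure_distr prob_space)
  qed
  have "\<exists>a b. a < b \<and> (\<forall>n. Sigma_Algebra.measure (\<mu> n) {a<..b} > 1 - e)" if "e > 0" for e :: real
    by (rule exI[of _ "-1"], rule exI[of _ 2]) (use m1 that in auto)
  then have tight: "tight \<mu>" unfolding tight_def using rd by blast
  obtain r M where r: "strict_mono (r::nat\<Rightarrow>nat)" and M: "real_distribution M"
    and wc: "weak_conv_m (\<mu> \<circ> id \<circ> r) M"
    using tight_imp_convergent_subsubsequence[OF tight, of id] by (auto simp: strict_mono_def)
  interpret M: real_distribution M by (rule M)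
  define L where "L = closure (c ` K)"
  have clL: "closed L" by (simp add: L_def)
  (* the inverse of the code extends to the closure of its range *)
  have "\<exists>p\<in>K. \<forall>e>0. \<exists>d>0. \<forall>x\<in>K. \<bar>c x - z\<bar> < d \<longrightarrow> dist x p < e" if z: "z \<in> L" for z
  proof -
    obtain y where y: "\<And>n. y n \<in> c ` K" "y \<longlonglongrightarrow> z" using z unfolding L_def closure_sequential by blast
    then have "\<forall>n. \<exists>x\<in>K. y n = c x" by blast
    then obtain x where x: "\<And>n. x n \<in> K" "\<And>n. y n = c (x n)" by metis
    obtain p s where p: "p \<in> K" "strict_mono (s::nat\<Rightarrow>nat)" "(x \<circ> s) \<longlonglongrightarrow> p"
      using K(1) x(1) unfolding compact_def by blast
    have ys: "(\<lambda>n. y (s n)) \<longlonglongrightarrow> z" using LIMSEQ_subseq_LIMSEQ[OF y(2) p(2)] by (simp add: o_def)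
    show ?thesis
    proof (intro bexI[of _ p] allI impI p)
      fix e :: real assume e: "e > 0"
      obtain d where d: "d > 0" "\<And>x y. x\<in>K \<Longrightarrow> y\<in>K \<Longrightarrow> \<bar>c x - c y\<bar> < d \<Longrightarrow> dist x y < e/2"
        using sep[of "e/2"] e by auto
      have "eventually (\<lambda>n. dist (y (s n)) z < d/2) sequentially"
        using ys d(1) by (auto dest!: tendstoD[of _ _ _ "d/2"])
      moreover have "eventually (\<lambda>n. dist (x (s n)) p < e/2) sequentially"
        using p(3) e by (auto dest!: tendstoD[of _ _ _ "e/2"] simp: o_def)
      ultimately have "eventually (\<lambda>n. dist (y (s n)) z < d/2 \<and> dist (x (s n)) p < e/2) sequentially"
        by (rule eventually_conj)
      then obtain n where n: "dist (y (s n)) z < d/2" "dist (x (s n)) p < e/2"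
        by (auto simp: eventually_sequentially)
      show "\<exists>d>0. \<forall>x\<in>K. \<bar>c x - z\<bar> < d \<longrightarrow> dist x p < e"
      proof (intro exI[of _ "d/2"] conjI ballI impI)
        fix x' assume x': "x' \<in> K" "\<bar>c x' - z\<bar> < d/2"
        have "\<bar>c x' - c (x (s n))\<bar> < d" using x'(2) n(1) x(2)[of "s n"] unfolding dist_real_def by linarith
        then have "dist x' (x (s n)) < e/2" using d x' x by blast
        then show "dist x' p < e" using n(2) dist_triangle[of x' p "x (s n)"] by linarith
      qed (use d in auto)
    qed
  qed
  then obtain \<pi> where piK: "\<And>z. z \<in> L \<Longrightarrow> \<pi> z \<in> K"
    and pi: "\<And>z e. z \<in> L \<Longrightarrow> e > 0 \<Longrightarrow> \<exists>d>0. \<forall>x\<in>K. \<bar>c x - z\<bar> < d \<longrightarrow> dist x (\<pi> z) < e"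
    by metis
  have cL: "c x \<in> L" if "x \<in> K" for x using that closure_subset[of "c ` K"] by (auto simp: L_def)
  have pic: "\<pi> (c x) = x" if xK: "x \<in> K" for x
  proof (rule ccontr)
    assume "\<pi> (c x) \<noteq> x"
    then obtain d where "d > 0" "\<forall>x'\<in>K. \<bar>c x' - c x\<bar> < d \<longrightarrow> dist x' (\<pi> (c x)) < dist x (\<pi> (c x))"
      using pi[OF cL[OF xK], of "dist x (\<pi> (c x))"] by auto
    then show False using xK by auto
  qed
  have picont: "continuous_on L \<pi>" unfolding continuous_on_iff
  proof (intro ballI allI impI)
    fix z e assume z: "z \<in> L" and e: "(e::real) > 0"
    obtain d where d: "d > 0" "\<forall>x\<in>K. \<bar>c x - z\<bar> < d \<longrightarrow> dist x (\<pi> z) < e/2" using pi[OF z, of "e/2"] e by auto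
    show "\<exists>d>0. \<forall>z'\<in>L. dist z' z < d \<longrightarrow> dist (\<pi> z') (\<pi> z) < e"
    proof (intro exI[of _ "d/2"] conjI ballI impI)
      fix z' assume z': "z' \<in> L" "dist z' z < d/2"
      obtain d' where d': "d' > 0" "\<forall>x\<in>K. \<bar>c x - z'\<bar> < d' \<longrightarrow> dist x (\<pi> z') < e/2" using pi[OF z'(1), of "e/2"] e by auto
      have "min (d/2) d' > 0" using d d' by auto
      then obtain x where x: "x \<in> K" "dist (c x) z' < min (d/2) d'"
        using z'(1) unfolding L_def closure_approachable by blast
      have "\<bar>c x - z\<bar> < d" using x(2) z'(2) unfolding dist_real_def by linarith
      with d x(1) have "dist x (\<pi> z) < e/2" by blast
      moreover have "dist x (\<pi> z') < e/2" using d' x by (auto simp: dist_real_def)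
      ultimately show "dist (\<pi> z') (\<pi> z) < e" using dist_triangle2[of "\<pi> z'" "\<pi> z" x] by (simp add: dist_commute)
    qed (use d in auto)
  qed
  obtain p0 where p0: "p0 \<in> K" using K(2) by blast
  have [measurable]: "L \<in> sets borel" using clL by auto
  define q where "q z = (if z \<in> L then \<pi> z else p0)" for z
  have q[measurable]: "q \<in> borel_measurable borel"
    unfolding q_def by (rule borel_measurable_continuous_on_if) (use picont in auto)
  have conv: "(\<lambda>j. \<integral>x. h (c x) \<partial>\<nu> (r j)) \<longlonglongrightarrow> (\<integral>z. h z \<partial>M)"
    if h: "continuous_on UNIV h" "\<And>z. \<bar>h z\<bar> \<le> B" for h :: "real \<Rightarrow> real" and B
  proof -
    have hm[measurable]: "h \<in> borel_measurable borel" using h(1) by (rule borel_measurable_continuous_onI)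
    have "(\<lambda>j. integral\<^sup>L ((\<mu> \<circ> id \<circ> r) j) h) \<longlonglongrightarrow> integral\<^sup>L M h"
      by (rule weak_conv_imp_integral_bdd_continuous_conv[OF _ M wc])
        (use rd h in \<open>auto simp: continuous_on_eq_continuous_at\<close>)
    moreover have "integral\<^sup>L ((\<mu> \<circ> id \<circ> r) j) h = (\<integral>x. h (c x) \<partial>\<nu> (r j))" for j
      by (simp add: \<mu>_def integral_distr)
    ultimately show ?thesis by simp
  qed
  have AEL: "AE z in M. z \<in> L"
  proof -
    let ?h = "\<lambda>z. min 1 (infdist z L)"
    have [measurable]: "(\<lambda>z. infdist z L) \<in> borel_measurable borel"
      by (intro borel_measurable_continuous_onI continuous_intros)
    have "(\<lambda>j. \<integral>x. ?h (c x) \<partial>\<nu> (r j)) \<longlonglongrightarrow> (\<integral>z. ?h z \<partial>M)"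
      by (rule conv[of _ 1]) (intro continuous_intros, use infdist_nonneg[of _ L] in \<open>auto simp: abs_of_nonneg\<close>)
    moreover have "(\<integral>x. ?h (c x) \<partial>\<nu> (r j)) = 0" for j
      by (rule integral_eq_zero_AE) (use conc[of "r j"] cL in \<open>auto elim!: eventually_mono\<close>)
    ultimately have "(\<integral>z. ?h z \<partial>M) = 0" by (simp add: LIMSEQ_const_iff)
    moreover have "integrable M ?h" 
      by (rule M.integrable_const_bound[of _ 1]) (use infdist_nonneg[of _ L] in \<open>auto simp: abs_of_nonneg\<close>)
    ultimately have "AE z in M. ?h z = 0"
      by (subst (asm) integral_nonneg_eq_0_iff_AE) (auto simp: infdist_nonneg)
    then show ?thesis
    proof eventually_elim
      case (elim z)
      then have "infdist z L = 0" by (auto simp: min_def split: if_splits)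
      moreover have "L \<noteq> {}" using cL p0 by blast
      ultimately show ?case using in_closed_iff_infdist_zero[OF clL] by blast
    qed
  qed
  show ?thesis
  proof (rule that[of r "distr M borel q"])
    show "prob_space (distr M borel q)" by (rule M.prob_space_distr) simp
    show "AE x in distr M borel q. x \<in> K"
      by (subst AE_distr_iff) (use piK p0 in \<open>auto simp: q_def\<close>)
    fix f :: "'a \<Rightarrow> real" assume f: "continuous_on K f"
    have cf: "continuous_on L (\<lambda>z. f (\<pi> z))"
      using continuous_on_compose2[OF f picont] piK by auto
    have "bounded (f ` K)" using compact_continuous_image[OF f K(1)] compact_imp_bounded by blast
    then obtain B where B: "\<And>x. x \<in> K \<Longrightarrow> \<bar>f x\<bar> \<le> B" by (auto simp: bounded_iff)
    have B0: "0 \<le> B" using B[OF p0] by linarith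
    obtain h where h: "continuous_on UNIV h" "\<And>z. z \<in> L \<Longrightarrow> h z = f (\<pi> z)" "\<And>z. norm (h z) \<le> B"
      by (rule Tietze[of L "\<lambda>z. f (\<pi> z)" UNIV B])
        (use cf clL piK B B0 in \<open>auto\<close>)
    have [measurable]: "h \<in> borel_measurable borel" using h(1) by (rule borel_measurable_continuous_onI)
    have fm[measurable]: "(\<lambda>x. indicator K x * f x) \<in> borel_measurable borel"
      using borel_measurable_continuous_on_indicator[OF KB f] by simp
    have "(\<lambda>j. \<integral>x. h (c x) \<partial>\<nu> (r j)) \<longlonglongrightarrow> (\<integral>z. h z \<partial>M)" by (rule conv[of _ B]) (use h in auto)
    moreover have "(\<integral>x. h (c x) \<partial>\<nu> (r j)) = (\<integral>x. indicator K x * f x \<partial>\<nu> (r j))" for j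
      by (rule integral_cong_AE) (use conc[of "r j"] in \<open>auto elim!: eventually_mono simp: h(2) cL pic\<close>)
    moreover have "(\<integral>z. h z \<partial>M) = (\<integral>x. indicator K x * f x \<partial>distr M borel q)"
    proof (subst integral_distr)
      have q_pi: "q z = \<pi> z" if "z \<in> L" for z using that by (simp add: q_def)
      have [measurable]: "(\<lambda>z. indicator K (q z) * f (q z)) \<in> borel_measurable borel"
        using measurable_compose[OF q fm] .
      show "(\<integral>z. h z \<partial>M) = (\<integral>z. indicator K (q z) * f (q z) \<partial>M)"
        by (rule integral_cong_AE) (use AEL in \<open>auto elim!: eventually_mono simp: h(2) q_pi piK\<close>)
    qed simp_all
    ultimately show "(\<lambda>j. \<integral>x. indicator K x * f x \<partial>\<nu> (r j)) \<longlonglongrightarrow> (\<integral>x. indicator K x * f x \<partial>distr M borel q)"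
      by simp
  qed (use r in auto)
qed

section \<open>Integral representation and an exponential integral equation\<close>

text \<open>
  A functional on nonnegative measurable functions that is additive, homogeneous and monotonely
  continuous is the integral against the measure \<open>A \<mapsto> L (indicator A)\<close>. It turns the kernels and sums of
  kernels below into measures.
\<close>

lemma additive_functional_is_nn_integral:
  fixes L :: "('a \<Rightarrow> ennreal) \<Rightarrow> ennreal"
  assumes add: "\<And>f g. f \<in> borel_measurable N \<Longrightarrow> g \<in> borel_measurable N \<Longrightarrow> L (\<lambda>x. f x + g x) = L f + L g"
    and mult: "\<And>f c. f \<in> borel_measurable N \<Longrightarrow> L (\<lambda>x. c * f x) = c * L f"
    and SUP: "\<And>f. (\<And>i::nat. f i \<in> borel_measurable N) \<Longrightarrow> incseq f \<Longrightarrow> L (\<lambda>x. SUP i. f i x) = (SUP i. L (f i))"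
    and cong: "\<And>f g. f \<in> borel_measurable N \<Longrightarrow> g \<in> borel_measurable N \<Longrightarrow> (\<And>x. x \<in> space N \<Longrightarrow> f x = g x) \<Longrightarrow> L f = L g"
  obtains m where "sets m = sets N" "\<And>f. f \<in> borel_measurable N \<Longrightarrow> (\<integral>\<^sup>+x. f x \<partial>m) = L f"
proof -
  have zero: "L (\<lambda>x. 0) = 0" using mult[of "\<lambda>x. 0" 0] by simp
  have fin: "L (\<lambda>x. \<Sum>i<n. f i x) = (\<Sum>i<n. L (f i))" if "\<And>i. f i \<in> borel_measurable N" for n and f :: "nat \<Rightarrow> 'a \<Rightarrow> ennreal"
    using that by (induction n) (simp_all add: zero add)
  define m where "m = measure_of (space N) (sets N) (\<lambda>A. L (indicator A))"
  have em: "emeasure m A = L (indicator A)" if "A \<in> sets N" for A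
  proof (rule emeasure_measure_of[OF m_def])
    show "positive (sets m) (\<lambda>A. L (indicator A))" 
    proof -
      have "indicator {} = (\<lambda>x::'a. 0::ennreal)" by auto
      with zero show ?thesis by (simp add: positive_def)
    qed
    show "countably_additive (sets m) (\<lambda>A. L (indicator A))"
    proof (rule countably_additiveI)
      fix A :: "nat \<Rightarrow> 'a set" assume A: "range A \<subseteq> sets m" "disjoint_family A"
      have [measurable]: "A i \<in> sets N" for i using A(1) by (auto simp: m_def sets.space_closed)
      have "(\<Sum>i. L (indicator (A i))) = (SUP n. \<Sum>i<n. L (indicator (A i)))" by (rule suminf_eq_SUP)
      also have "\<dots> = (SUP n. L (\<lambda>x. \<Sum>i<n. indicator (A i) x))" by (subst fin) auto
      also have "\<dots> = L (\<lambda>x. SUP n. \<Sum>i<n. indicator (A i) x)"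
        by (rule SUP[symmetric]) (auto simp: incseq_def le_fun_def intro!: sum_mono2)
      also have "(\<lambda>x. SUP n. \<Sum>i<n. indicator (A i) x :: ennreal) = indicator (\<Union>i. A i)"
        using suminf_indicator[OF A(2)] by (simp add: suminf_eq_SUP fun_eq_iff)
      finally show "(\<Sum>i. L (indicator (A i))) = L (indicator (\<Union>i. A i))" .
    qed
  qed (use that in \<open>auto simp: m_def sets.space_closed\<close>)
  have sm: "sets m = sets N" by (simp add: m_def sets.space_closed)
  have spm: "space m = space N" by (simp add: m_def space_measure_of_conv)
  have "(\<integral>\<^sup>+x. f x \<partial>m) = L f" if "f \<in> borel_measurable N" for f
    using that
  proof (induction rule: borel_measurable_induct)
    case (cong f g)
    then have "(\<integral>\<^sup>+x. f x \<partial>m) = (\<integral>\<^sup>+x. g x \<partial>m)" by (intro nn_integral_cong) (simp add: spm)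
    then show ?case using cong assms(4)[of f g] by simp
  next
    case (set A) then show ?case by (simp add: em sm)
  next
    case (mult u c) 
    then have "u \<in> borel_measurable m" using measurable_cong_sets[OF sm refl] by blast
    with mult show ?case by (simp add: nn_integral_cmult assms(2))
  next
    case (add u v)
    then have "u \<in> borel_measurable m" "v \<in> borel_measurable m" using measurable_cong_sets[OF sm refl] by blast+
    with add show ?case by (simp add: nn_integral_add assms(1))
  next
    case (seq U)
    then have U: "\<And>i. U i \<in> borel_measurable m" using measurable_cong_sets[OF sm refl] by blast
    have "(\<integral>\<^sup>+x. (SUP i. U i) x \<partial>m) = (SUP i. \<integral>\<^sup>+x. U i x \<partial>m)"
      using nn_integral_monotone_convergence_SUP[OF seq.hyps(3) U] by (simp add: image_comp)
    also have "\<dots> = L (\<lambda>x. SUP i. U i x)" using SUP[OF seq.hyps(1) seq.hyps(3)] seq.IH by simp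
    finally show ?case by (simp add: image_comp)
  qed
  then show thesis using that sm by blast
qed

text \<open>
  A function proportional to its own tail integral is first seen to be continuous, then differentiable
  with \<open>a' = - a / r\<close>; hence \<open>exp (t / r) * a t\<close> is constant.
\<close>

lemma exponential_from_tail_integral:
  fixes a :: "real \<Rightarrow> real"
  assumes int: "set_integrable lborel {0..} a" and "r > 0"
    and eq: "\<And>t. t \<ge> 0 \<Longrightarrow> r * a t = (LBINT s:{t..}. a s)" and t: "t \<ge> 0"
  shows "a t = exp (- t / r) * a 0"
proof -
  have int': "set_integrable lborel A a" if "A \<subseteq> {0..}" "A \<in> sets borel" for A
    by (rule set_integrable_subset[OF int]) (use that in auto)
  have hk: "(LBINT s:{0..u}. a s) = integral {0..u} a" and hki: "a integrable_on {0..u}" for u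
    using set_borel_integral_eq_integral[OF int'[of "{0..u}"]] by auto
  have a_eq: "a u = a 0 - integral {0..u} a / r" if u: "u \<ge> 0" for u
  proof -
    have "(LBINT s:{0..}. a s) = (LBINT s:{0..u} \<union> {u<..}. a s)" using u by (simp add: ivl_disj_un)
    also have "\<dots> = (LBINT s:{0..u}. a s) + (LBINT s:{u<..}. a s)"
      by (rule set_integral_Un) (use u in \<open>auto intro!: int'\<close>)
    also have "(LBINT s:{u<..}. a s) = (LBINT s:{u..}. a s)"
    proof -
      have "AE x in lborel. x \<noteq> u" by (rule AE_lborel_singleton)
      moreover have "set_integrable lborel {u<..} a" "set_integrable lborel {u..} a"
        by (rule int', use u in auto)+
      ultimately show ?thesis unfolding set_lebesgue_integral_def set_integrable_def
        by (intro integral_cong_AE borel_measurable_integrable) (auto simp: indicator_def elim!: eventually_mono)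
    qed
    finally have "r * a 0 = integral {0..u} a + r * a u" using eq[of 0] eq[OF u] hk by simp
    then show ?thesis using \<open>r > 0\<close> by (simp add: field_simps)
  qed
  have cont: "continuous_on {0..t} a"
  proof -
    have "continuous_on {0..t} (\<lambda>u. integral {0..u} a)" by (rule indefinite_integral_continuous_1[OF hki])
    then have "continuous_on {0..t} (\<lambda>u. a 0 - integral {0..u} a / r)" by (intro continuous_intros) (use \<open>r > 0\<close> in auto)
    then show ?thesis by (rule continuous_on_eq) (simp add: a_eq[symmetric])
  qed
  have deriv: "(a has_real_derivative (- a u / r)) (at u within {0..t})" if u: "u \<in> {0..t}" for u
  proof -
    have "((\<lambda>u. integral {0..u} a) has_real_derivative a u) (at u within {0..t})"
      by (rule integral_has_real_derivative[OF cont u])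
    then have "((\<lambda>u. a 0 - integral {0..u} a / r) has_real_derivative (- a u / r)) (at u within {0..t})"
      using \<open>r > 0\<close> by (auto intro!: derivative_eq_intros)
    then show ?thesis by (rule has_field_derivative_transform_within[of _ _ _ _ 1]) (use u in \<open>simp_all add: a_eq[symmetric]\<close>)
  qed
  have "((\<lambda>u. exp (u / r) * a u) has_real_derivative 0) (at u within {0..t})" if u: "u \<in> {0..t}" for u
    using \<open>r > 0\<close> by (auto intro!: derivative_eq_intros deriv[OF u] simp: field_simps)
  then have "\<exists>c. \<forall>u\<in>{0..t}. exp (u / r) * a u = c"
    by (intro has_field_derivative_zero_constant) auto
  then have "exp (t / r) * a t = exp (0 / r) * a 0" using t by (metis atLeastAtMost_iff order_refl)
  then show ?thesis by (simp add: exp_minus field_simps)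
qed

section \<open>Functions vanishing at infinity and cut-off functions\<close>

lemma inverse_Suc_mono: "m \<le> n \<Longrightarrow> 1 / real (Suc n) \<le> 1 / real (Suc m)"
  by (intro divide_left_mono) auto

lemma Cc_subset_C0: "f \<in> Cc S \<Longrightarrow> f \<in> C0 S"
  unfolding C0_def by (auto intro!: bexI[of _ f])

lemma C0_approx:
  assumes "f \<in> C0 S"
  obtains g where "\<And>n::nat. g n \<in> Cc S" "uniform_limit S g f sequentially"
proof -
  have "\<forall>n. \<exists>g\<in>Cc S. \<forall>x\<in>S. \<bar>f x - g x\<bar> \<le> 1 / Suc n" using assms unfolding C0_def by (auto simp del: of_nat_Suc)
  then obtain g where g: "\<And>n. g n \<in> Cc S" "\<And>n x. x \<in> S \<Longrightarrow> \<bar>f x - g n x\<bar> \<le> 1 / Suc n" by metis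
  have "uniform_limit S g f sequentially"
  proof (rule uniform_limitI)
    fix e :: real assume "e > 0"
    then obtain N where N: "1 / Suc N < e" using nat_approx_posE by blast
    show "\<forall>\<^sub>F n in sequentially. \<forall>x\<in>S. dist (g n x) (f x) < e"
    proof (rule eventually_sequentiallyI[of N], intro ballI)
      fix n x assume "N \<le> n" "x \<in> S"
      have "1 / real (Suc n) \<le> 1 / Suc N" using \<open>N \<le> n\<close> by (auto intro!: inverse_Suc_mono simp del: of_nat_Suc)
      then show "dist (g n x) (f x) < e" using g(2)[OF \<open>x \<in> S\<close>, of n] N by (simp add: dist_real_def abs_minus_commute)
    qed
  qed
  with g(1) show thesis by (rule that)
qed

lemma C0_continuous_on:
  assumes "f \<in> C0 S"
  shows "continuous_on S f"
proof -
  obtain g where g: "\<And>n::nat. g n \<in> Cc S" "uniform_limit S g f sequentially" using C0_approx[OF assms] by blast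
  show ?thesis by (rule uniform_limit_theorem[OF _ g(2)]) (use g(1) in \<open>auto simp: Cc_def\<close>)
qed

text \<open>
  This is the form in which "\<open>f\<close> vanishes at the boundary" is used.
\<close>

lemma C0_small_off_compact:
  assumes "f \<in> C0 S" "e > 0"
  obtains C where "compact C" "C \<subseteq> S" "\<And>x. x \<in> S - C \<Longrightarrow> \<bar>f x\<bar> \<le> e"
proof -
  obtain g where g: "g \<in> Cc S" "\<forall>x\<in>S. \<bar>f x - g x\<bar> \<le> e" using assms unfolding C0_def by blast
  obtain C where C: "compact C" "C \<subseteq> S" "\<forall>x\<in>S - C. g x = 0" using g(1) unfolding Cc_def by blast
  show thesis by (rule that[OF C(1,2)]) (use C(3) g(2) in fastforce)
qed

lemma C0_bounded:
  assumes "f \<in> C0 S"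
  obtains B where "B > 0" "\<And>x. x \<in> S \<Longrightarrow> \<bar>f x\<bar> \<le> B"
proof -
  obtain C where C: "compact C" "C \<subseteq> S" "\<And>x. x \<in> S - C \<Longrightarrow> \<bar>f x\<bar> \<le> 1"
    using C0_small_off_compact[OF assms, of 1] by auto
  have "bounded (f ` C)"
    using compact_continuous_image[OF continuous_on_subset[OF C0_continuous_on[OF assms] C(2)] C(1)] compact_imp_bounded by blast
  then obtain b where b: "\<forall>x\<in>C. \<bar>f x\<bar> \<le> b" by (auto simp: bounded_iff)
  show thesis by (rule that[of "max 1 b"]) (use b C(3) in force)+
qed

text \<open>
  For \<open>f\<close> of compact support in \<open>D\<close> the extension is continuous on the relatively open sets \<open>D\<close> and
  \<open>K - supp f\<close>, which cover \<open>K\<close>; the general case follows by uniform approximation. It lets the Green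
  operator act on continuous functions on the compact space \<open>K\<close>.
\<close>

lemma C0_zero_extension_continuous:
  assumes D: "openin (top_of_set K) D" and f: "f \<in> C0 D"
  shows "continuous_on K (\<lambda>x. if x \<in> D then f x else 0)"
proof -
  have DK: "D \<subseteq> K" using D openin_subset by fastforce
  obtain g where g: "\<And>n::nat. g n \<in> Cc D" "uniform_limit D g f sequentially" using C0_approx[OF f] by blast
  have "continuous_on K (\<lambda>x. if x \<in> D then g n x else 0)" for n
  proof -
    obtain C where C: "compact C" "C \<subseteq> D" "\<forall>x\<in>D - C. g n x = 0" using g(1)[of n] unfolding Cc_def by blast
    have "K = D \<union> (K - C)" using DK C(2) by auto
    moreover have "openin (top_of_set K) (K - C)"
      using compact_imp_closed[OF C(1)] by (metis openin_diff openin_open_Int open_UNIV Int_UNIV_right closedin_closed_Int Diff_Int2 Diff_Int_distrib inf.idem openin_subtopology_self Diff_Compl Diff_eq open_Compl)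
    ultimately show ?thesis
      using continuous_on_cases_local_open[of D "K - C" "g n" "\<lambda>x. 0" "\<lambda>x. x \<in> D"] D C(3) g(1)[of n]
      by (auto simp: Cc_def)
  qed
  moreover have "uniform_limit K (\<lambda>n x. if x \<in> D then g n x else 0) (\<lambda>x. if x \<in> D then f x else 0) sequentially"
  proof (rule uniform_limitI)
    fix e :: real assume "e > 0"
    then have "\<forall>\<^sub>F n in sequentially. \<forall>x\<in>D. dist (g n x) (f x) < e" using g(2) by (auto dest: uniform_limitD)
    then show "\<forall>\<^sub>F n in sequentially. \<forall>x\<in>K. dist (if x \<in> D then g n x else 0) (if x \<in> D then f x else 0) < e"
      by eventually_elim (use \<open>e > 0\<close> in auto)
  qed
  ultimately show ?thesis by (intro uniform_limit_theorem) auto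
qed

definition bump :: "'a::metric_space set \<Rightarrow> real \<Rightarrow> 'a \<Rightarrow> real" where
  "bump C \<rho> x = max 0 (1 - infdist x C / \<rho>)"

lemma bump_continuous: "continuous_on S (bump C \<rho>)"
  unfolding bump_def by (cases "\<rho> = 0") (auto intro!: continuous_intros)

lemma bump_bounds: "0 \<le> bump C \<rho> x" "\<rho> > 0 \<Longrightarrow> bump C \<rho> x \<le> 1"
  using infdist_nonneg[of x C] by (auto simp: bump_def)

lemma bump_eq_1: "x \<in> C \<Longrightarrow> bump C \<rho> x = 1"
  by (simp add: bump_def)

lemma bump_eq_0: "\<rho> > 0 \<Longrightarrow> \<rho> \<le> infdist x C \<Longrightarrow> bump C \<rho> x = 0"
  by (simp add: bump_def field_simps)

lemma bump_tendsto_indicator: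
  assumes "closed C" "C \<noteq> {}"
  shows "(\<lambda>n. bump C (1 / Suc n) x) \<longlonglongrightarrow> indicator C x"
proof (cases "x \<in> C")
  case False
  then have "infdist x C > 0" using assms in_closed_iff_infdist_zero infdist_nonneg by (metis less_le)
  then obtain N where N: "1 / Suc N < infdist x C" using nat_approx_posE by blast
  have "\<forall>\<^sub>F n in sequentially. bump C (1 / Suc n) x = 0"
  proof (rule eventually_sequentiallyI[of N], rule bump_eq_0)
    fix n assume "N \<le> n"
    then have "1 / real (Suc n) \<le> 1 / Suc N" by (auto intro!: inverse_Suc_mono simp del: of_nat_Suc)
    then show "1 / real (Suc n) \<le> infdist x C" using N by simp
  qed auto
  then show ?thesis using False tendsto_eventually by fastforce
qed (simp add: bump_eq_1)

lemma infdist_less_ex: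
  assumes "infdist x C < e" "C \<noteq> {}"
  obtains c where "c \<in> C" "dist x c < e"
proof -
  have "bdd_below (dist x ` C)" by (auto intro: bdd_belowI[of _ 0])
  then show thesis using assms that by (auto simp: infdist_def cINF_less_iff)
qed

text \<open>
  In a locally compact space a compact set has a neighbourhood contained in a compact set, so narrow
  cut-offs around it are admissible test functions for the Feller property.
\<close>

lemma bump_in_C0:
  fixes C :: "'a::metric_space set"
  assumes lc: "locally compact (UNIV :: 'a set)" and C: "compact C" "C \<noteq> {}"
  obtains \<rho>0 where "\<rho>0 > 0" "\<And>\<rho>. 0 < \<rho> \<Longrightarrow> \<rho> \<le> \<rho>0 \<Longrightarrow> bump C \<rho> \<in> C0 UNIV"
proof -
  have "\<exists>u v. x \<in> u \<and> u \<subseteq> v \<and> open u \<and> compact v" for x :: 'a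
    using lc unfolding locally_compact by (auto simp: subtopology_UNIV)
  then obtain u v where uv: "\<And>x::'a. x \<in> u x" "\<And>x. u x \<subseteq> v x" "\<And>x. open (u x)" "\<And>x. compact (v x)" by metis
  obtain F where F: "finite F" "C \<subseteq> (\<Union>x\<in>F. u x)"
    by (rule compactE_image[OF C(1), of C u]) (use uv in blast)+
  obtain e where e: "e > 0" "(\<Union>x\<in>C. ball x e) \<subseteq> (\<Union>x\<in>F. u x)"
    using compact_subset_open_imp_ball_epsilon_subset[OF C(1) _ F(2)] uv(3) by blast
  have cV: "compact (\<Union>x\<in>F. v x)" using F(1) uv(4) by (intro compact_UN) auto
  show thesis
  proof (rule that[OF e(1)], rule Cc_subset_C0)
    fix \<rho> :: real assume \<rho>: "0 < \<rho>" "\<rho> \<le> e"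
    have "bump C \<rho> x = 0" if x: "x \<notin> (\<Union>x\<in>F. v x)" for x
    proof (rule bump_eq_0[OF \<rho>(1)], rule ccontr)
      assume "\<not> \<rho> \<le> infdist x C"
      then have "infdist x C < e" using \<rho> by auto
      then obtain c where "c \<in> C" "dist x c < e" using infdist_less_ex C(2) by blast
      then have "x \<in> (\<Union>x\<in>C. ball x e)" by (auto simp: dist_commute)
      then show False using e(2) uv(2) x by blast
    qed
    then show "bump C \<rho> \<in> Cc UNIV" using cV bump_continuous unfolding Cc_def by blast
  qed
qed

section \<open>The Markov property for path functionals\<close>

definition right_cont_path :: "(real \<Rightarrow> 'a::topological_space) \<Rightarrow> bool" where
  "right_cont_path w \<longleftrightarrow> (\<forall>t\<ge>0. (w \<longlongrightarrow> w t) (at_right t))"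

lemma right_cont_path_open:
  assumes "right_cont_path w" "0 \<le> t" "open O'" "w t \<in> O'"
  obtains e where "e > 0" "\<And>s. t \<le> s \<Longrightarrow> s < t + e \<Longrightarrow> w s \<in> O'"
proof -
  have "(w \<longlongrightarrow> w t) (at_right t)" using assms by (auto simp: right_cont_path_def)
  then have "\<forall>\<^sub>F s in at_right t. w s \<in> O'" using assms by (auto dest: topological_tendstoD)
  then obtain b where b: "b > t" "\<And>s. t < s \<Longrightarrow> s < b \<Longrightarrow> w s \<in> O'"
    by (auto simp: eventually_at_right_field)
  show thesis
  proof (rule that[of "b - t"])
    fix s assume "t \<le> s" "s < t + (b - t)"
    then show "w s \<in> O'" using b(2)[of s] assms(4) by (cases "s = t") auto
  qed (use b in auto)
qed

lemma right_cont_path_shift: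
  assumes "right_cont_path w" "0 \<le> t"
  shows "right_cont_path (\<lambda>u. w (t + u))"
  unfolding right_cont_path_def
proof (intro allI impI)
  fix u :: real assume "0 \<le> u"
  then have "(w \<longlongrightarrow> w (t + u)) (at_right (t + u))" using assms by (auto simp: right_cont_path_def)
  then have "((\<lambda>s. w (s + t)) \<longlongrightarrow> w (t + u)) (at_right u)"
    using filterlim_at_right_to_0[of w _ "t + u"] filterlim_at_right_to_0[of "\<lambda>s. w (s + t)" _ u]
    by (simp add: ac_simps)
  then show "((\<lambda>u. w (t + u)) \<longlongrightarrow> w (t + u)) (at_right u)" by (simp add: add.commute)
qed

text \<open>
  Right continuity reduces statements about all times to countably many, provided that the interval
  is open on the right.
\<close>

lemma right_cont_path_rational_times:
  assumes w: "right_cont_path w" and "closed A" "0 \<le> a"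
    and rat: "\<And>q. q \<in> \<rat> \<Longrightarrow> a \<le> q \<Longrightarrow> q < b \<Longrightarrow> w q \<in> A"
    and u: "a \<le> u" "u < b"
  shows "w u \<in> A"
proof (rule ccontr)
  assume "w u \<notin> A"
  then obtain e where e: "e > 0" "\<And>s. u \<le> s \<Longrightarrow> s < u + e \<Longrightarrow> w s \<in> - A"
    using right_cont_path_open[OF w, of u "- A"] assms by (auto simp: open_Compl)
  obtain q where "q \<in> \<rat>" "u < q" "q < min (u + e) b" using Rats_dense_in_real[of u "min (u + e) b"] u e by auto
  then show False using rat[of q] e(2)[of q] u by auto
qed

locale feller_process = markov_feller_semigroup P + cadlag_markov_process P \<Omega> F Pr X
  for P :: "real \<Rightarrow> 'a::{metric_space, second_countable_topology} \<Rightarrow> 'a measure"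
    and \<Omega> :: "'w measure" and F Pr X
begin

lemma space_Pr[simp]: "space (Pr x) = space \<Omega>"
  using sets_Pr by (rule sets_eq_imp_space_eq)

lemma space_F[simp]: "space (F t) = space \<Omega>"
  using filtration.space_F[OF filtration] .

lemma measure_Pr_space[simp]: "measure (Pr x) (space \<Omega>) = 1"
  using prob_space.prob_space[OF prob, of x] by simp

lemma sets_F_subset: "sets (F t) \<subseteq> sets \<Omega>"
  using subalgebra[of t] by (auto simp: subalgebra_def)

lemma sets_F_mono: "s \<le> t \<Longrightarrow> sets (F s) \<subseteq> sets (F t)"
  using filtration.sets_F_mono[OF filtration] .

lemma F_measurable_mono: "s \<le> t \<Longrightarrow> f \<in> F s \<rightarrow>\<^sub>M M \<Longrightarrow> f \<in> F t \<rightarrow>\<^sub>M M"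
  using sets_F_mono[of s t] by (auto simp: measurable_def)

lemma F_measurable: "f \<in> F s \<rightarrow>\<^sub>M M \<Longrightarrow> f \<in> \<Omega> \<rightarrow>\<^sub>M M"
  using sets_F_subset[of s] by (auto simp: measurable_def)

lemma measurable_Pr_eq: "measurable (Pr x) M = measurable \<Omega> M"
  using sets_Pr by (rule measurable_cong_sets) auto

lemma X_F: "0 \<le> s \<Longrightarrow> s \<le> t \<Longrightarrow> X s \<in> F t \<rightarrow>\<^sub>M borel"
  by (rule F_measurable_mono[OF _ adapted])

lemma X_meas: "0 \<le> s \<Longrightarrow> X s \<in> \<Omega> \<rightarrow>\<^sub>M borel"
  by (rule F_measurable[OF adapted])

lemma path: "\<omega> \<in> space \<Omega> \<Longrightarrow> right_cont_path (\<lambda>u. X u \<omega>)"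
  using path_right by (auto simp: right_cont_path_def)

lemma path_shift: "\<omega> \<in> space \<Omega> \<Longrightarrow> 0 \<le> t \<Longrightarrow> right_cont_path (\<lambda>u. X (t + u) \<omega>)"
  using right_cont_path_shift[OF path] .

lemma P_prob: "0 \<le> t \<Longrightarrow> prob_space (P t x)"
  using measurable_space[OF kernel, of t x] by (auto simp: space_prob_algebra)

lemma P_sets: "0 \<le> t \<Longrightarrow> sets (P t x) = sets borel"
  using measurable_space[OF kernel, of t x] by (auto simp: space_prob_algebra)

lemma markov_op_measurable:
  assumes "0 \<le> t" "f \<in> borel_measurable borel"
  shows "markov_op P t f \<in> borel_measurable borel"
proof -
  have "P t \<in> borel \<rightarrow>\<^sub>M subprob_algebra borel" using kernel[OF assms(1)] by (rule measurable_prob_algebraD)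
  from measurable_compose[OF this integral_measurable_subprob_algebra[OF assms(2)]]
  show ?thesis unfolding markov_op_def[abs_def] .
qed

lemma markov_op_bound:
  assumes "0 \<le> t" "f \<in> borel_measurable borel" "\<And>y. \<bar>f y\<bar> \<le> (B::real)"
  shows "\<bar>markov_op P t f x\<bar> \<le> B"
proof -
  interpret prob_space "P t x" by (rule P_prob[OF assms(1)])
  have fm: "f \<in> borel_measurable (P t x)" using assms(2) measurable_cong_sets[OF P_sets[OF assms(1)] refl] by blast
  have "integrable (P t x) f" by (rule integrable_const_bound[of _ B]) (use assms fm in auto)
  then have "norm (\<integral>y. f y \<partial>P t x) \<le> (\<integral>y. norm (f y) \<partial>P t x)" by (intro integral_norm_bound)
  also have "\<dots> \<le> (\<integral>y. B \<partial>P t x)" by (rule integral_mono) (use assms \<open>integrable _ _\<close> in auto)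
  finally show ?thesis by (simp add: markov_op_def prob_space)
qed

lemma integrable_Pr:
  assumes "f \<in> borel_measurable \<Omega>" "\<And>\<omega>. \<omega> \<in> space \<Omega> \<Longrightarrow> \<bar>f \<omega>\<bar> \<le> (B::real)"
  shows "integrable (Pr x) f"
proof -
  interpret prob_space "Pr x" by (rule prob)
  show ?thesis by (rule integrable_const_bound[of _ B]) (use assms measurable_Pr_eq in auto)
qed

lemma subalgebra_Pr: "subalgebra (Pr x) (F t)"
  using subalgebra[of t] by (simp add: subalgebra_def sets_Pr)

text \<open>
  The Markov property is assumed as an identity of conditional expectations; this integrated form is
  the one used below.
\<close>

lemma markov_step:
  assumes t: "0 \<le> t" "0 \<le> s" and Y: "Y \<in> borel_measurable (F t)" "\<And>\<omega>. \<bar>Y \<omega>\<bar> \<le> 1"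
    and f: "f \<in> borel_measurable borel" "\<And>y. \<bar>f y\<bar> \<le> (1::real)"
  shows "(\<integral>\<omega>. Y \<omega> * f (X (t + s) \<omega>) \<partial>Pr x) = (\<integral>\<omega>. Y \<omega> * markov_op P s f (X t \<omega>) \<partial>Pr x)"
proof -
  interpret prob_space "Pr x" by (rule prob)
  interpret finite_measure_subalgebra "Pr x" "F t"
    using subalgebra_Pr by unfold_locales
  have [measurable]: "Y \<in> borel_measurable \<Omega>" using F_measurable[OF Y(1)] .
  have [measurable]: "X (t + s) \<in> \<Omega> \<rightarrow>\<^sub>M borel" "X t \<in> \<Omega> \<rightarrow>\<^sub>M borel" using t by (auto intro: X_meas)
  note f(1)[measurable] markov_op_measurable[OF t(2) f(1), measurable]
  have [measurable]: "real_cond_exp (Pr x) (F t) (\<lambda>\<omega>. f (X (t + s) \<omega>)) \<in> borel_measurable \<Omega>"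
    using borel_measurable_cond_exp2[of "Pr x" "F t"] unfolding measurable_Pr_eq .
  have fX: "(\<lambda>\<omega>. f (X (t + s) \<omega>)) \<in> borel_measurable (Pr x)" by (simp add: measurable_Pr_eq)
  have int: "integrable (Pr x) (\<lambda>\<omega>. Y \<omega> * f (X (t + s) \<omega>))"
    by (rule integrable_Pr[of _ 1]) (use Y(2) f(2) in \<open>auto simp: abs_mult intro!: mult_le_one\<close>)
  have "(\<integral>\<omega>. Y \<omega> * f (X (t + s) \<omega>) \<partial>Pr x) =
      (\<integral>\<omega>. Y \<omega> * real_cond_exp (Pr x) (F t) (\<lambda>\<omega>. f (X (t + s) \<omega>)) \<omega> \<partial>Pr x)"
    by (rule real_cond_exp_intg(2)[OF int Y(1) fX, symmetric])
  also have "\<dots> = (\<integral>\<omega>. Y \<omega> * markov_op P s f (X t \<omega>) \<partial>Pr x)"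
  proof (rule integral_cong_AE)
    have "bounded (range f)" using f(2) by (auto simp: bounded_iff)
    then show "AE \<omega> in Pr x. Y \<omega> * real_cond_exp (Pr x) (F t) (\<lambda>\<omega>. f (X (t + s) \<omega>)) \<omega> = Y \<omega> * markov_op P s f (X t \<omega>)"
      using markov[OF t(2) t(1) f(1), of x]
      by (auto elim!: eventually_mono)
  qed (measurable, auto simp: measurable_Pr_eq)
  finally show ?thesis .
qed

text \<open>
  A bounded functional \<open>\<Phi>\<close> of the path is of this kind if, given the past up to time \<open>t\<close>, the
  expectation of \<open>\<Phi>\<close> of the shifted path is the expectation of \<open>\<Phi>\<close> under the law started at \<open>X t\<close>.
  The process comes without shift operators, so \<open>\<Phi>\<close> is a function on paths \<open>real \<Rightarrow> 'a\<close> rather than a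
  random variable.
\<close>

definition markov_functional :: "((real \<Rightarrow> 'a) \<Rightarrow> real) \<Rightarrow> bool" where
  "markov_functional \<Phi> \<longleftrightarrow>
    (\<forall>t\<ge>0. (\<lambda>\<omega>. \<Phi> (\<lambda>u. X (t + u) \<omega>)) \<in> borel_measurable \<Omega>) \<and> (\<forall>w. \<bar>\<Phi> w\<bar> \<le> 1) \<and>
    (\<lambda>y. \<integral>\<omega>. \<Phi> (\<lambda>u. X u \<omega>) \<partial>Pr y) \<in> borel_measurable borel \<and>
    (\<forall>t\<ge>0. \<forall>x Y. Y \<in> borel_measurable (F t) \<longrightarrow> (\<forall>\<omega>. \<bar>Y \<omega>\<bar> \<le> 1) \<longrightarrow>
      (\<integral>\<omega>. Y \<omega> * \<Phi> (\<lambda>u. X (t + u) \<omega>) \<partial>Pr x) = (\<integral>\<omega>. Y \<omega> * (\<integral>\<omega>'. \<Phi> (\<lambda>u. X u \<omega>') \<partial>Pr (X t \<omega>)) \<partial>Pr x))"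

text \<open>
  It suffices to find some Borel function \<open>h\<close> for the conditional expectation: taking \<open>t = 0\<close> and using
  \<open>X 0 = x\<close> almost surely identifies \<open>h\<close> as the expectation of \<open>\<Phi>\<close>.
\<close>

lemma markov_functionalI:
  assumes meas: "\<And>t. 0 \<le> t \<Longrightarrow> (\<lambda>\<omega>. \<Phi> (\<lambda>u. X (t + u) \<omega>)) \<in> borel_measurable \<Omega>" and bd: "\<And>w. \<bar>\<Phi> w\<bar> \<le> 1"
    and h: "h \<in> borel_measurable borel"
      "\<And>t x Y. 0 \<le> t \<Longrightarrow> Y \<in> borel_measurable (F t) \<Longrightarrow> (\<And>\<omega>. \<bar>Y \<omega>\<bar> \<le> 1) \<Longrightarrow>
        (\<integral>\<omega>. Y \<omega> * \<Phi> (\<lambda>u. X (t + u) \<omega>) \<partial>Pr x) = (\<integral>\<omega>. Y \<omega> * h (X t \<omega>) \<partial>Pr x)"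
  shows "markov_functional \<Phi>"
proof -
  have eq: "(\<integral>\<omega>. \<Phi> (\<lambda>u. X u \<omega>) \<partial>Pr y) = h y" for y
  proof -
    interpret prob_space "Pr y" by (rule prob)
    have [measurable]: "X 0 \<in> Pr y \<rightarrow>\<^sub>M borel" by (simp add: measurable_Pr_eq X_meas)
    note h(1)[measurable]
    have "(\<integral>\<omega>. \<Phi> (\<lambda>u. X u \<omega>) \<partial>Pr y) = (\<integral>\<omega>. h (X 0 \<omega>) \<partial>Pr y)"
      using h(2)[of 0 "\<lambda>_. 1" y] by simp
    also have "\<dots> = (\<integral>\<omega>. h y \<partial>Pr y)"
      by (rule integral_cong_AE) (use start[of y] in \<open>auto elim!: eventually_mono\<close>)
    finally show ?thesis by (simp add: prob_space)
  qed
  show ?thesis unfolding markov_functional_def eq using assms by simp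
qed

lemma markov_functionalD:
  assumes "markov_functional \<Phi>"
  shows "0 \<le> t \<Longrightarrow> (\<lambda>\<omega>. \<Phi> (\<lambda>u. X (t + u) \<omega>)) \<in> borel_measurable \<Omega>"
    and "(\<lambda>\<omega>. \<Phi> (\<lambda>u. X u \<omega>)) \<in> borel_measurable \<Omega>"
    and "(\<lambda>y. \<integral>\<omega>. \<Phi> (\<lambda>u. X u \<omega>) \<partial>Pr y) \<in> borel_measurable borel"
    and "0 \<le> t \<Longrightarrow> Y \<in> borel_measurable (F t) \<Longrightarrow> (\<And>\<omega>. \<bar>Y \<omega>\<bar> \<le> 1) \<Longrightarrow>
      (\<integral>\<omega>. Y \<omega> * \<Phi> (\<lambda>u. X (t + u) \<omega>) \<partial>Pr x) = (\<integral>\<omega>. Y \<omega> * (\<integral>\<omega>'. \<Phi> (\<lambda>u. X u \<omega>') \<partial>Pr (X t \<omega>)) \<partial>Pr x)"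
  using assms unfolding markov_functional_def by (blast, force, blast, blast)

text \<open>
  Dominated convergence on both sides of the identity. Convergence is demanded only along right
  continuous paths, because only those occur.
\<close>

lemma markov_functional_limit:
  assumes \<Phi>: "\<And>n::nat. markov_functional (\<Phi> n)"
    and lim: "\<And>w. right_cont_path w \<Longrightarrow> (\<lambda>n. \<Phi> n w) \<longlonglongrightarrow> \<Psi> w" and bd: "\<And>w. \<bar>\<Psi> w\<bar> \<le> 1"
  shows "markov_functional \<Psi>"
proof -
  have bdn: "\<bar>\<Phi> n w\<bar> \<le> 1" for n w using \<Phi> unfolding markov_functional_def by blast
  have meas: "(\<lambda>\<omega>. \<Phi> n (\<lambda>u. X (t + u) \<omega>)) \<in> borel_measurable \<Omega>" if "0 \<le> t" for n t
    using \<Phi> that unfolding markov_functional_def by blast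
  have lim': "(\<lambda>n. \<Phi> n (\<lambda>u. X (t + u) \<omega>)) \<longlonglongrightarrow> \<Psi> (\<lambda>u. X (t + u) \<omega>)" if "\<omega> \<in> space \<Omega>" "0 \<le> t" for t \<omega>
    by (rule lim[OF path_shift[OF that]])
  have meas': "(\<lambda>\<omega>. \<Psi> (\<lambda>u. X (t + u) \<omega>)) \<in> borel_measurable \<Omega>" if "0 \<le> t" for t
    by (rule borel_measurable_LIMSEQ_real[OF lim' meas]) (use that in auto)
  have conv: "(\<lambda>n. \<integral>\<omega>. Y \<omega> * \<Phi> n (\<lambda>u. X (t + u) \<omega>) \<partial>Pr x) \<longlonglongrightarrow> (\<integral>\<omega>. Y \<omega> * \<Psi> (\<lambda>u. X (t + u) \<omega>) \<partial>Pr x)"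
    if t: "0 \<le> t" and Y: "Y \<in> borel_measurable \<Omega>" "\<And>\<omega>. \<bar>Y \<omega>\<bar> \<le> 1" for t Y x
  proof (rule integral_dominated_convergence[where w="\<lambda>_. 1"])
    note Y(1)[measurable] meas[OF t, measurable] meas'[OF t, measurable]
    show "(\<lambda>\<omega>. Y \<omega> * \<Psi> (\<lambda>u. X (t + u) \<omega>)) \<in> borel_measurable (Pr x)"
      "(\<lambda>\<omega>. Y \<omega> * \<Phi> n (\<lambda>u. X (t + u) \<omega>)) \<in> borel_measurable (Pr x)" for n
      unfolding measurable_Pr_eq by measurable
    show "integrable (Pr x) (\<lambda>_. 1::real)" by (rule integrable_Pr[of _ 1]) auto
    show "AE \<omega> in Pr x. (\<lambda>n. Y \<omega> * \<Phi> n (\<lambda>u. X (t + u) \<omega>)) \<longlonglongrightarrow> Y \<omega> * \<Psi> (\<lambda>u. X (t + u) \<omega>)"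
      by (rule AE_I2) (use lim' t in \<open>auto intro!: tendsto_mult\<close>)
    show "AE \<omega> in Pr x. norm (Y \<omega> * \<Phi> n (\<lambda>u. X (t + u) \<omega>)) \<le> 1" for n
      using Y(2) bdn by (auto simp: abs_mult intro!: mult_le_one)
  qed
  define h where "h n y = (\<integral>\<omega>. \<Phi> n (\<lambda>u. X u \<omega>) \<partial>Pr y)" for n y
  define g where "g y = (\<integral>\<omega>. \<Psi> (\<lambda>u. X u \<omega>) \<partial>Pr y)" for y
  have hg: "(\<lambda>n. h n y) \<longlonglongrightarrow> g y" for y
    using conv[of 0 "\<lambda>_. 1" y] by (simp add: h_def g_def)
  have hm[measurable]: "h n \<in> borel_measurable borel" for n using \<Phi> unfolding markov_functional_def h_def by blast
  have gm[measurable]: "g \<in> borel_measurable borel" by (rule borel_measurable_LIMSEQ_real[OF hg hm])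
  have hb: "\<bar>h n y\<bar> \<le> 1" for n y
  proof -
    interpret prob_space "Pr y" by (rule prob)
    have i: "integrable (Pr y) (\<lambda>\<omega>. \<Phi> n (\<lambda>u. X u \<omega>))" using meas[of 0 n] bdn by (intro integrable_Pr[of _ 1]) auto
    have "\<bar>h n y\<bar> \<le> (\<integral>\<omega>. \<bar>\<Phi> n (\<lambda>u. X u \<omega>)\<bar> \<partial>Pr y)" unfolding h_def by (rule integral_abs_bound)
    also have "\<dots> \<le> (\<integral>\<omega>. 1 \<partial>Pr y)" by (rule integral_mono) (use i bdn in auto)
    finally show ?thesis by (simp add: prob_space)
  qed
  show ?thesis
  proof (rule markov_functionalI[OF meas' bd gm])
    fix t x Y assume t: "0 \<le> (t::real)" and Y: "Y \<in> borel_measurable (F t)" "\<And>\<omega>. \<bar>Y \<omega>\<bar> \<le> (1::real)"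
    have YO[measurable]: "Y \<in> borel_measurable \<Omega>" using F_measurable[OF Y(1)] .
    have [measurable]: "X t \<in> \<Omega> \<rightarrow>\<^sub>M borel" using t by (rule X_meas)
    have "(\<lambda>n. \<integral>\<omega>. Y \<omega> * h n (X t \<omega>) \<partial>Pr x) \<longlonglongrightarrow> (\<integral>\<omega>. Y \<omega> * g (X t \<omega>) \<partial>Pr x)"
    proof (rule integral_dominated_convergence[where w="\<lambda>_. 1"])
      show "(\<lambda>\<omega>. Y \<omega> * g (X t \<omega>)) \<in> borel_measurable (Pr x)"
        "(\<lambda>\<omega>. Y \<omega> * h n (X t \<omega>)) \<in> borel_measurable (Pr x)" for n
        unfolding measurable_Pr_eq by measurable
      show "integrable (Pr x) (\<lambda>_. 1::real)" by (rule integrable_Pr[of _ 1]) auto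
      show "AE \<omega> in Pr x. (\<lambda>n. Y \<omega> * h n (X t \<omega>)) \<longlonglongrightarrow> Y \<omega> * g (X t \<omega>)"
        using hg by (auto intro!: tendsto_mult)
      show "AE \<omega> in Pr x. norm (Y \<omega> * h n (X t \<omega>)) \<le> 1" for n
        using Y(2) hb by (auto simp: abs_mult intro!: mult_le_one)
    qed
    moreover have "(\<integral>\<omega>. Y \<omega> * \<Phi> n (\<lambda>u. X (t + u) \<omega>) \<partial>Pr x) = (\<integral>\<omega>. Y \<omega> * h n (X t \<omega>) \<partial>Pr x)" for n
      using \<Phi>[of n] t Y unfolding markov_functional_def h_def by blast
    ultimately show "(\<integral>\<omega>. Y \<omega> * \<Psi> (\<lambda>u. X (t + u) \<omega>) \<partial>Pr x) = (\<integral>\<omega>. Y \<omega> * g (X t \<omega>) \<partial>Pr x)"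
      using conv[OF t YO Y(2), of x] LIMSEQ_unique by fastforce
  qed
qed

text \<open>
  Induction on the largest time \<open>b\<close>: the Markov property at the preceding time \<open>v\<close> replaces the last
  factor by a function of \<open>X v\<close>, which is absorbed into the factor belonging to \<open>v\<close>. Time 0 is always
  included so that a preceding time exists.
\<close>

lemma markov_functional_finite_product:
  assumes "finite A" "A \<subseteq> {0<..}" "\<And>u. f u \<in> borel_measurable borel" "\<And>u y. \<bar>f u y\<bar> \<le> (1::real)"
  shows "markov_functional (\<lambda>w. \<Prod>u\<in>insert 0 A. f u (w u))"
  using assms
proof (induction A arbitrary: f rule: finite_linorder_max_induct)
  case empty
  show ?case
    by (rule markov_functionalI[of _ "f 0"]) (use empty X_meas measurable_compose in auto)
next
  case (insert b A f)
  let ?A = "insert 0 A"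
  define v where "v = Max ?A"
  have vA: "v \<in> ?A" unfolding v_def using \<open>finite A\<close> by (intro Max_in) auto
  have Av: "u \<le> v" if "u \<in> ?A" for u unfolding v_def using \<open>finite A\<close> that by (intro Max_ge) auto
  have A0: "0 \<le> u" if "u \<in> ?A" for u using insert.prems(1) that by auto
  have vb: "v < b" using vA insert.hyps(2) insert.prems(1) by auto
  have v0: "0 \<le> v" using A0[OF vA] .
  have fm[measurable]: "f u \<in> borel_measurable borel" for u by (rule insert.prems(2))
  have bA: "b \<notin> ?A" using Av vb by force
  define g where "g = markov_op P (b - v) (f b)"
  have gm[measurable]: "g \<in> borel_measurable borel" unfolding g_def by (rule markov_op_measurable) (use vb in auto)
  have gb: "\<bar>g y\<bar> \<le> 1" for y unfolding g_def by (rule markov_op_bound) (use vb insert.prems in auto)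
  define f' where "f' = f(v := \<lambda>y. f v y * g y)"
  have IH: "markov_functional (\<lambda>w. \<Prod>u\<in>?A. f' u (w u))"
    by (rule insert.IH) (use insert.prems gb in \<open>auto simp: f'_def abs_mult intro!: mult_le_one\<close>)
  have f'prod: "(\<Prod>u\<in>?A. f' u (w u)) = (\<Prod>u\<in>?A. f u (w u)) * g (w v)" for w
  proof -
    have "(\<Prod>u\<in>?A. f' u (w u)) = f' v (w v) * (\<Prod>u\<in>?A - {v}. f' u (w u))"
      using \<open>finite A\<close> vA by (intro prod.remove) auto
    also have "(\<Prod>u\<in>?A - {v}. f' u (w u)) = (\<Prod>u\<in>?A - {v}. f u (w u))" by (rule prod.cong) (auto simp: f'_def)
    also have "f' v (w v) * \<dots> = (f v (w v) * (\<Prod>u\<in>?A - {v}. f u (w u))) * g (w v)" by (simp add: f'_def)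
    also have "f v (w v) * (\<Prod>u\<in>?A - {v}. f u (w u)) = (\<Prod>u\<in>?A. f u (w u))"
      using \<open>finite A\<close> vA by (intro prod.remove[symmetric]) auto
    finally show ?thesis .
  qed
  have split: "(\<Prod>u\<in>insert 0 (insert b A). f u (w u)) = (\<Prod>u\<in>?A. f u (w u)) * f b (w b)" for w
    using bA \<open>finite A\<close> by (subst insert_commute) (simp add: ac_simps)
  have pb: "\<bar>\<Prod>u\<in>B. f u (w u)\<bar> \<le> 1" for B w
    unfolding abs_prod by (intro prod_le_1) (use insert.prems in auto)
  define h where "h y = (\<integral>\<omega>'. (\<Prod>u\<in>?A. f' u (X u \<omega>')) \<partial>Pr y)" for y
  have hm: "h \<in> borel_measurable borel" using IH unfolding markov_functional_def h_def by blast
  show ?case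
  proof (rule markov_functionalI[OF _ pb hm])
    fix t :: real assume t: "0 \<le> t"
    have "X (t + u) \<in> \<Omega> \<rightarrow>\<^sub>M borel" if "u \<in> insert 0 (insert b A)" for u
      using that A0 vb v0 t by (intro X_meas) auto
    then show "(\<lambda>\<omega>. \<Prod>u\<in>insert 0 (insert b A). f u (X (t + u) \<omega>)) \<in> borel_measurable \<Omega>"
      by (intro borel_measurable_prod measurable_compose[OF _ fm])
  next
    fix t x Y assume t: "0 \<le> (t::real)" and Y: "Y \<in> borel_measurable (F t)" "\<And>\<omega>. \<bar>Y \<omega>\<bar> \<le> (1::real)"
    define Y' where "Y' \<omega> = Y \<omega> * (\<Prod>u\<in>?A. f u (X (t + u) \<omega>))" for \<omega>
    have Y': "Y' \<in> borel_measurable (F (t + v))" unfolding Y'_def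
    proof (intro borel_measurable_times borel_measurable_prod measurable_compose[OF _ fm])
      show "Y \<in> borel_measurable (F (t + v))" by (rule F_measurable_mono[OF _ Y(1)]) (use v0 in auto)
      fix u assume "u \<in> ?A"
      then show "X (t + u) \<in> F (t + v) \<rightarrow>\<^sub>M borel" using Av[of u] A0[of u] t by (intro X_F) auto
    qed
    have Y'b: "\<bar>Y' \<omega>\<bar> \<le> 1" for \<omega>
      unfolding Y'_def abs_mult using Y(2)[of \<omega>] pb[of "\<lambda>u. X (t + u) \<omega>" ?A] by (intro mult_le_one) auto
    have "(\<integral>\<omega>. Y \<omega> * (\<Prod>u\<in>insert 0 (insert b A). f u (X (t + u) \<omega>)) \<partial>Pr x) = (\<integral>\<omega>. Y' \<omega> * f b (X ((t + v) + (b - v)) \<omega>) \<partial>Pr x)"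
      unfolding split[of "\<lambda>u. X (t + u) _"] Y'_def by (simp add: ac_simps)
    also have "\<dots> = (\<integral>\<omega>. Y' \<omega> * g (X (t + v) \<omega>) \<partial>Pr x)"
      unfolding g_def by (rule markov_step[OF _ _ Y' Y'b]) (use t v0 vb insert.prems in auto)
    also have "\<dots> = (\<integral>\<omega>. Y \<omega> * (\<Prod>u\<in>?A. f' u (X (t + u) \<omega>)) \<partial>Pr x)"
      unfolding f'prod[of "\<lambda>u. X (t + u) _"] Y'_def by (simp add: ac_simps)
    also have "\<dots> = (\<integral>\<omega>. Y \<omega> * h (X t \<omega>) \<partial>Pr x)"
      using IH t Y unfolding markov_functional_def h_def by blast
    finally show "(\<integral>\<omega>. Y \<omega> * (\<Prod>u\<in>insert 0 (insert b A). f u (X (t + u) \<omega>)) \<partial>Pr x) = (\<integral>\<omega>. Y \<omega> * h (X t \<omega>) \<partial>Pr x)" .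
  qed
qed

end

section \<open>Paths that remain inside the domain\<close>

locale killed_process = feller_process P \<Omega> F Pr X
  for P :: "real \<Rightarrow> 'a::{metric_space, second_countable_topology} \<Rightarrow> 'a measure"
    and \<Omega> :: "'w measure" and F Pr X +
  fixes D K :: "'a set"
  assumes locally_compact: "locally compact (UNIV :: 'a set)"
    and K_compact: "compact K"
    and D_open: "openin (top_of_set K) D"
begin

lemma D_subset: "D \<subseteq> K"
  using D_open openin_subset by fastforce

lemma K_closed: "closed K"
  using K_compact by (rule compact_imp_closed)

text \<open>
  An exhaustion of \<open>D\<close> by closed sets at positive distance from the boundary. Quantifying over the
  boundary points, instead of using \<open>infdist\<close>, gives \<open>core n = K\<close> when the boundary is empty.
\<close>

definition core :: "nat \<Rightarrow> 'a set" where
  "core n = {x \<in> K. \<forall>c\<in>K - D. 1 / Suc n \<le> dist x c}"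

lemma D_eq_open: obtains O' where "open O'" "D = K \<inter> O'"
  using D_open unfolding openin_open by blast

lemma boundary_closed: "closed (K - D)"
proof -
  obtain O' where "open O'" "D = K \<inter> O'" by (rule D_eq_open)
  then have "K - D = K - O'" by blast
  then show ?thesis using K_closed \<open>open O'\<close> by (simp add: closed_Diff)
qed

lemma boundary_compact: "compact (K - D)"
  using compact_Int_closed[OF K_compact boundary_closed] by (simp add: Int_absorb1)

lemma core_closed: "closed (core n)"
proof -
  have "core n = K \<inter> (\<Inter>c\<in>K - D. {x. 1 / Suc n \<le> dist x c})" by (auto simp: core_def)
  then show ?thesis using K_closed by (auto intro!: closed_Int closed_INT closed_Collect_le continuous_intros)
qed

lemma core_borel[measurable]: "core n \<in> sets borel"
  using core_closed by (rule borel_closed)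

lemma core_mono: "m \<le> n \<Longrightarrow> core m \<subseteq> core n"
proof -
  assume "m \<le> n"
  then have "1 / real (Suc n) \<le> 1 / Suc m" by (auto intro!: inverse_Suc_mono simp del: of_nat_Suc)
  then show ?thesis unfolding core_def by force
qed

lemma core_subset: "core n \<subseteq> D"
proof
  fix x assume x: "x \<in> core n"
  show "x \<in> D"
  proof (rule ccontr)
    assume "x \<notin> D"
    then have "x \<in> K - D" using x by (auto simp: core_def)
    then have "1 / Suc n \<le> dist x x" using x unfolding core_def by blast
    then show False by simp
  qed
qed

text \<open>
  Near a point of \<open>D\<close> the set \<open>K\<close> is contained in one of the cores; this is how relative openness of \<open>D\<close>
  enters the analysis of paths.
\<close>

lemma core_nhd:
  assumes "x \<in> D"
  obtains n O' where "open O'" "x \<in> O'" "K \<inter> O' \<subseteq> core n"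
proof -
  obtain U where U: "open U" "D = K \<inter> U" by (rule D_eq_open)
  then obtain e where e: "e > 0" "ball x e \<subseteq> U" using assms by (meson IntE openE)
  obtain n where n: "1 / Suc n < e / 2" using nat_approx_posE[of "e/2"] e by auto
  show thesis
  proof (rule that[of "ball x (1 / Suc n)" n])
    show "K \<inter> ball x (1 / Suc n) \<subseteq> core n"
    proof
      fix y assume y: "y \<in> K \<inter> ball x (1 / Suc n)"
      have "1 / Suc n \<le> dist y c" if c: "c \<in> K - D" for c
      proof (rule ccontr)
        assume "\<not> 1 / Suc n \<le> dist y c"
        then have "dist x c < e" using y n dist_triangle[of x c y] by auto
        then show False using c e U by auto
      qed
      then show "y \<in> core n" using y by (auto simp: core_def)
    qed
  qed auto
qed

lemma D_borel[measurable]: "D \<in> sets borel"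
proof -
  obtain U where "open U" "D = K \<inter> U" by (rule D_eq_open)
  then show ?thesis using K_closed by auto
qed

lemma K_borel[measurable]: "K \<in> sets borel"
  using K_closed by auto

text \<open>
  The path remains in a fixed core until slightly after time \<open>t\<close>. For a cadlag path this
  says that up to some time after \<open>t\<close> neither the path nor its left limits meet the boundary or leave \<open>K\<close>.
  In contrast to the event that the exit time exceeds \<open>t\<close>, it is determined by countably many coordinates
  (of a right continuous path).
\<close>

definition stays :: "(real \<Rightarrow> 'a) \<Rightarrow> real \<Rightarrow> bool" where
  "stays w t \<longleftrightarrow> (\<exists>n. \<forall>u. 0 \<le> u \<and> u < t + 1 / Suc n \<longrightarrow> w u \<in> core n)"

lemma stays_mono:
  assumes "s \<le> t" "stays w t"
  shows "stays w s"
proof -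
  obtain n where n: "\<And>u. 0 \<le> u \<and> u < t + 1 / Suc n \<Longrightarrow> w u \<in> core n" using assms(2) unfolding stays_def by blast
  show ?thesis unfolding stays_def by (rule exI[of _ n], intro allI impI n) (use assms(1) in linarith)
qed

lemma stays_in_D: "stays w t \<Longrightarrow> 0 \<le> u \<Longrightarrow> u \<le> t \<Longrightarrow> w u \<in> D"
proof -
  assume "stays w t" "0 \<le> u" "u \<le> t"
  then obtain n where n: "\<forall>u. 0 \<le> u \<and> u < t + 1 / Suc n \<longrightarrow> w u \<in> core n" unfolding stays_def by blast
  have "u < t + 1 / Suc n" using \<open>u \<le> t\<close> by (smt (verit) divide_pos_pos of_nat_0_less_iff zero_less_Suc)
  then show ?thesis using n \<open>0 \<le> u\<close> core_subset by blast
qed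

text \<open>
  The multiplicative property of the killing; it becomes the semigroup property of the killed kernels.
\<close>

lemma stays_add:
  assumes "0 \<le> t" "0 \<le> s"
  shows "stays w (t + s) \<longleftrightarrow> stays w t \<and> stays (\<lambda>u. w (t + u)) s"
proof safe
  assume st: "stays w (t + s)"
  then show "stays w t" using stays_mono[of t "t + s"] assms by auto
  obtain n where n: "\<forall>u. 0 \<le> u \<and> u < t + s + 1 / Suc n \<longrightarrow> w u \<in> core n" using st unfolding stays_def by blast
  show "stays (\<lambda>u. w (t + u)) s" unfolding stays_def by (rule exI[of _ n]) (use n assms in auto)
next
  assume "stays w t" "stays (\<lambda>u. w (t + u)) s"
  then obtain n m where n: "\<forall>u. 0 \<le> u \<and> u < t + 1 / Suc n \<longrightarrow> w u \<in> core n"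
    and m: "\<forall>u. 0 \<le> u \<and> u < s + 1 / Suc m \<longrightarrow> w (t + u) \<in> core m" unfolding stays_def by blast
  show "stays w (t + s)" unfolding stays_def
  proof (rule exI[of _ "max n m"], intro allI impI)
    fix u assume u: "0 \<le> u \<and> u < t + s + 1 / Suc (max n m)"
    show "w u \<in> core (max n m)"
    proof (cases "u < t")
      case True
      then have "u < t + 1 / Suc n" by (smt (verit) divide_pos_pos of_nat_0_less_iff zero_less_Suc)
      then show ?thesis using n u core_mono[of n "max n m"] by auto
    next
      case False
      have "1 / real (Suc (max n m)) \<le> 1 / Suc m" by (auto intro!: inverse_Suc_mono simp del: of_nat_Suc)
      then have "w (t + (u - t)) \<in> core m" using False u m[rule_format, of "u - t"] by simp
      then show ?thesis using core_mono[of m "max n m"] by auto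
    qed
  qed
qed

lemma stays_right:
  assumes "stays w t"
  obtains e where "e > 0" "stays w (t + e)"
proof -
  obtain n where n: "\<forall>u. 0 \<le> u \<and> u < t + 1 / Suc n \<longrightarrow> w u \<in> core n" using assms unfolding stays_def by blast
  let ?e = "1 / real (Suc (2 * n + 1))"
  have e: "?e + ?e = 1 / Suc n" by (simp add: field_simps)
  show thesis
  proof (rule that[of ?e])
    show "stays w (t + ?e)" unfolding stays_def
    proof (rule exI[of _ "2 * n + 1"], intro allI impI)
      fix u assume "0 \<le> u \<and> u < t + ?e + ?e"
      then have "w u \<in> core n" using n e by (smt (verit))
      then show "w u \<in> core (2 * n + 1)" using core_mono[of n "2 * n + 1"] by auto
    qed
  qed auto
qed

text \<open>
  The rational times are enumerated as \<open>\<bar>real_of_rat (from_nat i)\<bar>\<close>, so that only nonnegative ones occur.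
\<close>

lemma stays_iff_rational_times:
  assumes w: "right_cont_path w"
  shows "stays w t \<longleftrightarrow> (\<exists>n. \<forall>i. \<bar>real_of_rat (from_nat i)\<bar> < t + 1 / Suc n \<longrightarrow> w \<bar>real_of_rat (from_nat i)\<bar> \<in> core n)"
proof -
  have "(\<forall>u. 0 \<le> u \<and> u < t + 1 / Suc n \<longrightarrow> w u \<in> core n)" 
    if *: "\<forall>i. \<bar>real_of_rat (from_nat i)\<bar> < t + 1 / Suc n \<longrightarrow> w \<bar>real_of_rat (from_nat i)\<bar> \<in> core n" for n
  proof (intro allI impI)
    fix u assume u: "0 \<le> u \<and> u < t + 1 / Suc n"
    show "w u \<in> core n"
    proof (rule right_cont_path_rational_times[OF w core_closed, of 0 "t + 1 / Suc n"])
      fix q :: real assume q: "q \<in> \<rat>" "0 \<le> q" "q < t + 1 / Suc n"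
      obtain r where r: "q = real_of_rat r" using q(1) by (auto elim: Rats_cases)
      obtain i where "from_nat i = r" by (metis from_nat_to_nat)
      then show "w q \<in> core n" using *[rule_format, of i] q r by simp
    qed (use u in auto)
  qed
  then show ?thesis unfolding stays_def by (meson abs_ge_zero)
qed

text \<open>
  Surviving is an increasing union over the cores of decreasing intersections over finitely many
  rational times, and each of the finite events is covered by the product case. The functional is set
  to 0 off the right continuous paths, where rational times do not determine survival.
\<close>

lemma markov_functional_stays:
  assumes f: "f \<in> borel_measurable borel" "\<And>y. \<bar>f y\<bar> \<le> 1" and s: "0 \<le> s"
  shows "markov_functional (\<lambda>w. f (w s) * of_bool (stays w s \<and> right_cont_path w))"
proof -
  define q where "q i = \<bar>real_of_rat (from_nat i)\<bar>" for i
  have q0: "0 \<le> q i" for i by (simp add: q_def)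
  let ?\<Phi> = "\<lambda>n m w. f (w s) * of_bool (\<forall>i<m. q i < s + 1 / Suc n \<longrightarrow> w (q i) \<in> core n)"
  let ?\<Psi> = "\<lambda>n w. f (w s) * of_bool (\<forall>i. q i < s + 1 / Suc n \<longrightarrow> w (q i) \<in> core n)"
  have b: "\<bar>f y * of_bool Q\<bar> \<le> 1" for y Q using f(2)[of y] by (simp add: abs_mult)
  have 1: "markov_functional (?\<Phi> n m)" for n m
  proof -
    (* f is evaluated at time s, membership in core n at the first m rational times of the window. *)
    define J where "J = {q i |i. i < m \<and> q i < s + 1 / Suc n}"
    have fJ: "finite J" unfolding J_def by simp
    define A where "A = insert s J - {0}"
    have iA: "insert 0 A = insert 0 (insert s J)" unfolding A_def by auto
    define g :: "real \<Rightarrow> 'a \<Rightarrow> real" where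
      "g u y = (if u = s then f y else 1) * (if u \<in> J then indicator (core n) y else 1)" for u y
    have gm: "g u \<in> borel_measurable borel" for u
      unfolding g_def using f(1) by measurable
    have gb: "\<bar>g u y\<bar> \<le> 1" for u y
      unfolding g_def using f(2)[of y] by (auto simp: abs_mult indicator_def)
    have "A \<subseteq> {0<..}" using s q0 by (force simp: A_def J_def less_le)
    then have "markov_functional (\<lambda>w. \<Prod>u\<in>insert 0 A. g u (w u))"
      by (intro markov_functional_finite_product gm gb) (use fJ in \<open>auto simp: A_def\<close>)
    also have "(\<lambda>w. \<Prod>u\<in>insert 0 A. g u (w u)) = ?\<Phi> n m"
    proof
      fix w
      let ?B = "insert 0 (insert s J)"
      have "(\<Prod>u\<in>insert 0 A. g u (w u)) = (\<Prod>u\<in>?B. if u = s then f (w u) else 1) * (\<Prod>u\<in>?B. if u \<in> J then indicator (core n) (w u) else 1)"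
        unfolding iA g_def by (rule prod.distrib)
      also have "(\<Prod>u\<in>?B. if u = s then f (w u) else 1) = f (w s)" using fJ by (subst prod.delta) auto
      also have "(\<Prod>u\<in>?B. if u \<in> J then indicator (core n) (w u) else (1::real)) = (\<Prod>u\<in>J. indicator (core n) (w u))"
        using fJ by (intro prod.mono_neutral_cong_right) auto
      also have "\<dots> = of_bool (\<forall>u\<in>J. w u \<in> core n)" using fJ by (induction J rule: finite_induct) auto
      also have "(\<forall>u\<in>J. w u \<in> core n) \<longleftrightarrow> (\<forall>i<m. q i < s + 1 / Suc n \<longrightarrow> w (q i) \<in> core n)"
        unfolding J_def by auto
      finally show "(\<Prod>u\<in>insert 0 A. g u (w u)) = ?\<Phi> n m w" .
    qed
    finally show ?thesis .
  qed
  have 2: "markov_functional (?\<Psi> n)" for n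
  proof (rule markov_functional_limit[OF 1 _ b])
    fix w :: "real \<Rightarrow> 'a"
    show "(\<lambda>m. ?\<Phi> n m w) \<longlonglongrightarrow> ?\<Psi> n w"
    proof (cases "\<forall>i. q i < s + 1 / Suc n \<longrightarrow> w (q i) \<in> core n")
      case False
      then obtain i where i: "\<not> (q i < s + 1 / Suc n \<longrightarrow> w (q i) \<in> core n)" by blast
      have "\<forall>\<^sub>F m in sequentially. ?\<Phi> n m w = ?\<Psi> n w"
        by (rule eventually_sequentiallyI[of "Suc i"]) (use i in auto)
      then show ?thesis by (rule tendsto_eventually)
    qed auto
  qed
  show ?thesis
  proof (rule markov_functional_limit[OF 2 _ b])
    fix w :: "real \<Rightarrow> 'a" assume w: "right_cont_path w"
    show "(\<lambda>n. ?\<Psi> n w) \<longlonglongrightarrow> f (w s) * of_bool (stays w s \<and> right_cont_path w)"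
    proof (cases "stays w s")
      case False
      then have "\<not> (\<forall>i. q i < s + 1 / Suc n \<longrightarrow> w (q i) \<in> core n)" for n
        using stays_iff_rational_times[OF w, of s] unfolding q_def by blast
      then have "(\<lambda>n. ?\<Psi> n w) = (\<lambda>n. 0)" by (intro ext) simp
      with False show ?thesis by (simp only: simp_thms of_bool_eq mult_zero_right tendsto_const)
    next
      case True
      then obtain n where n: "\<And>i. q i < s + 1 / Suc n \<Longrightarrow> w (q i) \<in> core n" using stays_iff_rational_times[OF w, of s] unfolding q_def by blast
      have "\<forall>\<^sub>F m in sequentially. ?\<Psi> m w = f (w s) * of_bool (stays w s \<and> right_cont_path w)"
      proof (rule eventually_sequentiallyI[of n])
        fix m assume "n \<le> m"
        then have "1 / real (Suc m) \<le> 1 / Suc n" by (auto intro!: inverse_Suc_mono simp del: of_nat_Suc)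
        then have "q i < s + 1 / Suc m \<longrightarrow> w (q i) \<in> core m" for i using n[of i] core_mono[OF \<open>n \<le> m\<close>] by auto
        then show "?\<Psi> m w = f (w s) * of_bool (stays w s \<and> right_cont_path w)" using True w by simp
      qed
      then show ?thesis by (rule tendsto_eventually)
    qed
  qed
qed

section \<open>No jump from the boundary into the interior\<close>

text \<open>
  On the dyadic grid of mesh \<open>1 / 2 ^ m\<close>, step \<open>i\<close> is the first one at which the path is in \<open>K\<close> but
  outside \<open>core n\<close>, that is, closer than \<open>1 / Suc n\<close> to the boundary.
\<close>

definition first_near :: "nat \<Rightarrow> nat \<Rightarrow> (real \<Rightarrow> 'a) \<Rightarrow> nat \<Rightarrow> bool" where
  "first_near n m w i \<longleftrightarrow> w (i / 2 ^ m) \<in> K - core n \<and> (\<forall>j\<in>{..<i}. w (real j / 2 ^ m) \<notin> K - core n)"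

text \<open>
  Having come close to the boundary on the grid, the path is back in \<open>core k\<close> after the time \<open>s\<close>.
\<close>

definition escape :: "nat \<Rightarrow> real \<Rightarrow> nat \<Rightarrow> nat \<Rightarrow> (real \<Rightarrow> 'a) \<Rightarrow> bool" where
  "escape k s n m w \<longleftrightarrow> (\<exists>i. first_near n m w i \<and> w (i / 2 ^ m + s) \<in> core k)"

lemma first_near_unique: "first_near n m w i \<Longrightarrow> first_near n m w j \<Longrightarrow> i = j"
  unfolding first_near_def by (cases i j rule: linorder_cases) auto

lemma first_near_measurable: "{\<omega> \<in> space \<Omega>. first_near n m (\<lambda>u. X u \<omega>) i} \<in> sets (F (i / 2 ^ m))"
proof -
  have [measurable]: "X (j / 2 ^ m) \<in> F (i / 2 ^ m) \<rightarrow>\<^sub>M borel" if "j \<le> i" for j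
    using that by (intro X_F) (auto intro!: divide_right_mono)
  have 1: "{\<omega> \<in> space (F (i / 2 ^ m)). X (j / 2 ^ m) \<omega> \<in> K - core n} \<in> sets (F (i / 2 ^ m))" if "j \<le> i" for j
    using that by measurable
  have "{\<omega> \<in> space (F (i / 2 ^ m)). X (i / 2 ^ m) \<omega> \<in> K - core n \<and> (\<forall>j\<in>{..<i}. X (real j / 2 ^ m) \<omega> \<notin> K - core n)} \<in> sets (F (i / 2 ^ m))"
    by (intro sets.sets_Collect_conj sets.sets_Collect_finite_All sets.sets_Collect_neg 1) auto
  then show ?thesis by (simp add: first_near_def)
qed

lemma escape_measurable:
  assumes "0 \<le> s"
  shows "{\<omega> \<in> space \<Omega>. escape k s n m (\<lambda>u. X u \<omega>)} \<in> sets \<Omega>"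
proof -
  have 1: "{\<omega> \<in> space \<Omega>. first_near n m (\<lambda>u. X u \<omega>) i} \<in> sets \<Omega>" for i
    using first_near_measurable sets_F_subset by blast
  have [measurable]: "X (i / 2 ^ m + s) \<in> \<Omega> \<rightarrow>\<^sub>M borel" for i :: nat using assms by (intro X_meas) auto
  have 2: "{\<omega> \<in> space \<Omega>. X (i / 2 ^ m + s) \<omega> \<in> core k} \<in> sets \<Omega>" for i :: nat by measurable
  show ?thesis unfolding escape_def by (intro sets.sets_Collect_countable_Ex sets.sets_Collect_conj 1 2)
qed

text \<open>
  The strong Markov property at a stopping time with values in a grid: the events that the first close
  visit happens at step \<open>i\<close> are disjoint, and on each of them the ordinary Markov property applies.
\<close>

lemma prob_escape_le:
  assumes s: "0 \<le> s" and p: "0 \<le> p" "\<And>y. y \<in> K - core n \<Longrightarrow> measure (P s y) (core k) \<le> p"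
  shows "measure (Pr x) {\<omega> \<in> space \<Omega>. escape k s n m (\<lambda>u. X u \<omega>)} \<le> p"
proof -
  interpret prob_space "Pr x" by (rule prob)
  define E where "E i = {\<omega> \<in> space \<Omega>. first_near n m (\<lambda>u. X u \<omega>) i}" for i
  define H where "H i = {\<omega> \<in> E i. X (i / 2 ^ m + s) \<omega> \<in> core k}" for i
  have EF: "E i \<in> sets (F (i / 2 ^ m))" for i unfolding E_def by (rule first_near_measurable)
  then have E[measurable]: "E i \<in> sets \<Omega>" for i using sets_F_subset by blast
  have Xm[measurable]: "X (i / 2 ^ m + s) \<in> \<Omega> \<rightarrow>\<^sub>M borel" "X (i / 2 ^ m) \<in> \<Omega> \<rightarrow>\<^sub>M borel" for i :: nat using s by (auto intro: X_meas)
  have "H i = E i \<inter> {\<omega> \<in> space \<Omega>. X (i / 2 ^ m + s) \<omega> \<in> core k}" for i by (auto simp: H_def E_def)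
  then have H[measurable]: "H i \<in> sets \<Omega>" for i by simp
  have dE: "disjoint_family E" using first_near_unique by (fastforce simp: disjoint_family_on_def E_def)
  have dH: "disjoint_family H" using dE by (rule disjoint_family_subset) (auto simp: H_def)
  have Hi: "measure (Pr x) (H i) \<le> p * measure (Pr x) (E i)" for i
  proof -
    note markov_op_measurable[OF s, measurable]
    have ic[measurable]: "(indicator (core k) :: 'a \<Rightarrow> real) \<in> borel_measurable borel" by measurable
    have "measure (Pr x) (H i) = (\<integral>\<omega>. indicator (H i) \<omega> \<partial>Pr x)" by (simp add: sets_Pr)
    also have "\<dots> = (\<integral>\<omega>. indicator (E i) \<omega> * indicator (core k) (X (i / 2 ^ m + s) \<omega>) \<partial>Pr x)"
      by (intro Bochner_Integration.integral_cong) (auto simp: H_def indicator_def)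
    also have "\<dots> = (\<integral>\<omega>. indicator (E i) \<omega> * markov_op P s (indicator (core k)) (X (i / 2 ^ m) \<omega>) \<partial>Pr x)"
      by (rule markov_step) (use s EF in \<open>auto simp: indicator_def\<close>)
    also have "\<dots> \<le> (\<integral>\<omega>. p * indicator (E i) \<omega> \<partial>Pr x)"
    proof (rule integral_mono)
      have b: "\<bar>markov_op P s (indicator (core k)) y\<bar> \<le> 1" for y
        by (rule markov_op_bound[OF s]) (auto simp: indicator_def)
      show "integrable (Pr x) (\<lambda>\<omega>. indicator (E i) \<omega> * markov_op P s (indicator (core k)) (X (i / 2 ^ m) \<omega>))"
        by (rule integrable_Pr[of _ 1]) (use b in \<open>auto simp: abs_mult indicator_def\<close>)
      show "integrable (Pr x) (\<lambda>\<omega>. p * indicator (E i) \<omega>)"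
        by (rule integrable_Pr[of _ p]) (use p in \<open>auto simp: indicator_def\<close>)
      fix \<omega>
      have "markov_op P s (indicator (core k)) y \<le> p" if "y \<in> K - core n" for y
        using p(2)[OF that] by (simp add: markov_op_def P_sets[OF s])
      then show "indicator (E i) \<omega> * markov_op P s (indicator (core k)) (X (i / 2 ^ m) \<omega>) \<le> p * indicator (E i) \<omega>"
        by (auto simp: indicator_def E_def first_near_def)
    qed
    finally show ?thesis by (simp add: sets_Pr)
  qed
  have sH: "(\<lambda>i. measure (Pr x) (H i)) sums measure (Pr x) (\<Union>i. H i)"
    by (rule finite_measure_UNION[OF _ dH]) (auto simp: sets_Pr)
  have sE: "(\<lambda>i. measure (Pr x) (E i)) sums measure (Pr x) (\<Union>i. E i)"
    by (rule finite_measure_UNION[OF _ dE]) (auto simp: sets_Pr)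
  have "{\<omega> \<in> space \<Omega>. escape k s n m (\<lambda>u. X u \<omega>)} = (\<Union>i. H i)"
    by (auto simp: escape_def H_def E_def)
  also have "measure (Pr x) (\<Union>i. H i) \<le> p * measure (Pr x) (\<Union>i. E i)"
    by (rule sums_le[OF Hi sH sums_mult[OF sE]])
  also have "\<dots> \<le> p * 1" using p(1) by (intro mult_left_mono) auto
  finally show ?thesis by simp
qed

text \<open>
  By the Feller property, \<open>P s f\<close> is uniformly close to \<open>f\<close> for small \<open>s\<close>. With \<open>f\<close> a cut-off around the boundary
  that vanishes on \<open>core k\<close>, a process started very close to the boundary is unlikely to be in \<open>core k\<close> a
  short time later.
\<close>

lemma prob_escape_small:
  assumes "e > 0"
  obtains s0 where "s0 > 0"
    "\<And>s. 0 < s \<Longrightarrow> s < s0 \<Longrightarrow> \<exists>n0. \<forall>n\<ge>n0. \<forall>m x. measure (Pr x) {\<omega> \<in> space \<Omega>. escape k s n m (\<lambda>u. X u \<omega>)} \<le> e"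
proof (cases "K - D = {}")
  case True
  then have "core n = K" for n by (auto simp: core_def)
  then have "\<not> escape k s n m w" for s n m w by (auto simp: escape_def first_near_def)
  then show thesis using assms by (intro that[of 1]) auto
next
  case False
  obtain r0 where r0: "r0 > 0" "\<And>r. 0 < r \<Longrightarrow> r \<le> r0 \<Longrightarrow> bump (K - D) r \<in> C0 UNIV"
    using bump_in_C0[OF locally_compact boundary_compact False] by blast
  (* The radius is small enough for compact support and for f = 0 on core k. *)
  define r where "r = min r0 (1 / Suc k)"
  have r: "r > 0" "r \<le> r0" "r \<le> 1 / Suc k" using r0 by (auto simp: r_def)
  define f where "f = bump (K - D) r"
  have f: "f \<in> C0 UNIV" unfolding f_def by (rule r0(2)[OF r(1,2)])
  have fk: "f y = 0" if "y \<in> core k" for y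
    unfolding f_def
  proof (rule bump_eq_0[OF r(1)])
    have "1 / Suc k \<le> infdist y (K - D)"
      unfolding infdist_def using False that by (auto simp: core_def intro!: cINF_greatest)
    with r(3) show "r \<le> infdist y (K - D)" by linarith
  qed
  have "\<forall>\<^sub>F s in at_right 0. \<forall>y\<in>UNIV. dist (markov_op P s f y) (f y) < e / 2"
    using strongly_continuous[OF f] assms by (intro uniform_limitD) auto
  then obtain s0 where s0: "s0 > 0" "\<And>s y. 0 < s \<Longrightarrow> s < s0 \<Longrightarrow> dist (markov_op P s f y) (f y) < e / 2"
    by (auto simp: eventually_at_right_field)
  show thesis
  proof (rule that[OF s0(1)])
    fix s :: real assume s: "0 < s" "s < s0"
    obtain n0 where n0: "1 / real (Suc n0) < r * e / 2" using nat_approx_posE[of "r * e / 2"] r assms by auto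
    have "measure (P s y) (core k) \<le> e" if n: "n0 \<le> n" and y: "y \<in> K - core n" for n y
    proof -
      interpret ps: prob_space "P s y" by (rule P_prob) (use s in auto)
      note [measurable_cong] = P_sets[of s y]
      have [measurable_cong]: "sets (P s y) = sets borel" by (rule P_sets) (use s in auto)
      have fm[measurable]: "f \<in> borel_measurable borel" unfolding f_def
        by (rule borel_measurable_continuous_onI[OF bump_continuous])
      obtain c where c: "c \<in> K - D" "dist y c < 1 / Suc n" using y by (force simp: core_def)
      have "infdist y (K - D) \<le> dist y c" using c(1) by (rule infdist_le)
      also have "\<dots> \<le> 1 / Suc n" using c by simp
      also have "\<dots> \<le> 1 / Suc n0" using n by (auto intro!: inverse_Suc_mono simp del: of_nat_Suc)
      finally have "infdist y (K - D) \<le> e / 2 * r" using n0 by (simp add: ac_simps del: of_nat_Suc)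
      then have "infdist y (K - D) / r \<le> e / 2" using r(1) by (simp add: pos_divide_le_eq)
      then have fy: "1 - e / 2 \<le> f y" unfolding f_def bump_def by auto
      have fb: "0 \<le> f z" "f z \<le> 1" for z using bump_bounds(1)[of "K - D" r] bump_bounds(2)[of r "K - D"] r(1) by (auto simp: f_def)
      have fi: "integrable (P s y) f" by (rule ps.integrable_const_bound[of _ 1]) (use fb in auto)
      have ii: "integrable (P s y) (indicator (core k) :: 'a \<Rightarrow> real)" by (rule ps.integrable_const_bound[of _ 1]) auto
      have "measure (P s y) (core k) + markov_op P s f y = (\<integral>z. indicator (core k) z + f z \<partial>P s y)"
        using fi ii by (simp add: markov_op_def P_sets s less_imp_le)
      also have "\<dots> \<le> (\<integral>z. 1 \<partial>P s y)"
        by (rule integral_mono[OF Bochner_Integration.integrable_add[OF ii fi]]) (use fb fk in \<open>auto simp: indicator_def\<close>)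
      finally have "measure (P s y) (core k) \<le> 1 - markov_op P s f y" by (simp add: ps.prob_space)
      moreover have "\<bar>markov_op P s f y - f y\<bar> < e / 2" using s0(2)[OF s] by (simp add: dist_real_def)
      ultimately show ?thesis using fy by linarith
    qed
    then show "\<exists>n0. \<forall>n\<ge>n0. \<forall>m x. measure (Pr x) {\<omega> \<in> space \<Omega>. escape k s n m (\<lambda>u. X u \<omega>)} \<le> e"
      using prob_escape_le[of s e] s assms by (intro exI[of _ n0]) auto
  qed
qed

lemma sets_INT_atLeast:
  assumes "\<And>n. A n \<in> sets M"
  shows "(\<Inter>n\<in>{n0::nat..}. A n) \<in> sets M"
  using sets.countable_INT'[of "{n0..}" A M] assms by (auto simp: countableI_type not_Ici_eq_empty)

lemma measure_liminf_le:
  fixes A :: "nat \<Rightarrow> 'b set"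
  assumes "finite_measure M" "\<And>n. A n \<in> sets M" "\<And>n. n \<ge> N \<Longrightarrow> measure M (A n) \<le> e"
  shows "measure M (\<Union>n0. \<Inter>n\<in>{n0..}. A n) \<le> e"
proof -
  interpret finite_measure M by fact
  define B where "B n0 = (\<Inter>n\<in>{n0..}. A n)" for n0
  have B: "B n \<in> sets M" for n unfolding B_def using assms(2) by (rule sets_INT_atLeast)
  have "incseq B" by (fastforce simp: incseq_def B_def)
  then have "(\<lambda>n. measure M (B n)) \<longlonglongrightarrow> measure M (\<Union>n. B n)" using B by (intro finite_Lim_measure_incseq) auto
  moreover have "measure M (B n) \<le> e" if "n \<ge> N" for n
    using finite_measure_mono[of "B n" "A n"] assms(2,3) that by (force simp: B_def)
  ultimately show ?thesis unfolding B_def by (intro LIMSEQ_le_const2) auto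
qed

text \<open>
  The times at which the path comes within \<open>1 / Suc n\<close> of the boundary announce the time at which its
  left limit reaches the boundary. A path that jumps from such a left limit into the interior belongs
  to one of these sets: at every small time \<open>1 / Suc j\<close> after late announcing times it is in \<open>core k\<close>.
\<close>

definition predictable_escape :: "nat \<Rightarrow> nat \<Rightarrow> 'w set" where
  "predictable_escape k l = {\<omega> \<in> space \<Omega>. \<forall>j\<ge>l. \<exists>n0. \<forall>n\<ge>n0. \<exists>m0. \<forall>m\<ge>m0. escape k (1 / Suc j) n m (\<lambda>u. X u \<omega>)}"

text \<open>
  An instance of quasi-left continuity: a Feller process does not jump at a time
  announced by the approach to the boundary. The exceptional set is null for all starting points
  simultaneously, so the completeness of the filtration applies to its subsets.
\<close>

lemma predictable_escape_null: "(\<Union>k l. predictable_escape k l) \<in> null_sets (Pr x)"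
proof -
  interpret prob_space "Pr x" by (rule prob)
  define A where "A k j n m = {\<omega> \<in> space \<Omega>. escape k (1 / Suc j) n m (\<lambda>u. X u \<omega>)}" for k j n m
  have A: "A k j n m \<in> sets (Pr x)" for k j n m unfolding A_def sets_Pr by (rule escape_measurable) auto
  define B where "B k j n = (\<Union>m0. \<Inter>m\<in>{m0..}. A k j n m)" for k j n
  have B: "B k j n \<in> sets (Pr x)" for k j n
    unfolding B_def using A by (intro sets.countable_UN sets_INT_atLeast image_subsetI)
  define C where "C k j = (\<Union>n0. \<Inter>n\<in>{n0..}. B k j n)" for k j
  have C: "C k j \<in> sets (Pr x)" for k j
    unfolding C_def using B by (intro sets.countable_UN sets_INT_atLeast image_subsetI)
  have pe: "predictable_escape k l = (\<Inter>j\<in>{l..}. C k j)" for k l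
    by (fastforce simp: predictable_escape_def C_def B_def A_def)
  have "predictable_escape k l \<in> null_sets (Pr x)" for k l
  proof -
    have m: "predictable_escape k l \<in> sets (Pr x)" unfolding pe using C by (rule sets_INT_atLeast)
    have "measure (Pr x) (predictable_escape k l) \<le> 0 + e" if "e > 0" for e
    proof -
      obtain s0 where s0: "s0 > 0" and *: "\<And>s. 0 < s \<Longrightarrow> s < s0 \<Longrightarrow> \<exists>n0. \<forall>n\<ge>n0. \<forall>m x. measure (Pr x) {\<omega> \<in> space \<Omega>. escape k s n m (\<lambda>u. X u \<omega>)} \<le> e"
        using prob_escape_small[OF \<open>e > 0\<close>, of k] by blast
      obtain j' where j': "1 / Suc j' < s0" using nat_approx_posE s0 by blast
      (* The event demands the return at all times with index at least l; one small enough time suffices. *)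
      define j where "j = max j' l"
      have "1 / real (Suc j) \<le> 1 / Suc j'" unfolding j_def by (auto intro!: inverse_Suc_mono simp del: of_nat_Suc)
      with j' have js: "1 / real (Suc j) < s0" by linarith
      obtain n0 where n0: "\<And>n m. n \<ge> n0 \<Longrightarrow> measure (Pr x) (A k j n m) \<le> e" using *[OF _ js] unfolding A_def by auto
      have "measure (Pr x) (B k j n) \<le> e" if "n \<ge> n0" for n
        unfolding B_def by (rule measure_liminf_le[OF finite_measure_axioms A n0[OF that]])
      then have "measure (Pr x) (C k j) \<le> e" unfolding C_def by (rule measure_liminf_le[OF finite_measure_axioms B])
      moreover have "measure (Pr x) (predictable_escape k l) \<le> measure (Pr x) (C k j)"
        by (rule finite_measure_mono) (use C in \<open>auto simp: pe j_def\<close>)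
      ultimately show ?thesis by simp
    qed
    then have "measure (Pr x) (predictable_escape k l) \<le> 0" by (rule field_le_epsilon)
    then have "measure (Pr x) (predictable_escape k l) = 0" by (simp add: measure_le_0_iff)
    then show ?thesis using m by (simp add: null_sets_def emeasure_eq_measure)
  qed
  then show ?thesis by (intro null_sets_UN') auto
qed

text \<open>
  A path that is in \<open>D\<close> until after time \<open>t\<close> but does not stay in a single core comes arbitrarily close to
  the boundary. Let \<open>\<sigma>\<close> be the first time at which this happens. Since \<open>w \<sigma> \<in> D\<close>, the path is back in a core
  on an interval to the right of \<open>\<sigma>\<close>, while the times of the first visits close to the boundary increase to
  \<open>\<sigma>\<close> from the left.
\<close>

lemma exit_without_touching:
  assumes w: "right_cont_path w" and t: "0 \<le> t" "t < a"
    and inD: "\<And>u. 0 \<le> u \<Longrightarrow> u < a \<Longrightarrow> w u \<in> D" and ns: "\<not> stays w t"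
  obtains k \<delta> where "\<delta> > 0"
    "\<And>s. 0 < s \<Longrightarrow> s < \<delta> \<Longrightarrow> \<exists>n0. \<forall>n\<ge>n0. \<exists>m0. \<forall>m\<ge>m0. escape k s n m w"
proof -
  define good where "good u \<longleftrightarrow> (\<exists>n. \<forall>v. 0 \<le> v \<and> v < u \<longrightarrow> w v \<in> core n)" for u
  have good_mono: "good u" if "good u'" "u \<le> u'" for u u' using that unfolding good_def by (meson order_less_le_trans)
  have good0: "good u" if "u \<le> 0" for u using that unfolding good_def by auto
  have good_le: "u \<le> t" if "good u" for u
  proof (rule ccontr)
    assume "\<not> u \<le> t"
    then obtain n' where n': "1 / Suc n' < u - t" using nat_approx_posE[of "u - t"] by auto
    obtain n where n: "\<And>v. 0 \<le> v \<and> v < u \<Longrightarrow> w v \<in> core n" using \<open>good u\<close> unfolding good_def by blast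
    have "stays w t" unfolding stays_def
    proof (rule exI[of _ "max n n'"], intro allI impI)
      fix v assume v: "0 \<le> v \<and> v < t + 1 / Suc (max n n')"
      have "1 / real (Suc (max n n')) \<le> 1 / Suc n'" by (auto intro!: inverse_Suc_mono simp del: of_nat_Suc)
      then have "w v \<in> core n" using v n' by (intro n) linarith
      then show "w v \<in> core (max n n')" using core_mono[of n "max n n'"] by auto
    qed
    then show False using ns by blast
  qed
  define \<sigma> where "\<sigma> = Sup (Collect good)"
  have bdd: "bdd_above (Collect good)" using good_le by (auto intro!: bdd_aboveI[of _ t])
  have ne: "Collect good \<noteq> {}" using good0[of 0] by auto
  have \<sigma>t: "\<sigma> \<le> t" unfolding \<sigma>_def using ne good_le by (intro cSup_least) auto
  have \<sigma>0: "0 \<le> \<sigma>" unfolding \<sigma>_def using bdd good0[of 0] by (intro cSup_upper) auto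
  have good_below: "good u" if "u < \<sigma>" for u
  proof -
    have "\<exists>u'\<in>Collect good. u < u'" using that less_cSup_iff[OF ne bdd, of u] unfolding \<sigma>_def by blast
    then show ?thesis using good_mono[of _ u] by auto
  qed
  have not_good: "\<not> good u" if "\<sigma> < u" for u
    using cSup_upper[OF _ bdd, of u] that unfolding \<sigma>_def by auto
  obtain k O' where O': "open O'" "w \<sigma> \<in> O'" "K \<inter> O' \<subseteq> core k"
    by (rule core_nhd[OF inD[of \<sigma>]]) (use \<sigma>0 \<sigma>t t in auto)
  obtain e' where e': "e' > 0" "\<And>s. \<sigma> \<le> s \<Longrightarrow> s < \<sigma> + e' \<Longrightarrow> w s \<in> O'"
    using right_cont_path_open[OF w \<sigma>0 O'(1,2)] by blast
  define e where "e = min e' (a - \<sigma>)"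
  have e0: "e > 0" using e'(1) \<sigma>t t by (auto simp: e_def)
  have core_e: "w s \<in> core k" if "\<sigma> \<le> s" "s < \<sigma> + e" for s
  proof -
    have "w s \<in> D" by (rule inD) (use that \<sigma>0 in \<open>auto simp: e_def\<close>)
    then show ?thesis using O'(3) e'(2)[of s] that D_subset by (auto simp: e_def)
  qed
  (* Otherwise the path would be in a single core up to \<sigma> + e, beyond the supremum. *)
  have hit: "\<exists>v. 0 \<le> v \<and> v < \<sigma> \<and> w v \<notin> core n" for n
  proof (rule ccontr)
    assume *: "\<not> ?thesis"
    have "good (\<sigma> + e)" unfolding good_def
    proof (rule exI[of _ "max n k"], intro allI impI)
      fix v assume "0 \<le> v \<and> v < \<sigma> + e"
      then have "w v \<in> core n \<or> w v \<in> core k" using * core_e[of v] by (cases "v < \<sigma>") auto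
      then show "w v \<in> core (max n k)" using core_mono[of n "max n k"] core_mono[of k "max n k"] by auto
    qed
    then show False using not_good[of "\<sigma> + e"] e0 by auto
  qed
  show thesis
  proof (rule that[OF e0, of k])
    fix s assume s: "0 < s" "s < e"
    (* Visits close to the boundary with large n happen after \<sigma> - s / 2, so s time units later the path
       is to the right of \<sigma>. *)
    have "good (\<sigma> - s / 2)" by (rule good_below) (use s in auto)
    then obtain n0 where n0: "\<And>v. 0 \<le> v \<and> v < \<sigma> - s / 2 \<Longrightarrow> w v \<in> core n0" unfolding good_def by blast
    show "\<exists>n0. \<forall>n\<ge>n0. \<exists>m0. \<forall>m\<ge>m0. escape k s n m w"
    proof (rule exI[of _ n0], intro allI impI)
      fix n assume n: "n0 \<le> n"
      obtain v where v: "0 \<le> v" "v < \<sigma>" "w v \<notin> core n" using hit by blast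
      have ov: "open (- core n)" using core_closed by (simp add: open_Compl)
      have "w v \<in> - core n" using v by simp
      then obtain d' where d': "d' > 0" "\<And>s. v \<le> s \<Longrightarrow> s < v + d' \<Longrightarrow> w s \<in> - core n"
        using right_cont_path_open[OF w v(1) ov] by metis
      (* A grid point between v and v + d exists once the mesh is below d. *)
      define d where "d = min d' (\<sigma> - v)"
      have d0: "d > 0" using d' v by (auto simp: d_def)
      obtain m0 where m0: "(1 / 2) ^ m0 < d" using real_arch_pow_inv[of d "1/2"] d0 by auto
      show "\<exists>m0. \<forall>m\<ge>m0. escape k s n m w"
      proof (rule exI[of _ m0], intro allI impI)
        fix m assume m: "m0 \<le> m"
        have "(1 / 2 :: real) ^ m \<le> (1 / 2) ^ m0" using m by (intro power_decreasing) auto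
        then have md: "1 / 2 ^ m < d" using m0 by (simp add: power_divide)
        define j where "j = nat \<lceil>v * 2 ^ m\<rceil>"
        have "real j = of_int \<lceil>v * 2 ^ m\<rceil>" using v(1) by (simp add: j_def)
        then have j: "v * 2 ^ m \<le> j" "j < v * 2 ^ m + 1" by linarith+
        have j1: "v \<le> j / 2 ^ m" using j(1) by (simp add: field_simps)
        have "j / 2 ^ m < v + 1 / 2 ^ m" using j(2) by (simp add: field_simps)
        then have j2: "j / 2 ^ m < v + d" using md by linarith
        have "w (j / 2 ^ m) \<notin> core n" using d'(2)[of "j / 2 ^ m"] j1 j2 by (auto simp: d_def)
        moreover have "w (j / 2 ^ m) \<in> D" by (rule inD) (use j2 \<sigma>t t in \<open>auto simp: d_def\<close>)
        ultimately have jn: "w (j / 2 ^ m) \<in> K - core n" using D_subset by auto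
        define i where "i = (LEAST i::nat. w (i / 2 ^ m) \<in> K - core n)"
        have i: "w (i / 2 ^ m) \<in> K - core n" unfolding i_def by (rule LeastI[where P="\<lambda>i. w (real i / 2 ^ m) \<in> K - core n", OF jn])
        have ij: "i \<le> j" unfolding i_def by (rule Least_le[where P="\<lambda>i. w (real i / 2 ^ m) \<in> K - core n", OF jn])
        have fn: "first_near n m w i"
          unfolding first_near_def using i not_less_Least[of _ "\<lambda>i. w (real i / 2 ^ m) \<in> K - core n"] by (auto simp: i_def)
        have "i / 2 ^ m \<le> j / 2 ^ m" using ij by (intro divide_right_mono) auto
        then have i1: "i / 2 ^ m < \<sigma>" using j2 by (auto simp: d_def)
        have i2: "\<sigma> - s / 2 \<le> i / 2 ^ m"
          using n0[of "i / 2 ^ m"] i core_mono[OF n] by force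
        have "w (i / 2 ^ m + s) \<in> core k" by (rule core_e) (use i1 i2 s in auto)
        then show "escape k s n m w" using fn unfolding escape_def by blast
      qed
    qed
  qed
qed

definition alive :: "real \<Rightarrow> 'w \<Rightarrow> bool" where
  "alive t \<omega> \<longleftrightarrow> stays (\<lambda>u. X u \<omega>) t"

text \<open>
  Staying in a core slightly beyond \<open>t\<close> keeps the exit time away from \<open>t\<close>.
\<close>

lemma alive_imp_exit: 
  assumes "alive t \<omega>"
  shows "ereal t < exit_time X D \<omega>"
proof -
  obtain e where e: "e > 0" "stays (\<lambda>u. X u \<omega>) (t + e)" using assms stays_right unfolding alive_def by blast
  have "ereal (t + e) \<le> exit_time X D \<omega>"
    unfolding exit_time_def
  proof (rule INF_greatest)
    fix u assume u: "u \<in> {t. 0 \<le> t \<and> X t \<omega> \<notin> D}"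
    then have "t + e < u" using stays_in_D[OF e(2), of u] by force
    then show "ereal (t + e) \<le> ereal u" by simp
  qed
  moreover have "ereal t < ereal (t + e)" using e(1) by simp
  ultimately show ?thesis by (rule less_le_trans[rotated])
qed

text \<open>
  The converse holds off the null set of paths that jump back from the boundary.
\<close>

lemma exit_imp_alive:
  assumes \<omega>: "\<omega> \<in> space \<Omega>" and t: "0 \<le> t" "ereal t < exit_time X D \<omega>"
    and null: "\<omega> \<notin> (\<Union>k l. predictable_escape k l)"
  shows "alive t \<omega>"
proof (rule ccontr)
  assume ns: "\<not> alive t \<omega>"
  obtain a where a: "ereal t < ereal a" "ereal a < exit_time X D \<omega>" using ereal_dense2[OF t(2)] by blast
  have ta: "t < a" using a(1) by simp
  have inD: "X u \<omega> \<in> D" if "0 \<le> u" "u < a" for u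
  proof (rule ccontr)
    assume "X u \<omega> \<notin> D"
    then have "exit_time X D \<omega> \<le> ereal u" unfolding exit_time_def by (intro INF_lower) (use that in auto)
    with a(2) have "ereal a < ereal u" by (rule less_le_trans)
    with that(2) show False by simp
  qed
  show False
  proof (rule exit_without_touching[of "\<lambda>u. X u \<omega>" t a])
    show "right_cont_path (\<lambda>u. X u \<omega>)" by (rule path[OF \<omega>])
    show "\<not> stays (\<lambda>u. X u \<omega>) t" using ns by (simp add: alive_def)
    fix k \<delta>
    assume k: "\<delta> > 0" "\<And>s. 0 < s \<Longrightarrow> s < \<delta> \<Longrightarrow> \<exists>n0. \<forall>n\<ge>n0. \<exists>m0. \<forall>m\<ge>m0. escape k s n m (\<lambda>u. X u \<omega>)"
  obtain l where l: "1 / Suc l < \<delta>" using nat_approx_posE k(1) by blast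
  have "\<omega> \<in> predictable_escape k l"
    unfolding predictable_escape_def
  proof (clarsimp simp: \<omega> simp del: of_nat_Suc)
    fix j assume "l \<le> j"
    then have "1 / real (Suc j) \<le> 1 / Suc l" by (auto intro!: inverse_Suc_mono simp del: of_nat_Suc)
    then show "\<exists>n0. \<forall>n\<ge>n0. \<exists>m0. \<forall>m\<ge>m0. escape k (1 / real (Suc j)) n m (\<lambda>u. X u \<omega>)"
      using l by (intro k(2)) auto
  qed
    with null show False by blast
  qed (use t(1) ta inD in simp_all)
qed

lemma alive_measurable:
  assumes "0 \<le> t"
  shows "{\<omega> \<in> space \<Omega>. alive t \<omega>} \<in> sets \<Omega>"
proof -
  have "markov_functional (\<lambda>w. (\<lambda>_. 1) (w t) * of_bool (stays w t \<and> right_cont_path w))"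
    by (rule markov_functional_stays) (use assms in auto)
  from markov_functionalD(2)[OF this]
  have m: "(\<lambda>\<omega>. of_bool (stays (\<lambda>u. X u \<omega>) t \<and> right_cont_path (\<lambda>u. X u \<omega>)) :: real) \<in> borel_measurable \<Omega>"
    by simp
  have "{\<omega> \<in> space \<Omega>. (of_bool (stays (\<lambda>u. X u \<omega>) t \<and> right_cont_path (\<lambda>u. X u \<omega>)) :: real) = 1} \<in> sets \<Omega>"
    using m by measurable
  also have "{\<omega> \<in> space \<Omega>. (of_bool (stays (\<lambda>u. X u \<omega>) t \<and> right_cont_path (\<lambda>u. X u \<omega>)) :: real) = 1} = {\<omega> \<in> space \<Omega>. alive t \<omega>}"
    using path by (auto simp: alive_def)
  finally show ?thesis .
qed

text \<open>
  The event that the exit time exceeds \<open>t\<close> need not be a Borel event of the path, since hitting a closed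
  set by a cadlag path is an analytic condition. It differs from \<open>alive t\<close> by a subset of a null set, which
  is measurable by completeness.
\<close>

lemma killed_op_eq:
  assumes t: "0 \<le> t" and f: "(\<lambda>y. indicator D y * f y) \<in> borel_measurable borel"
  shows "killed_op Pr X D t f x = (\<integral>\<omega>. indicator D (X t \<omega>) * f (X t \<omega>) * of_bool (alive t \<omega>) \<partial>Pr x)"
proof -
  let ?N = "\<Union>k l. predictable_escape k l"
  let ?S = "{\<omega> \<in> space \<Omega>. ereal t < exit_time X D \<omega>}"
  note [measurable] = X_meas[OF t] f
  have A[measurable]: "{\<omega> \<in> space \<Omega>. alive t \<omega>} \<in> sets \<Omega>" by (rule alive_measurable[OF t])
  then have [measurable]: "Measurable.pred \<Omega> (alive t)" by (simp add: pred_def)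
  have fX: "(\<lambda>\<omega>. indicator D (X t \<omega>) * f (X t \<omega>)) \<in> borel_measurable \<Omega>"
    using measurable_compose[OF X_meas[OF t] f] .
  have "?S \<inter> ?N \<in> sets (F t)" by (rule complete[OF t, of ?N]) (use predictable_escape_null in auto)
  then have SN: "?S \<inter> ?N \<in> sets \<Omega>" using sets_F_subset by blast
  have eq: "?S = {\<omega> \<in> space \<Omega>. alive t \<omega>} \<union> (?S \<inter> ?N)" using alive_imp_exit exit_imp_alive[OF _ t] by blast
  have "?S \<in> sets \<Omega>" by (subst eq) (rule sets.Un[OF A SN])
  then have S[measurable]: "Measurable.pred \<Omega> (\<lambda>\<omega>. ereal t < exit_time X D \<omega>)" by (simp add: pred_def)
  have XD: "X t \<omega> \<in> D" if "ereal t < exit_time X D \<omega>" for \<omega>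
  proof (rule ccontr)
    assume "X t \<omega> \<notin> D"
    then have "exit_time X D \<omega> \<le> ereal t" unfolding exit_time_def by (intro INF_lower) (use t in auto)
    with that show False by simp
  qed
  have "killed_op Pr X D t f x = (\<integral>\<omega>. indicator D (X t \<omega>) * f (X t \<omega>) * of_bool (ereal t < exit_time X D \<omega>) \<partial>Pr x)"
    unfolding killed_op_def using XD by (intro Bochner_Integration.integral_cong) (auto simp: indicator_def)
  also have "\<dots> = (\<integral>\<omega>. indicator D (X t \<omega>) * f (X t \<omega>) * of_bool (alive t \<omega>) \<partial>Pr x)"
  proof (rule integral_cong_AE)
    have "AE \<omega> in Pr x. \<omega> \<notin> ?N" by (rule AE_not_in[OF predictable_escape_null])
    then show "AE \<omega> in Pr x. indicator D (X t \<omega>) * f (X t \<omega>) * of_bool (ereal t < exit_time X D \<omega>) =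
        indicator D (X t \<omega>) * f (X t \<omega>) * of_bool (alive t \<omega>)"
      using AE_space
    proof eventually_elim
      case (elim \<omega>)
      then have "ereal t < exit_time X D \<omega> \<longleftrightarrow> alive t \<omega>" using alive_imp_exit exit_imp_alive[OF _ t] by auto
      then show ?case by simp
    qed
  qed (use fX in \<open>auto simp: measurable_Pr_eq\<close>)
  finally show ?thesis .
qed

section \<open>Killed transition kernels\<close>

text \<open>
  The definition looks slightly into the future of \<open>t\<close>, so membership in \<open>F t\<close> uses the right continuity
  of the filtration.
\<close>

lemma alive_adapted:
  assumes t: "0 \<le> t"
  shows "{\<omega> \<in> space \<Omega>. alive t \<omega>} \<in> sets (F t)"
  unfolding right_continuous[OF t]
proof (rule INT_I)
  fix s assume "s \<in> {t<..}"
  then have s: "t < s" by simp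
  obtain N where N: "1 / real (Suc N) < s - t" using nat_approx_posE[of "s - t"] s by auto
  define q where "q i = \<bar>real_of_rat (from_nat i)\<bar>" for i
  have 1: "alive t \<omega> \<longleftrightarrow> (\<exists>n\<in>{N..}. \<forall>i. q i < t + 1 / Suc n \<longrightarrow> X (q i) \<omega> \<in> core n)" if w: "\<omega> \<in> space \<Omega>" for \<omega>
  proof
    assume "alive t \<omega>"
    then obtain n where n: "\<And>i. q i < t + 1 / Suc n \<Longrightarrow> X (q i) \<omega> \<in> core n"
      unfolding alive_def stays_iff_rational_times[OF path[OF w]] q_def by blast
    have "X (q i) \<omega> \<in> core (max n N)" if "q i < t + 1 / Suc (max n N)" for i
    proof -
      have "1 / real (Suc (max n N)) \<le> 1 / Suc n" by (auto intro!: inverse_Suc_mono simp del: of_nat_Suc)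
      then show ?thesis using n[of i] that core_mono[of n "max n N"] by auto
    qed
    then show "\<exists>n\<in>{N..}. \<forall>i. q i < t + 1 / Suc n \<longrightarrow> X (q i) \<omega> \<in> core n" by (intro bexI[of _ "max n N"]) auto
  next
    assume "\<exists>n\<in>{N..}. \<forall>i. q i < t + 1 / Suc n \<longrightarrow> X (q i) \<omega> \<in> core n"
    then show "alive t \<omega>" unfolding alive_def stays_iff_rational_times[OF path[OF w]] q_def by blast
  qed
  have 2: "{\<omega> \<in> space (F s). q i < t + 1 / Suc n \<longrightarrow> X (q i) \<omega> \<in> core n} \<in> sets (F s)" if "n \<in> {N..}" for n i
  proof (cases "q i < t + 1 / Suc n")
    case True
    have "1 / real (Suc n) \<le> 1 / Suc N" using that by (auto intro!: inverse_Suc_mono simp del: of_nat_Suc)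
    then have "q i \<le> s" using True N by linarith
    then have [measurable]: "X (q i) \<in> F s \<rightarrow>\<^sub>M borel" by (intro X_F) (auto simp: q_def)
    have "{\<omega> \<in> space (F s). X (q i) \<omega> \<in> core n} \<in> sets (F s)" by measurable
    with True show ?thesis by simp
  next
    case False
    then show ?thesis by (metis (mono_tags, lifting) Collect_cong sets.top Collect_mem_eq)
  qed
  have "{\<omega> \<in> space (F s). \<exists>n\<in>{N..}. \<forall>i. q i < t + 1 / Suc n \<longrightarrow> X (q i) \<omega> \<in> core n} \<in> sets (F s)"
    by (intro sets.sets_Collect_countable_Ex' sets.sets_Collect_countable_All 2) (auto simp: countableI_type)
  also have "{\<omega> \<in> space (F s). \<exists>n\<in>{N..}. \<forall>i. q i < t + 1 / Suc n \<longrightarrow> X (q i) \<omega> \<in> core n} = {\<omega> \<in> space \<Omega>. alive t \<omega>}"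
    using 1 by auto
  finally show "{\<omega> \<in> space \<Omega>. alive t \<omega>} \<in> sets (F s)" .
qed

definition survive :: "real \<Rightarrow> ('a \<Rightarrow> real) \<Rightarrow> 'a \<Rightarrow> real" where
  "survive t f x = (\<integral>\<omega>. f (X t \<omega>) * of_bool (alive t \<omega>) \<partial>Pr x)"

lemma alive_pred[measurable]: "0 \<le> t \<Longrightarrow> Measurable.pred \<Omega> (alive t)"
  using alive_measurable by (simp add: pred_def)

lemma survive_integrand_measurable:
  assumes "0 \<le> t" "f \<in> borel_measurable borel"
  shows "(\<lambda>\<omega>. f (X t \<omega>) * of_bool (alive t \<omega>) :: real) \<in> borel_measurable \<Omega>"
proof -
  note [measurable] = X_meas[OF assms(1)] assms(2) alive_pred[OF assms(1)]
  show ?thesis by measurable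
qed

lemma survive_markov:
  assumes f: "f \<in> borel_measurable borel" "\<And>y. \<bar>f y\<bar> \<le> 1" and s: "0 \<le> s"
  shows "survive s f \<in> borel_measurable borel"
    and "0 \<le> t \<Longrightarrow> survive (t + s) f x = (\<integral>\<omega>. of_bool (alive t \<omega>) * survive s f (X t \<omega>) \<partial>Pr x)"
proof -
  define \<Phi> where "\<Phi> w = f (w s) * of_bool (stays w s \<and> right_cont_path w)" for w
  have mf: "markov_functional \<Phi>" unfolding \<Phi>_def by (rule markov_functional_stays[OF f s])
  have eq: "survive s f x = (\<integral>\<omega>. \<Phi> (\<lambda>u. X u \<omega>) \<partial>Pr x)" for x
    unfolding survive_def \<Phi>_def using path by (intro Bochner_Integration.integral_cong) (auto simp: alive_def)
  show "survive s f \<in> borel_measurable borel" unfolding eq[abs_def] by (rule markov_functionalD(3)[OF mf])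
  assume t: "0 \<le> t"
  note [measurable] = alive_adapted[OF t]
  have Y: "(\<lambda>\<omega>. indicator {\<omega> \<in> space \<Omega>. alive t \<omega>} \<omega> :: real) \<in> borel_measurable (F t)" by measurable
  have "survive (t + s) f x = (\<integral>\<omega>. indicator {\<omega> \<in> space \<Omega>. alive t \<omega>} \<omega> * \<Phi> (\<lambda>u. X (t + u) \<omega>) \<partial>Pr x)"
    unfolding survive_def \<Phi>_def using path_shift[OF _ t] stays_add[OF t s]
    by (intro Bochner_Integration.integral_cong) (auto simp: alive_def indicator_def)
  also have "\<dots> = (\<integral>\<omega>. indicator {\<omega> \<in> space \<Omega>. alive t \<omega>} \<omega> * survive s f (X t \<omega>) \<partial>Pr x)"
    unfolding eq by (rule markov_functionalD(4)[OF mf t Y]) (auto simp: indicator_def)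
  also have "\<dots> = (\<integral>\<omega>. of_bool (alive t \<omega>) * survive s f (X t \<omega>) \<partial>Pr x)"
    by (intro Bochner_Integration.integral_cong) (auto simp: indicator_def)
  finally show "survive (t + s) f x = (\<integral>\<omega>. of_bool (alive t \<omega>) * survive s f (X t \<omega>) \<partial>Pr x)" .
qed

lemma alive_in_D: "alive t \<omega> \<Longrightarrow> 0 \<le> t \<Longrightarrow> X t \<omega> \<in> D"
  unfolding alive_def using stays_in_D[of "\<lambda>u. X u \<omega>" t t] by auto

text \<open>
  A surviving path survives a little longer and converges from the right inside \<open>D\<close>; a killed path
  remains killed.
\<close>

lemma survive_right_continuous:
  assumes f: "f \<in> borel_measurable borel" "\<And>y. \<bar>f y\<bar> \<le> B" "continuous_on D f"
    and t: "0 \<le> t" and tn: "\<And>n. t \<le> tn n" "tn \<longlonglongrightarrow> t"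
  shows "(\<lambda>n::nat. survive (tn n) f x) \<longlonglongrightarrow> survive t f x"
  unfolding survive_def
proof (rule integral_dominated_convergence[where w="\<lambda>_. B"])
  have tn0: "0 \<le> tn n" for n using t tn(1)[of n] by linarith
  show "(\<lambda>\<omega>. f (X t \<omega>) * of_bool (alive t \<omega>)) \<in> borel_measurable (Pr x)"
    "(\<lambda>\<omega>. f (X (tn n) \<omega>) * of_bool (alive (tn n) \<omega>)) \<in> borel_measurable (Pr x)" for n
    unfolding measurable_Pr_eq by (rule survive_integrand_measurable[OF _ f(1)], use t tn0 in auto)+
  show "integrable (Pr x) (\<lambda>_. B)" by (rule integrable_Pr[of _ "\<bar>B\<bar>"]) auto
  have B: "0 \<le> B" using f(2)[of undefined] by linarith
  show "AE \<omega> in Pr x. norm (f (X (tn n) \<omega>) * of_bool (alive (tn n) \<omega>)) \<le> B" for n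
    using f(2) B by (intro AE_I2) (auto simp: of_bool_def)
  show "AE \<omega> in Pr x. (\<lambda>n. f (X (tn n) \<omega>) * of_bool (alive (tn n) \<omega>)) \<longlonglongrightarrow> f (X t \<omega>) * of_bool (alive t \<omega>)"
  proof (rule AE_I2)
    fix \<omega> assume "\<omega> \<in> space (Pr x)"
    then have \<omega>: "\<omega> \<in> space \<Omega>" by simp
    show "(\<lambda>n. f (X (tn n) \<omega>) * of_bool (alive (tn n) \<omega>)) \<longlonglongrightarrow> f (X t \<omega>) * of_bool (alive t \<omega>)"
    proof (cases "alive t \<omega>")
      case False
      then have "\<not> alive (tn n) \<omega>" for n using stays_mono[OF tn(1)] unfolding alive_def by blast
      with False show ?thesis by simp
    next
      case True
      obtain e where e: "e > 0" "stays (\<lambda>u. X u \<omega>) (t + e)" using stays_right True unfolding alive_def by blast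
      have ev: "\<forall>\<^sub>F n in sequentially. tn n < t + e" using order_tendstoD(2)[OF tn(2), of "t + e"] e(1) by simp
      have al: "alive (tn n) \<omega>" "X (tn n) \<omega> \<in> D" if "tn n < t + e" for n
        using stays_mono[OF _ e(2), of "tn n"] stays_in_D[OF e(2) tn0, of n] that by (auto simp: alive_def)
      have evD: "\<forall>\<^sub>F n in sequentially. X (tn n) \<omega> \<in> D" using ev by eventually_elim (rule al(2))
      have "(\<lambda>n. X (tn n) \<omega>) \<longlonglongrightarrow> X t \<omega>"
      proof (rule topological_tendstoI)
        fix S assume S: "open S" "X t \<omega> \<in> S"
        obtain d where d: "d > 0" "\<And>s. t \<le> s \<Longrightarrow> s < t + d \<Longrightarrow> X s \<omega> \<in> S"
          using right_cont_path_open[OF path[OF \<omega>] t S] by blast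
        have "\<forall>\<^sub>F n in sequentially. tn n < t + d" using order_tendstoD(2)[OF tn(2), of "t + d"] d(1) by simp
        then show "\<forall>\<^sub>F n in sequentially. X (tn n) \<omega> \<in> S" by eventually_elim (use d(2) tn(1) in auto)
      qed
      then have "(\<lambda>n. f (X (tn n) \<omega>)) \<longlonglongrightarrow> f (X t \<omega>)"
        by (rule continuous_on_tendsto_compose[OF f(3) _ alive_in_D[OF True t] evD])
      moreover have "\<forall>\<^sub>F n in sequentially. f (X (tn n) \<omega>) = f (X (tn n) \<omega>) * of_bool (alive (tn n) \<omega>)"
        using ev by eventually_elim (simp add: al(1))
      ultimately have "(\<lambda>n. f (X (tn n) \<omega>) * of_bool (alive (tn n) \<omega>)) \<longlonglongrightarrow> f (X t \<omega>)"
        by (rule Lim_transform_eventually)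
      then show ?thesis using True by simp
    qed
  qed
qed

text \<open>
  A function that is right continuous in time and measurable in space is the limit of the functions
  obtained by rounding the time up to a grid.
\<close>

lemma survive_jointly_measurable:
  assumes f: "f \<in> borel_measurable borel" "\<And>y. \<bar>f y\<bar> \<le> 1" "continuous_on D f"
  shows "(\<lambda>p. survive (max 0 (fst p)) f (snd p)) \<in> borel_measurable (borel \<Otimes>\<^sub>M borel)"
proof (rule borel_measurable_LIMSEQ_real)
  define a where "a n t = (of_int \<lfloor>real (Suc n) * max 0 t\<rfloor> + 1) / real (Suc n)" for n t
  have a1: "max 0 t \<le> a n t" "a n t \<le> max 0 t + 1 / real (Suc n)" for n t
  proof -
    define m where "m = max 0 t"
    have "real (Suc n) * m \<le> of_int \<lfloor>real (Suc n) * m\<rfloor> + 1"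
      "of_int \<lfloor>real (Suc n) * m\<rfloor> + 1 \<le> real (Suc n) * m + 1" by linarith+
    then show "max 0 t \<le> a n t" "a n t \<le> max 0 t + 1 / real (Suc n)"
      unfolding a_def m_def[symmetric]
      by (simp_all add: pos_le_divide_eq pos_divide_le_eq distrib_right distrib_left mult.commute del: of_nat_Suc)
  qed
  have lim: "(\<lambda>n. a n t) \<longlonglongrightarrow> max 0 t" for t
  proof (rule tendsto_sandwich[of "\<lambda>_. max 0 t" _ _ "\<lambda>n. max 0 t + 1 / real (Suc n)"])
    show "(\<lambda>n. max 0 t + 1 / real (Suc n)) \<longlonglongrightarrow> max 0 t"
      using tendsto_add[OF tendsto_const LIMSEQ_inverse_real_of_nat, of "max 0 t"] by (simp add: inverse_eq_divide)
  qed (use a1 in \<open>auto simp del: of_nat_Suc\<close>)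
  show "(\<lambda>n. survive (a n (fst p)) f (snd p)) \<longlonglongrightarrow> survive (max 0 (fst p)) f (snd p)" for p
    by (rule survive_right_continuous[OF f _ _ lim]) (use a1 in auto)
  show "(\<lambda>p. survive (a n (fst p)) f (snd p)) \<in> borel_measurable (borel \<Otimes>\<^sub>M borel)" for n
  proof -
    have m: "survive (max 0 ((of_int k + 1) / real (Suc n))) f \<in> borel_measurable borel" for k :: int
      by (rule survive_markov(1)[OF f(1,2)]) auto
    have "(\<lambda>p. survive (max 0 ((of_int \<lfloor>real (Suc n) * max 0 (fst p)\<rfloor> + 1) / real (Suc n))) f (snd p)) \<in> borel_measurable (borel \<Otimes>\<^sub>M borel)"
    proof (rule measurable_compose_countable[where f="\<lambda>k p. survive (max 0 ((of_int k + 1) / real (Suc n))) f (snd p)" and g="\<lambda>p. \<lfloor>real (Suc n) * max 0 (fst p)\<rfloor>"])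
      show "(\<lambda>p. survive (max 0 ((of_int k + 1) / real (Suc n))) f (snd p)) \<in> borel_measurable (borel \<Otimes>\<^sub>M borel)" for k :: int
        using measurable_compose[OF measurable_snd m[of k]] .
      show "(\<lambda>p. \<lfloor>real (Suc n) * max 0 (fst p)\<rfloor>) \<in> (borel \<Otimes>\<^sub>M borel) \<rightarrow>\<^sub>M count_space UNIV" by measurable
    qed
    moreover have "max 0 (a n t) = a n t" for t using a1(1)[of t n] by auto
    ultimately show ?thesis unfolding a_def by simp
  qed
qed

text \<open>
  The killed transition kernel as a sub-probability measure. Clamping the time at 0 makes it a function
  on the whole line, on which joint measurability can be stated.
\<close>

definition kern :: "real \<Rightarrow> 'a \<Rightarrow> 'a measure" where
  "kern t x = distr (density (Pr x) (\<lambda>\<omega>. indicator {\<omega> \<in> space \<Omega>. alive (max 0 t) \<omega>} \<omega>)) borel (X (max 0 t))"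

lemma sets_kern[simp, measurable_cong]: "sets (kern t x) = sets borel"
  by (simp add: kern_def)

lemma space_kern[simp]: "space (kern t x) = UNIV"
  by (simp add: kern_def)

lemma nn_integral_kern:
  assumes "0 \<le> t" and f: "f \<in> borel_measurable borel"
  shows "(\<integral>\<^sup>+y. f y \<partial>kern t x) = (\<integral>\<^sup>+\<omega>. f (X t \<omega>) * of_bool (alive t \<omega>) \<partial>Pr x)"
proof -
  note [measurable] = X_meas[OF assms(1)] f alive_measurable[OF assms(1)]
  have [simp]: "max 0 t = t" using assms by simp
  have m: "X t \<in> density (Pr x) (\<lambda>\<omega>. indicator {\<omega> \<in> space \<Omega>. alive t \<omega>} \<omega>) \<rightarrow>\<^sub>M borel"
    using X_meas[OF assms(1)] measurable_cong_sets[OF trans[OF sets_density sets_Pr] refl] by blast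
  have i: "(\<lambda>\<omega>. indicator {\<omega> \<in> space \<Omega>. alive t \<omega>} \<omega> :: ennreal) \<in> borel_measurable (Pr x)"
    unfolding measurable_Pr_eq by measurable
  have fX: "(\<lambda>\<omega>. f (X t \<omega>)) \<in> borel_measurable (Pr x)" unfolding measurable_Pr_eq by measurable
  have "(\<integral>\<^sup>+y. f y \<partial>kern t x) = (\<integral>\<^sup>+\<omega>. f (X t \<omega>) \<partial>density (Pr x) (\<lambda>\<omega>. indicator {\<omega> \<in> space \<Omega>. alive t \<omega>} \<omega>))"
    unfolding kern_def by (simp add: nn_integral_distr[OF m] f)
  also have "\<dots> = (\<integral>\<^sup>+\<omega>. indicator {\<omega> \<in> space \<Omega>. alive t \<omega>} \<omega> * f (X t \<omega>) \<partial>Pr x)"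
    by (rule nn_integral_density[OF i fX])
  also have "\<dots> = (\<integral>\<^sup>+\<omega>. f (X t \<omega>) * of_bool (alive t \<omega>) \<partial>Pr x)"
    by (rule nn_integral_cong) (auto simp: indicator_def)
  finally show ?thesis .
qed

lemma nn_integral_kern_eq_survive:
  assumes t: "0 \<le> t" and f: "f \<in> borel_measurable borel" "\<And>y. y \<in> D \<Longrightarrow> 0 \<le> f y" "\<And>y. y \<in> D \<Longrightarrow> f y \<le> B"
  shows "(\<integral>\<^sup>+y. ennreal (f y) \<partial>kern t x) = ennreal (survive t f x)" and "0 \<le> survive t f x"
    and "integrable (Pr x) (\<lambda>\<omega>. f (X t \<omega>) * of_bool (alive t \<omega>))"
proof -
  have nn: "0 \<le> f (X t \<omega>) * of_bool (alive t \<omega>)" for \<omega> using f(2) alive_in_D[OF _ t, of \<omega>] by auto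
  show int: "integrable (Pr x) (\<lambda>\<omega>. f (X t \<omega>) * of_bool (alive t \<omega>))"
    by (rule integrable_Pr[OF survive_integrand_measurable[OF t f(1)], of "max 0 B"])
      (use f(2,3) alive_in_D[OF _ t] in \<open>force simp: of_bool_def\<close>)
  have "(\<integral>\<^sup>+y. ennreal (f y) \<partial>kern t x) = (\<integral>\<^sup>+\<omega>. ennreal (f (X t \<omega>) * of_bool (alive t \<omega>)) \<partial>Pr x)"
    by (subst nn_integral_kern[OF t]) (use f(1) in \<open>auto intro!: nn_integral_cong simp: of_bool_def\<close>)
  also have "\<dots> = ennreal (survive t f x)" unfolding survive_def by (rule nn_integral_eq_integral[OF int]) (use nn in auto)
  finally show "(\<integral>\<^sup>+y. ennreal (f y) \<partial>kern t x) = ennreal (survive t f x)" .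
  show "0 \<le> survive t f x" unfolding survive_def using nn by (intro integral_nonneg_AE) auto
qed

lemma emeasure_kern:
  assumes "0 \<le> t" "A \<in> sets borel"
  shows "emeasure (kern t x) A = ennreal (survive t (indicator A) x)"
  using nn_integral_kern_eq_survive(1)[OF assms(1), of "indicator A" 1 x] assms(2)
  by (simp add: ennreal_indicator)

lemma kern_max: "kern (max 0 t) x = kern t x"
  by (simp add: kern_def)

lemma emeasure_kern_le_1: "emeasure (kern t x) A \<le> 1"
proof -
  have t: "0 \<le> max 0 t" by simp
  have "emeasure (kern t x) A \<le> emeasure (kern t x) UNIV" by (rule emeasure_mono) auto
  also have "\<dots> = (\<integral>\<^sup>+y. 1 \<partial>kern t x)" by simp
  also have "\<dots> = (\<integral>\<^sup>+\<omega>. 1 * of_bool (alive (max 0 t) \<omega>) \<partial>Pr x)"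
    using nn_integral_kern[OF t, of "\<lambda>_. 1" x] by (simp add: kern_max)
  also have "\<dots> \<le> (\<integral>\<^sup>+\<omega>. 1 \<partial>Pr x)" by (rule nn_integral_mono) auto
  also have "\<dots> = 1" using prob_space.emeasure_space_1[OF prob, of x] by simp
  finally show ?thesis .
qed

lemma subprob_kern: "subprob_space (kern t x)"
  using emeasure_kern_le_1[of t x UNIV] by (intro subprob_spaceI) auto

lemma survive_limit:
  assumes t: "0 \<le> t" and f: "\<And>n. f n \<in> borel_measurable borel" "g \<in> borel_measurable borel" "\<And>n y. \<bar>f n y\<bar> \<le> 1"
    and lim: "\<And>y. (\<lambda>n::nat. f n y) \<longlonglongrightarrow> g y"
  shows "(\<lambda>n. survive t (f n) x) \<longlonglongrightarrow> survive t g x"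
  unfolding survive_def
proof (rule integral_dominated_convergence[where w="\<lambda>_. 1"])
  show "(\<lambda>\<omega>. g (X t \<omega>) * of_bool (alive t \<omega>)) \<in> borel_measurable (Pr x)"
    "(\<lambda>\<omega>. f n (X t \<omega>) * of_bool (alive t \<omega>)) \<in> borel_measurable (Pr x)" for n
    unfolding measurable_Pr_eq using survive_integrand_measurable[OF t] f by auto
  show "integrable (Pr x) (\<lambda>_. 1::real)" by (rule integrable_Pr[of _ 1]) auto
  show "AE \<omega> in Pr x. (\<lambda>n. f n (X t \<omega>) * of_bool (alive t \<omega>)) \<longlonglongrightarrow> g (X t \<omega>) * of_bool (alive t \<omega>)"
    by (intro AE_I2 tendsto_mult lim tendsto_const)
  show "AE \<omega> in Pr x. norm (f n (X t \<omega>) * of_bool (alive t \<omega>)) \<le> 1" for n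
    using f(3) by (intro AE_I2) (auto simp: of_bool_def)
qed

text \<open>
  Joint measurability is inherited from continuous functions to indicators of closed sets, as limits of
  cut-offs, and from these to all Borel sets because the closed sets generate them and are stable under
  intersection.
\<close>

lemma kern_measurable: "(\<lambda>p. kern (fst p) (snd p)) \<in> borel \<Otimes>\<^sub>M borel \<rightarrow>\<^sub>M subprob_algebra borel"
proof (rule measurable_subprob_algebra_generated[where \<Omega>=UNIV and G="Collect closed"])
  show "sets borel = sigma_sets UNIV (Collect (closed :: 'a set \<Rightarrow> bool))"
    by (subst borel_eq_closed) (simp add: sets_measure_of)
  show "Int_stable (Collect (closed :: 'a set \<Rightarrow> bool))" by (auto simp: Int_stable_def)
  have closed: "(\<lambda>p. emeasure (kern (fst p) (snd p)) A) \<in> borel_measurable (borel \<Otimes>\<^sub>M borel)" if A: "closed A" for A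
  proof (cases "A = {}")
    case False
    have [measurable]: "A \<in> sets borel" using A by simp
    have bm: "bump A (1 / real (Suc n)) \<in> borel_measurable borel" for n
      by (rule borel_measurable_continuous_onI[OF bump_continuous])
    have bb: "\<bar>bump A (1 / real (Suc n)) y\<bar> \<le> 1" for n y
      using bump_bounds(1)[of A "1 / real (Suc n)" y] bump_bounds(2)[of "1 / real (Suc n)" A y] by simp
    have "(\<lambda>p. survive (max 0 (fst p)) (indicator A) (snd p)) \<in> borel_measurable (borel \<Otimes>\<^sub>M borel)"
    proof (rule borel_measurable_LIMSEQ_real)
      show "(\<lambda>n. survive (max 0 (fst p)) (bump A (1 / real (Suc n))) (snd p)) \<longlonglongrightarrow> survive (max 0 (fst p)) (indicator A) (snd p)" for p
        by (rule survive_limit) (use bm bb bump_tendsto_indicator[OF A False] in auto)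
      show "(\<lambda>p. survive (max 0 (fst p)) (bump A (1 / real (Suc n))) (snd p)) \<in> borel_measurable (borel \<Otimes>\<^sub>M borel)" for n
        by (rule survive_jointly_measurable[OF bm bb bump_continuous])
    qed
    moreover have "emeasure (kern (fst p) (snd p)) A = ennreal (survive (max 0 (fst p)) (indicator A) (snd p))" for p
      using emeasure_kern[of "max 0 (fst p)" A "snd p"] by (simp add: kern_max)
    ultimately show ?thesis by simp
  qed simp
  show "(\<lambda>p. emeasure (kern (fst p) (snd p)) A) \<in> borel_measurable (borel \<Otimes>\<^sub>M borel)" if "A \<in> Collect closed" for A
    using closed that by simp
  show "(\<lambda>p. emeasure (kern (fst p) (snd p)) UNIV) \<in> borel_measurable (borel \<Otimes>\<^sub>M borel)" by (rule closed) simp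
qed (auto intro: subprob_kern)

lemma kern_measurable': "kern t \<in> borel \<rightarrow>\<^sub>M subprob_algebra borel"
  using measurable_compose[OF _ kern_measurable, of "\<lambda>x. (t, x)" borel] by simp

text \<open>
  The Markov property for the functional \<open>stays\<close> at time \<open>t\<close>, on the event of surviving up to \<open>t\<close>.
\<close>

lemma kern_add:
  assumes t: "0 \<le> t" and s: "0 \<le> s"
  shows "kern (t + s) x = kern t x \<bind> kern s"
proof (rule measure_eqI)
  have k: "kern s \<in> kern t x \<rightarrow>\<^sub>M subprob_algebra borel"
    using kern_measurable'[of s] measurable_cong_sets[OF sets_kern refl] by blast
  show sb: "sets (kern (t + s) x) = sets (kern t x \<bind> kern s)" by (simp add: sets_bind[OF sets_kernel[OF k]])
  fix A assume "A \<in> sets (kern (t + s) x)"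
  then have A[measurable]: "A \<in> sets borel" by simp
  have ib: "\<bar>indicator A y\<bar> \<le> (1::real)" for y by (simp add: indicator_def)
  have im: "(indicator A :: 'a \<Rightarrow> real) \<in> borel_measurable borel" by simp
  have sm: "survive s (indicator A) \<in> borel_measurable borel" by (rule survive_markov(1)[OF im ib s])
  have s01: "0 \<le> survive s (indicator A) y" "survive s (indicator A) y \<le> 1" for y
    using nn_integral_kern_eq_survive(2)[OF s im] emeasure_kern[OF s A] emeasure_kern_le_1[of s y A] by auto
  have "emeasure (kern t x \<bind> kern s) A = (\<integral>\<^sup>+y. emeasure (kern s y) A \<partial>kern t x)"
    by (rule emeasure_bind[OF _ k A]) simp
  also have "\<dots> = (\<integral>\<^sup>+y. ennreal (survive s (indicator A) y) \<partial>kern t x)" by (simp add: emeasure_kern[OF s])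
  also have "\<dots> = ennreal (survive t (survive s (indicator A)) x)"
    by (rule nn_integral_kern_eq_survive(1)[OF t sm]) (use s01 in auto)
  also have "survive t (survive s (indicator A)) x = survive (t + s) (indicator A) x"
    unfolding survive_markov(2)[OF im ib s t] by (simp add: survive_def mult.commute)
  also have "ennreal \<dots> = emeasure (kern (t + s) x) A" using emeasure_kern[of "t + s" A x] t s by simp
  finally show "emeasure (kern (t + s) x) A = emeasure (kern t x \<bind> kern s) A" ..
qed

lemma nn_integral_kern_add:
  assumes t: "0 \<le> t" and s: "0 \<le> s" and f: "f \<in> borel_measurable borel"
  shows "(\<integral>\<^sup>+y. f y \<partial>kern (t + s) x) = (\<integral>\<^sup>+y. (\<integral>\<^sup>+z. f z \<partial>kern s y) \<partial>kern t x)"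
proof -
  have k: "kern s \<in> kern t x \<rightarrow>\<^sub>M subprob_algebra borel"
    using kern_measurable'[of s] measurable_cong_sets[OF sets_kern refl] by blast
  show ?thesis unfolding kern_add[OF t s] by (rule nn_integral_bind[OF f k])
qed

section \<open>The Green operator\<close>

text \<open>
  The Green kernel acting on nonnegative Borel functions with values in the extended half-line, where
  Tonelli's theorem applies without integrability conditions.
\<close>

definition green :: "('a \<Rightarrow> ennreal) \<Rightarrow> 'a \<Rightarrow> ennreal" where
  "green f x = (\<integral>\<^sup>+t. indicator {0..} t * (\<integral>\<^sup>+y. f y \<partial>kern t x) \<partial>lborel)"

lemma nn_integral_kern_measurable:
  assumes "f \<in> borel_measurable borel"
  shows "(\<lambda>p. \<integral>\<^sup>+y. f y \<partial>kern (fst p) (snd p)) \<in> borel_measurable (borel \<Otimes>\<^sub>M borel)"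
  using measurable_compose[OF kern_measurable nn_integral_measurable_subprob_algebra[OF assms]] .

lemma nn_integral_kern_measurable1:
  assumes "f \<in> borel_measurable borel"
  shows "(\<lambda>x. \<integral>\<^sup>+y. f y \<partial>kern t x) \<in> borel_measurable borel"
  using measurable_compose[OF _ nn_integral_kern_measurable[OF assms], of "\<lambda>x. (t, x)" borel] by simp

lemma nn_integral_kern_measurable2:
  assumes "f \<in> borel_measurable borel"
  shows "(\<lambda>t. \<integral>\<^sup>+y. f y \<partial>kern t x) \<in> borel_measurable borel"
  using measurable_compose[OF _ nn_integral_kern_measurable[OF assms], of "\<lambda>t. (t, x)" borel] by simp

lemma kern_pair_measurable:
  assumes f: "f \<in> borel_measurable borel" and M: "sets M = sets borel"
  shows "(\<lambda>(x, s). indicator {u..} s * (\<integral>\<^sup>+y. f y \<partial>kern s x)) \<in> borel_measurable (M \<Otimes>\<^sub>M lborel)"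
proof -
  have "(\<lambda>p. \<integral>\<^sup>+y. f y \<partial>kern (snd p) (fst p)) \<in> borel_measurable (borel \<Otimes>\<^sub>M borel)"
    using measurable_compose[OF measurable_Pair[OF measurable_snd measurable_fst] nn_integral_kern_measurable[OF f]] by simp
  moreover have "(\<lambda>p. indicator {u..} (snd p) :: ennreal) \<in> borel_measurable ((borel :: 'a measure) \<Otimes>\<^sub>M borel)"
    by (rule measurable_compose[OF measurable_snd]) simp
  ultimately have m: "(\<lambda>p. indicator {u..} (snd p) * (\<integral>\<^sup>+y. f y \<partial>kern (snd p) (fst p))) \<in> borel_measurable ((borel :: 'a measure) \<Otimes>\<^sub>M borel)"
    by (intro borel_measurable_times_ennreal) auto
  have e: "sets (M \<Otimes>\<^sub>M lborel) = sets ((borel :: 'a measure) \<Otimes>\<^sub>M (borel :: real measure))"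
    by (intro sets_pair_measure_cong) (auto simp: M)
  from m show ?thesis unfolding case_prod_beta' measurable_cong_sets[OF e refl] .
qed

lemma kern_tonelli:
  assumes f: "f \<in> borel_measurable borel" and M: "sets M = sets borel" "sigma_finite_measure M"
  shows "(\<integral>\<^sup>+x. (\<integral>\<^sup>+s. indicator {u..} s * (\<integral>\<^sup>+y. f y \<partial>kern s x) \<partial>lborel) \<partial>M) =
    (\<integral>\<^sup>+s. indicator {u..} s * (\<integral>\<^sup>+x. (\<integral>\<^sup>+y. f y \<partial>kern s x) \<partial>M) \<partial>lborel)"
proof -
  interpret sigma_finite_measure M by (rule M)
  interpret pair_sigma_finite M lborel ..
  have "(\<lambda>x. \<integral>\<^sup>+y. f y \<partial>kern s x) \<in> borel_measurable M" for s
    using nn_integral_kern_measurable1[OF f] measurable_cong_sets[OF M(1) refl] by blast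
  then show ?thesis
    unfolding Fubini'[OF kern_pair_measurable[OF f M(1)], symmetric] by (intro nn_integral_cong nn_integral_cmult)
qed

lemma green_measurable:
  assumes "f \<in> borel_measurable borel"
  shows "green f \<in> borel_measurable borel"
  unfolding green_def[abs_def] by (rule lborel.borel_measurable_nn_integral[OF kern_pair_measurable[OF assms refl]])

text \<open>
  Both orders of composing the Green operator with the killed semigroup give the tail of the time
  integral.
\<close>

lemma kern_green:
  assumes t: "0 \<le> t" and f: "f \<in> borel_measurable borel"
  shows "(\<integral>\<^sup>+y. green f y \<partial>kern t x) = (\<integral>\<^sup>+s. indicator {t..} s * (\<integral>\<^sup>+y. f y \<partial>kern s x) \<partial>lborel)"
proof -
  interpret subprob_space "kern t x" by (rule subprob_kern)
  have "(\<integral>\<^sup>+y. green f y \<partial>kern t x) = (\<integral>\<^sup>+s. indicator {0..} s * (\<integral>\<^sup>+y. (\<integral>\<^sup>+z. f z \<partial>kern s y) \<partial>kern t x) \<partial>lborel)"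
    unfolding green_def by (rule kern_tonelli[OF f sets_kern sigma_finite_measure_axioms])
  also have "\<dots> = (\<integral>\<^sup>+s. indicator {t..} (t + 1 * s) * (\<integral>\<^sup>+y. f y \<partial>kern (t + 1 * s) x) \<partial>lborel)"
  proof (rule nn_integral_cong)
    fix s :: real
    show "indicator {0..} s * (\<integral>\<^sup>+y. (\<integral>\<^sup>+z. f z \<partial>kern s y) \<partial>kern t x) = indicator {t..} (t + 1 * s) * (\<integral>\<^sup>+y. f y \<partial>kern (t + 1 * s) x)"
      using nn_integral_kern_add[OF t _ f, of s x] by (auto simp: indicator_def)
  qed
  also have "\<dots> = (\<integral>\<^sup>+s. indicator {t..} s * (\<integral>\<^sup>+y. f y \<partial>kern s x) \<partial>lborel)"
    by (subst nn_integral_real_affine[of _ 1 t]) (use nn_integral_kern_measurable2[OF f] in auto)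
  finally show ?thesis .
qed

lemma green_kern:
  assumes t: "0 \<le> t" and f: "f \<in> borel_measurable borel"
  shows "green (\<lambda>y. \<integral>\<^sup>+z. f z \<partial>kern t y) x = (\<integral>\<^sup>+s. indicator {t..} s * (\<integral>\<^sup>+y. f y \<partial>kern s x) \<partial>lborel)"
proof -
  have "green (\<lambda>y. \<integral>\<^sup>+z. f z \<partial>kern t y) x = (\<integral>\<^sup>+s. indicator {t..} (t + 1 * s) * (\<integral>\<^sup>+y. f y \<partial>kern (t + 1 * s) x) \<partial>lborel)"
    unfolding green_def
  proof (rule nn_integral_cong)
    fix s :: real
    show "indicator {0..} s * (\<integral>\<^sup>+y. (\<integral>\<^sup>+z. f z \<partial>kern t y) \<partial>kern s x) = indicator {t..} (t + 1 * s) * (\<integral>\<^sup>+y. f y \<partial>kern (t + 1 * s) x)"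
      using nn_integral_kern_add[OF _ t f, of s x] by (auto simp: indicator_def add.commute)
  qed
  also have "\<dots> = (\<integral>\<^sup>+s. indicator {t..} s * (\<integral>\<^sup>+y. f y \<partial>kern s x) \<partial>lborel)"
    by (subst nn_integral_real_affine[of _ 1 t]) (use nn_integral_kern_measurable2[OF f] in auto)
  finally show ?thesis .
qed

lemma measurable_kern: "f \<in> borel_measurable borel \<Longrightarrow> f \<in> borel_measurable (kern t x)"
  using measurable_cong_sets[OF sets_kern refl] by blast

lemma green_add:
  assumes f: "f \<in> borel_measurable borel" and g: "g \<in> borel_measurable borel"
  shows "green (\<lambda>y. f y + g y) x = green f x + green g x"
proof -
  have "green (\<lambda>y. f y + g y) x = (\<integral>\<^sup>+t. indicator {0..} t * (\<integral>\<^sup>+y. f y \<partial>kern t x) + indicator {0..} t * (\<integral>\<^sup>+y. g y \<partial>kern t x) \<partial>lborel)"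
    unfolding green_def by (intro nn_integral_cong) (simp add: nn_integral_add measurable_kern f g distrib_left)
  also have "\<dots> = green f x + green g x"
    unfolding green_def by (rule nn_integral_add) (use nn_integral_kern_measurable2 f g in auto)
  finally show ?thesis .
qed

lemma green_cmult:
  assumes f: "f \<in> borel_measurable borel"
  shows "green (\<lambda>y. c * f y) x = c * green f x"
proof -
  have "green (\<lambda>y. c * f y) x = (\<integral>\<^sup>+t. c * (indicator {0..} t * (\<integral>\<^sup>+y. f y \<partial>kern t x)) \<partial>lborel)"
    unfolding green_def by (intro nn_integral_cong) (simp add: nn_integral_cmult measurable_kern f ac_simps)
  also have "\<dots> = c * green f x"
    unfolding green_def by (rule nn_integral_cmult) (use nn_integral_kern_measurable2 f in auto)
  finally show ?thesis .
qed

lemma kern_mono: "(\<And>y. y \<in> D \<Longrightarrow> f y \<le> g y) \<Longrightarrow> 0 \<le> t \<Longrightarrow> f \<in> borel_measurable borel \<Longrightarrow> g \<in> borel_measurable borel \<Longrightarrow>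
    (\<integral>\<^sup>+y. f y \<partial>kern t x) \<le> (\<integral>\<^sup>+y. g y \<partial>kern t x)"
  by (simp add: nn_integral_kern) (intro nn_integral_mono, auto simp: of_bool_def alive_in_D)

lemma green_mono:
  assumes "\<And>y. y \<in> D \<Longrightarrow> f y \<le> g y" "f \<in> borel_measurable borel" "g \<in> borel_measurable borel"
  shows "green f x \<le> green g x"
  unfolding green_def by (intro nn_integral_mono) (auto simp: indicator_def intro!: kern_mono assms)

lemma green_cong:
  assumes "\<And>y. y \<in> D \<Longrightarrow> f y = g y" "f \<in> borel_measurable borel" "g \<in> borel_measurable borel"
  shows "green f x = green g x"
  by (intro antisym green_mono) (use assms in auto)

lemma green_SUP:
  assumes f: "\<And>i::nat. f i \<in> borel_measurable borel" and inc: "incseq f"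
  shows "green (\<lambda>y. SUP i. f i y) x = (SUP i. green (f i) x)"
proof -
  have "green (\<lambda>y. SUP i. f i y) x = (\<integral>\<^sup>+t. (SUP i. indicator {0..} t * (\<integral>\<^sup>+y. f i y \<partial>kern t x)) \<partial>lborel)"
    unfolding green_def
    by (intro nn_integral_cong) (simp add: nn_integral_monotone_convergence_SUP[OF inc measurable_kern[OF f]] SUP_mult_left_ennreal)
  also have "\<dots> = (SUP i. \<integral>\<^sup>+t. indicator {0..} t * (\<integral>\<^sup>+y. f i y \<partial>kern t x) \<partial>lborel)"
  proof (rule nn_integral_monotone_convergence_SUP)
    show "incseq (\<lambda>i t. indicator {0..} t * (\<integral>\<^sup>+y. f i y \<partial>kern t x) :: ennreal)"
      using inc by (auto simp: incseq_def le_fun_def intro!: mult_left_mono nn_integral_mono)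
  qed (use nn_integral_kern_measurable2 f in auto)
  finally show ?thesis unfolding green_def .
qed

text \<open>
  For \<open>x \<in> D\<close> the kernel at time 0 need not be the unit mass at \<open>x\<close>, since the process may leave \<open>K\<close>
  instantaneously; for \<open>x \<notin> D\<close> all kernels vanish.
\<close>

lemma kern_started_outside:
  assumes "x \<notin> D" "0 \<le> t" "f \<in> borel_measurable borel"
  shows "(\<integral>\<^sup>+y. f y \<partial>kern t x) = 0"
proof -
  have "AE \<omega> in Pr x. f (X t \<omega>) * of_bool (alive t \<omega>) = 0"
    using start[of x]
  proof eventually_elim
    case (elim \<omega>)
    have "\<not> alive t \<omega>"
    proof
      assume "alive t \<omega>"
      then have "X 0 \<omega> \<in> D" unfolding alive_def using stays_in_D[of "\<lambda>u. X u \<omega>" t 0] assms(2) by auto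
      with elim assms(1) show False by simp
    qed
    then show ?case by simp
  qed
  then have "(\<integral>\<^sup>+\<omega>. f (X t \<omega>) * of_bool (alive t \<omega>) \<partial>Pr x) = (\<integral>\<^sup>+\<omega>. 0 \<partial>Pr x)"
    by (rule nn_integral_cong_AE)
  then show ?thesis by (simp add: nn_integral_kern assms)
qed

lemma green_started_outside:
  assumes "x \<notin> D" "f \<in> borel_measurable borel"
  shows "green f x = 0"
proof -
  have "green f x = (\<integral>\<^sup>+t. 0 \<partial>(lborel :: real measure))"
    unfolding green_def by (intro nn_integral_cong) (auto simp: indicator_def kern_started_outside assms)
  then show ?thesis by simp
qed

text \<open>
  By right continuity, positivity at one time persists on a time interval of positive length.
\<close>

lemma green_pos:
  assumes f: "f \<in> borel_measurable borel" "\<And>y. 0 \<le> f y" "\<And>y. f y \<le> B" "continuous_on D f"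
    and t: "0 \<le> t" and pos: "survive t f x > 0"
  shows "green (\<lambda>y. ennreal (f y)) x > 0"
proof -
  have ab: "\<bar>f y\<bar> \<le> B" for y using f(2,3)[of y] by simp
  have ex: "\<exists>e>0. \<forall>s. t \<le> s \<and> s < t + e \<longrightarrow> survive s f x > 0"
  proof (rule ccontr)
    assume "\<not> ?thesis"
    then have "\<forall>n::nat. \<exists>s. t \<le> s \<and> s < t + 1 / Suc n \<and> \<not> survive s f x > 0"
      by (metis of_nat_0_less_iff zero_less_Suc zero_less_divide_1_iff)
    then obtain s where s: "\<And>n. t \<le> s n" "\<And>n. s n < t + 1 / real (Suc n)" "\<And>n. \<not> survive (s n) f x > 0" by metis
    have "s \<longlonglongrightarrow> t"
    proof (rule tendsto_sandwich[of "\<lambda>_. t" _ _ "\<lambda>n. t + 1 / real (Suc n)"])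
      show "(\<lambda>n. t + 1 / real (Suc n)) \<longlonglongrightarrow> t"
        using tendsto_add[OF tendsto_const LIMSEQ_inverse_real_of_nat, of t] by (simp add: inverse_eq_divide)
    qed (use s(1,2) in \<open>auto intro!: always_eventually less_imp_le simp del: of_nat_Suc\<close>)
    then have "(\<lambda>n. survive (s n) f x) \<longlonglongrightarrow> survive t f x"
      by (intro survive_right_continuous[OF f(1) ab f(4) t s(1)])
    then have "survive t f x \<le> 0" by (rule LIMSEQ_le_const2) (use s(3) in \<open>auto simp: not_less\<close>)
    with pos show False by simp
  qed
  then obtain e where e: "e > 0" "\<And>s. t \<le> s \<Longrightarrow> s < t + e \<Longrightarrow> survive s f x > 0" by blast
  show ?thesis
  proof (rule ccontr)
    assume "\<not> ?thesis"
    then have "(\<integral>\<^sup>+s. indicator {0..} s * (\<integral>\<^sup>+y. ennreal (f y) \<partial>kern s x) \<partial>lborel) = 0" by (simp add: green_def)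
    then have "AE s in lborel. indicator {0..} s * (\<integral>\<^sup>+y. ennreal (f y) \<partial>kern s x) = 0"
      by (subst (asm) nn_integral_0_iff_AE) (use nn_integral_kern_measurable2 f in auto)
    then have "AE s in lborel. s \<notin> {t..<t+e}"
    proof eventually_elim
      case (elim s)
      show ?case
      proof
        assume s: "s \<in> {t..<t+e}"
        then have s0: "0 \<le> s" using t by simp
        have "(\<integral>\<^sup>+y. ennreal (f y) \<partial>kern s x) = ennreal (survive s f x)"
          by (rule nn_integral_kern_eq_survive(1)[OF s0 f(1)]) (use f in auto)
        with elim s0 have "ennreal (survive s f x) = 0" by (simp add: indicator_def)
        with e(2)[of s] s show False by simp
      qed
    qed
    then have "emeasure lborel {t..<t+e} = 0" by (subst (asm) AE_iff_measurable[of "{t..<t+e}"]) auto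
    with e(1) show False by simp
  qed
qed

lemma law_of_X:
  assumes t: "0 \<le> t" and f: "f \<in> borel_measurable borel" "\<And>y. \<bar>f y\<bar> \<le> 1"
  shows "(\<integral>\<omega>. f (X t \<omega>) \<partial>Pr x) = markov_op P t f x"
proof -
  note markov_op_measurable[OF t f(1), measurable]
  have [measurable]: "X 0 \<in> \<Omega> \<rightarrow>\<^sub>M borel" by (simp add: X_meas)
  have "(\<integral>\<omega>. f (X t \<omega>) \<partial>Pr x) = (\<integral>\<omega>. markov_op P t f (X 0 \<omega>) \<partial>Pr x)"
    using markov_step[of 0 t "\<lambda>_. 1" f x] t f by simp
  also have "\<dots> = (\<integral>\<omega>. markov_op P t f x \<partial>Pr x)"
    by (rule integral_cong_AE) (use start[of x] in \<open>auto elim!: eventually_mono simp: measurable_Pr_eq\<close>)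
  finally show ?thesis by simp
qed

lemma green_op_eq:
  assumes f: "f \<in> Cb D" "\<And>y. y \<in> D \<Longrightarrow> 0 \<le> f y"
  shows "green_op Pr X D f x = enn2real (green (\<lambda>y. ennreal (indicator D y * f y)) x)"
proof -
  let ?f = "\<lambda>y. indicator D y * f y"
  have fm: "?f \<in> borel_measurable borel"
    using borel_measurable_continuous_on_indicator[OF D_borel, of f] f(1) by (simp add: Cb_def)
  obtain B where B: "\<And>y. y \<in> D \<Longrightarrow> \<bar>f y\<bar> \<le> B" using f(1) by (auto simp: Cb_def bounded_iff)
  have ko: "killed_op Pr X D t f x = survive t ?f x" if "0 \<le> t" for t
    unfolding killed_op_eq[OF that fm] survive_def ..
  have se: "ennreal (survive t ?f x) = (\<integral>\<^sup>+y. ennreal (?f y) \<partial>kern t x)" "0 \<le> survive t ?f x" if "0 \<le> t" for t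
    using nn_integral_kern_eq_survive(1,2)[OF that fm, of B x] f(2) B by force+
  have "green_op Pr X D f x = (LINT t|lborel. indicator {0..} t * enn2real (\<integral>\<^sup>+y. ennreal (?f y) \<partial>kern t x))"
    unfolding green_op_def set_lebesgue_integral_def
    by (intro Bochner_Integration.integral_cong) (auto simp: indicator_def[of "{0..}"] ko se(1)[symmetric] se(2))
  also have "\<dots> = enn2real (\<integral>\<^sup>+t. ennreal (indicator {0..} t * enn2real (\<integral>\<^sup>+y. ennreal (?f y) \<partial>kern t x)) \<partial>lborel)"
    by (rule integral_eq_nn_integral) (use nn_integral_kern_measurable2[of "\<lambda>y. ennreal (?f y)"] fm in auto)
  also have "(\<integral>\<^sup>+t. ennreal (indicator {0..} t * enn2real (\<integral>\<^sup>+y. ennreal (?f y) \<partial>kern t x)) \<partial>lborel) = green (\<lambda>y. ennreal (?f y)) x"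
    unfolding green_def by (intro nn_integral_cong) (auto simp: indicator_def[of "{0..}"] se(1)[symmetric] se(2))
  finally show ?thesis .
qed

lemma killed_kernel_eq:
  assumes t: "0 \<le> t" and A: "A \<in> sets borel"
  shows "killed_kernel Pr X D t x A = measure (kern t x) A"
proof -
  have m: "(\<lambda>y. indicator D y * indicator (A \<inter> D) y :: real) \<in> borel_measurable borel" using A by measurable
  have "killed_kernel Pr X D t x A = survive t (indicator A) x"
    unfolding killed_kernel_def killed_op_eq[OF t m] survive_def
    by (intro Bochner_Integration.integral_cong) (auto simp: indicator_def alive_in_D[OF _ t])
  moreover have "0 \<le> survive t (indicator A) x"
    using nn_integral_kern_eq_survive(2)[OF t, of "indicator A" 1] A by auto
  ultimately show ?thesis using emeasure_kern[OF t A] by (simp add: measure_def)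
qed

end

section \<open>Exponential decay of the survival probability\<close>

locale regular_killed_process = killed_process P \<Omega> F Pr X D K
  for P :: "real \<Rightarrow> 'a::{metric_space, second_countable_topology} \<Rightarrow> 'a measure"
    and \<Omega> :: "'w measure" and F Pr X and D K :: "'a set" +
  assumes D_nonempty: "D \<noteq> {}"
    and accessible: "\<forall>x\<in>K. \<exists>t\<ge>0. measure (P t x) (UNIV - K) > 0"
    and green_Cb: "\<forall>f\<in>Cb D. green_op Pr X D f \<in> C0 D"
begin

lemma survive_one_le:
  assumes t: "0 \<le> t" and f: "f \<in> borel_measurable borel" "\<And>y. 0 \<le> f y" "\<And>y. f y \<le> 1" "\<And>y. y \<in> D \<Longrightarrow> f y = 1"
  shows "survive t (\<lambda>_. 1) x \<le> markov_op P t f x"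
proof -
  note [measurable] = X_meas[OF t] f(1)
  have "survive t (\<lambda>_. 1) x \<le> (\<integral>\<omega>. f (X t \<omega>) \<partial>Pr x)"
    unfolding survive_def
  proof (rule integral_mono)
    show "integrable (Pr x) (\<lambda>\<omega>. 1 * of_bool (alive t \<omega>) :: real)"
      using nn_integral_kern_eq_survive(3)[OF t, of "\<lambda>_. 1" 1] by simp
    show "integrable (Pr x) (\<lambda>\<omega>. f (X t \<omega>))" by (rule integrable_Pr[of _ 1]) (use f(2,3) in \<open>auto simp: abs_le_iff intro: order_trans[of _ 0]\<close>)
    show "1 * of_bool (alive t \<omega>) \<le> f (X t \<omega>)" for \<omega> using f(2,4) alive_in_D[OF _ t, of \<omega>] by (auto simp: of_bool_def)
  qed
  also have "\<dots> = markov_op P t f x" by (rule law_of_X[OF t f(1)]) (use f(2,3) in \<open>auto simp: abs_le_iff intro: order_trans[of _ 0]\<close>)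
  finally show ?thesis .
qed

lemma survive_one_antimono:
  assumes "0 \<le> s" "s \<le> t"
  shows "survive t (\<lambda>_. 1) x \<le> survive s (\<lambda>_. 1) x"
  unfolding survive_def
proof (rule integral_mono)
  show "integrable (Pr x) (\<lambda>\<omega>. 1 * of_bool (alive t \<omega>) :: real)"
    "integrable (Pr x) (\<lambda>\<omega>. 1 * of_bool (alive s \<omega>) :: real)"
    using nn_integral_kern_eq_survive(3)[of _ "\<lambda>_. 1" 1] assms by auto
  show "1 * of_bool (alive t \<omega>) \<le> (1 * of_bool (alive s \<omega>) :: real)" for \<omega>
    using stays_mono[OF assms(2)] by (auto simp: of_bool_def alive_def)
qed

text \<open>
  The probability of being in \<open>K\<close> at time \<open>t\<close> is below 1 at \<open>x\<close>, hence so is \<open>P t\<close> of a suitable cut-off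
  around \<open>K\<close>; the latter is continuous in the starting point by the Feller property and dominates the
  probability of survival.
\<close>

lemma exit_probability_near:
  assumes x: "x \<in> K"
  obtains V t d where "open V" "x \<in> V" "0 \<le> t" "d > 0" "\<And>y. y \<in> V \<Longrightarrow> survive t (\<lambda>_. 1) y \<le> 1 - d"
proof -
  have Kne: "K \<noteq> {}" using x by blast
  obtain t where t: "0 \<le> t" "measure (P t x) (UNIV - K) > 0" using accessible x by blast
  interpret p: prob_space "P t x" by (rule P_prob[OF t(1)])
  have sP[measurable_cong]: "sets (P t x) = sets borel" by (rule P_sets[OF t(1)])
  have spP: "space (P t x) = UNIV" using sets_eq_imp_space_eq[OF sP] by simp
  have less1: "measure (P t x) K < 1" using t(2) p.prob_compl[of K] K_borel by (simp add: sP spP)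
  obtain r0 where r0: "r0 > 0" "\<And>r. 0 < r \<Longrightarrow> r \<le> r0 \<Longrightarrow> bump K r \<in> C0 UNIV"
    using bump_in_C0[OF locally_compact K_compact Kne] by blast
  let ?b = "\<lambda>n. bump K (1 / real (Suc n))"
  have bm[measurable]: "?b n \<in> borel_measurable borel" for n by (rule borel_measurable_continuous_onI[OF bump_continuous])
  have b01: "0 \<le> ?b n y" "?b n y \<le> 1" for n y using bump_bounds(1)[of K "1 / real (Suc n)" y] bump_bounds(2)[of "1 / real (Suc n)" K y] by auto
  have "(\<lambda>n. \<integral>y. ?b n y \<partial>P t x) \<longlonglongrightarrow> (\<integral>y. indicator K y \<partial>P t x)"
  proof (rule integral_dominated_convergence[where w="\<lambda>_. 1"])
    show "AE y in P t x. (\<lambda>n. ?b n y) \<longlonglongrightarrow> indicator K y"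
      using bump_tendsto_indicator[OF K_closed Kne] by simp
    show "AE y in P t x. norm (?b n y) \<le> 1" for n using b01 by simp
  qed (use K_borel in \<open>auto simp del: of_nat_Suc\<close>)
  then have "(\<lambda>n. markov_op P t (?b n) x) \<longlonglongrightarrow> measure (P t x) K" by (simp add: markov_op_def spP)
  then have "\<forall>\<^sub>F n in sequentially. markov_op P t (?b n) x < 1" using less1 by (rule order_tendstoD(2))
  moreover have "\<forall>\<^sub>F n in sequentially. 1 / real (Suc n) \<le> r0"
  proof -
    obtain N where N: "1 / real (Suc N) < r0" using nat_approx_posE r0 by blast
    show ?thesis
    proof (rule eventually_sequentiallyI[of N])
      fix n assume "N \<le> n"
      then have "1 / real (Suc n) \<le> 1 / Suc N" by (auto intro!: inverse_Suc_mono simp del: of_nat_Suc)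
      with N show "1 / real (Suc n) \<le> r0" by linarith
    qed
  qed
  ultimately have "\<forall>\<^sub>F n in sequentially. markov_op P t (?b n) x < 1 \<and> 1 / real (Suc n) \<le> r0" by (rule eventually_conj)
  then obtain n where n: "markov_op P t (?b n) x < 1" "1 / real (Suc n) \<le> r0" by (auto simp: eventually_sequentially)
  define d where "d = (1 - markov_op P t (?b n) x) / 2"
  have d: "d > 0" "markov_op P t (?b n) x < 1 - d" using n(1) by (auto simp: d_def field_simps)
  have "?b n \<in> C0 UNIV" using n(2) by (intro r0(2)) auto
  then have "markov_op P t (?b n) \<in> C0 UNIV" using t(1) by (rule feller[rotated])
  then have cont: "continuous_on UNIV (markov_op P t (?b n))" by (rule C0_continuous_on)
  show thesis
  proof (rule that[of "{y. markov_op P t (?b n) y < 1 - d}" t d])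
    show "open {y. markov_op P t (?b n) y < 1 - d}"
      by (rule open_Collect_less[OF cont continuous_on_const])
    fix y assume "y \<in> {y. markov_op P t (?b n) y < 1 - d}"
    moreover have "survive t (\<lambda>_. 1) y \<le> markov_op P t (?b n) y"
      by (rule survive_one_le[OF t(1) bm b01]) (use D_subset in \<open>auto intro: bump_eq_1\<close>)
    ultimately show "survive t (\<lambda>_. 1) y \<le> 1 - d" by simp
  qed (use d t(1) in auto)
qed

text \<open>
  Compactness of \<open>K\<close>, together with the fact that the probability of survival decreases in time.
\<close>

lemma uniform_exit:
  obtains T d where "T > 0" "0 < d" "d \<le> 1" "\<And>y. survive T (\<lambda>_. 1) y \<le> 1 - d"
proof -
  have "\<forall>x. \<exists>V t d. x \<in> K \<longrightarrow> open V \<and> x \<in> V \<and> 0 \<le> t \<and> d > 0 \<and> (\<forall>y\<in>V. survive t (\<lambda>_. 1) y \<le> 1 - d)"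
    using exit_probability_near by metis
  then obtain V t d where V: "\<And>x. x \<in> K \<Longrightarrow> open (V x)" "\<And>x. x \<in> K \<Longrightarrow> x \<in> V x" "\<And>x. x \<in> K \<Longrightarrow> 0 \<le> t x"
    "\<And>x. x \<in> K \<Longrightarrow> d x > 0" "\<And>x y. x \<in> K \<Longrightarrow> y \<in> V x \<Longrightarrow> survive (t x) (\<lambda>_. 1) y \<le> 1 - d x" by metis
  obtain A where A: "A \<subseteq> K" "finite A" "K \<subseteq> (\<Union>x\<in>A. V x)"
    by (rule compactE_image[OF K_compact, of K V]) (use V in blast)+
  define T where "T = Max (insert 1 (t ` A))"
  define e where "e = Min (insert 1 (d ` A))"
  show thesis
  proof (rule that[of T e])
    show "T > 0" unfolding T_def using A(2) by (subst Max_gr_iff) auto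
    show "e > 0" unfolding e_def using A V(4) by (subst Min_gr_iff) auto
    show "e \<le> 1" unfolding e_def using A(2) by (intro Min_le) auto
    fix y
    show "survive T (\<lambda>_. 1) y \<le> 1 - e"
    proof (cases "y \<in> K")
      case True
      then obtain x where x: "x \<in> A" "y \<in> V x" using A(3) by blast
      have "t x \<le> T" unfolding T_def using A(2) x by (intro Max_ge) auto
      then have "survive T (\<lambda>_. 1) y \<le> survive (t x) (\<lambda>_. 1) y" using V(3) x A(1) by (intro survive_one_antimono) auto
      also have "\<dots> \<le> 1 - d x" using V(5) x A(1) by auto
      also have "\<dots> \<le> 1 - e" unfolding e_def using A(2) x by simp
      finally show ?thesis .
    next
      case False
      then have "(\<integral>\<^sup>+z. ennreal 1 \<partial>kern T y) = 0" using D_subset \<open>T > 0\<close> by (intro kern_started_outside) auto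
      then have "survive T (\<lambda>_. 1) y \<le> 0" using nn_integral_kern_eq_survive(1)[of T "\<lambda>_. 1" 1 y] \<open>T > 0\<close> by (simp add: ennreal_eq_0_iff)
      with \<open>e \<le> 1\<close> show ?thesis by simp
    qed
  qed
qed

text \<open>
  Iterating the uniform bound through the semigroup property gives exponential decay of the probability
  of survival, so its time integral is bounded.
\<close>

lemma green_one_bounded:
  obtains C where "C > 0" "\<And>x. green (\<lambda>_. 1) x \<le> ennreal C"
proof -
  obtain T d where T: "T > 0" "0 < d" "d \<le> 1" "\<And>y. survive T (\<lambda>_. 1) y \<le> 1 - d" using uniform_exit by blast
  have q: "(\<integral>\<^sup>+z. 1 \<partial>kern t y) = ennreal (survive t (\<lambda>_. 1) y)" if "0 \<le> t" for t y
    using nn_integral_kern_eq_survive(1)[OF that, of "\<lambda>_. 1" 1 y] by simp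
  have it: "(\<integral>\<^sup>+z. 1 \<partial>kern (real n * T) y) \<le> ennreal ((1 - d) ^ n)" for n y
  proof (induction n arbitrary: y)
    case 0
    show ?case using emeasure_kern_le_1[of 0 y UNIV] by simp
  next
    case (Suc n)
    have "(\<integral>\<^sup>+z. 1 \<partial>kern (T + real n * T) y) = (\<integral>\<^sup>+z. (\<integral>\<^sup>+w. 1 \<partial>kern (real n * T) z) \<partial>kern T y)"
      using T(1) by (intro nn_integral_kern_add) auto
    also have "\<dots> \<le> (\<integral>\<^sup>+z. ennreal ((1 - d) ^ n) * 1 \<partial>kern T y)" by (intro nn_integral_mono) (use Suc in simp)
    also have "\<dots> = ennreal ((1 - d) ^ n) * (\<integral>\<^sup>+z. 1 \<partial>kern T y)" by (rule nn_integral_cmult) simp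
    also have "\<dots> \<le> ennreal ((1 - d) ^ n) * ennreal (1 - d)"
      using q[of T y] T by (intro mult_left_mono) (auto intro!: ennreal_leI)
    also have "\<dots> = ennreal ((1 - d) ^ Suc n)" using T by (simp add: ennreal_mult[symmetric] mult.commute)
    finally show ?case by (simp add: algebra_simps)
  qed
  have decay: "(\<integral>\<^sup>+z. 1 \<partial>kern t y) \<le> ennreal (exp (d - d / T * t))" if t: "0 \<le> t" for t y
  proof -
    define n where "n = nat \<lfloor>t / T\<rfloor>"
    have n: "real n \<le> t / T" "t / T \<le> real n + 1" using t T(1) by (auto simp: n_def)
    have "real n * T \<le> t" using n(1) T(1) by (simp add: field_simps)
    then have "survive t (\<lambda>_. 1) y \<le> survive (real n * T) (\<lambda>_. 1) y" using T(1) by (intro survive_one_antimono) auto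
    then have "(\<integral>\<^sup>+z. 1 \<partial>kern t y) \<le> (\<integral>\<^sup>+z. 1 \<partial>kern (real n * T) y)"
      using q[OF t] q[of "real n * T" y] T(1) by (simp add: ennreal_leI)
    also have "\<dots> \<le> ennreal ((1 - d) ^ n)" by (rule it)
    also have "\<dots> \<le> ennreal (exp (- d) ^ n)"
      using exp_ge_add_one_self[of "- d"] T by (intro ennreal_leI power_mono) auto
    also have "exp (- d) ^ n = exp (- d * real n)" by (simp add: exp_of_nat_mult[symmetric] mult.commute)
    also have "ennreal \<dots> \<le> ennreal (exp (d - d / T * t))"
    proof (intro ennreal_leI, simp only: exp_le_cancel_iff)
      have "d * (t / T) \<le> d * (real n + 1)" using n(2) T(2) by (intro mult_left_mono) auto
      then show "- d * real n \<le> d - d / T * t" by (simp add: algebra_simps)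
    qed
    finally show ?thesis .
  qed
  show thesis
  proof (rule that[of "exp d * T / d"])
    show "exp d * T / d > 0" using T by simp
    fix x
    have "green (\<lambda>_. 1) x \<le> (\<integral>\<^sup>+t. ennreal (exp (d - d / T * t)) * indicator {0..} t \<partial>lborel)"
      unfolding green_def using decay by (intro nn_integral_mono) (auto simp: indicator_def)
    also have "\<dots> = ennreal (0 - - (T / d) * exp (d - d / T * 0))"
    proof (rule nn_integral_FTC_atLeast)
      show "DERIV (\<lambda>t. - (T / d) * exp (d - d / T * t)) t :> exp (d - d / T * t)" for t
        using T by (auto intro!: derivative_eq_intros)
      show "((\<lambda>t. - (T / d) * exp (d - d / T * t)) \<longlongrightarrow> 0) at_top"
      proof -
        have "filterlim (\<lambda>t. d / T * t) at_top at_top" using T by (intro filterlim_tendsto_pos_mult_at_top[OF tendsto_const]) (auto simp: filterlim_ident)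
        then have "filterlim (\<lambda>t. - d + d / T * t) at_top at_top" by (rule filterlim_tendsto_add_at_top[OF tendsto_const])
        then have "filterlim (\<lambda>t. - (- d + d / T * t)) at_bot at_top" by (simp only: filterlim_uminus_at_top)
        then have "((\<lambda>t. exp (- (- d + d / T * t))) \<longlongrightarrow> 0) at_top" by (rule filterlim_compose[OF exp_at_bot])
        then have "((\<lambda>t. exp (d - d / T * t)) \<longlongrightarrow> 0) at_top" by (simp only: minus_add_distrib minus_minus diff_conv_add_uminus)
        then show ?thesis by (rule tendsto_mult_right_zero)
      qed
    qed auto
    finally show "green (\<lambda>_. 1) x \<le> ennreal (exp d * T / d)" by (simp add: mult.commute)
  qed
qed

lemma green_le_const:
  assumes f: "f \<in> borel_measurable borel" "\<And>y. y \<in> D \<Longrightarrow> f y \<le> c"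
  shows "green f x \<le> c * green (\<lambda>_. 1) x"
  using green_mono[of f "\<lambda>_. c * 1" x] f green_cmult[of "\<lambda>_. 1" c x] by simp

lemma green_C0:
  assumes f: "f \<in> borel_measurable borel" "continuous_on D f" "\<And>y. y \<in> D \<Longrightarrow> 0 \<le> f y" "\<And>y. y \<in> D \<Longrightarrow> f y \<le> B"
  shows "(\<lambda>x. enn2real (green (\<lambda>y. ennreal (f y)) x)) \<in> C0 D"
    and "green_op Pr X D f x = enn2real (green (\<lambda>y. ennreal (f y)) x)"
proof -
  have cb: "f \<in> Cb D" using f unfolding Cb_def bounded_iff by (auto intro!: exI[of _ B] simp: abs_le_iff)
    (meson f(3) f(4) neg_le_0_iff_le order_trans)
  have eq: "green_op Pr X D f x = enn2real (green (\<lambda>y. ennreal (f y)) x)" for x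
  proof -
    have "green_op Pr X D f x = enn2real (green (\<lambda>y. ennreal (indicator D y * f y)) x)"
      by (rule green_op_eq[OF cb]) (rule f(3))
    also have "green (\<lambda>y. ennreal (indicator D y * f y)) x = green (\<lambda>y. ennreal (f y)) x"
      by (rule green_cong) (use f(1) in auto)
    finally show ?thesis .
  qed
  show "green_op Pr X D f x = enn2real (green (\<lambda>y. ennreal (f y)) x)" by (rule eq)
  show "(\<lambda>x. enn2real (green (\<lambda>y. ennreal (f y)) x)) \<in> C0 D"
    using green_Cb cb unfolding eq[abs_def, symmetric] by auto
qed

lemma green_finite:
  assumes "f \<in> borel_measurable borel" "\<And>y. y \<in> D \<Longrightarrow> f y \<le> B"
  shows "green (\<lambda>y. ennreal (f y)) x < top"
proof -
  obtain C where C: "C > 0" "\<And>x. green (\<lambda>_. 1) x \<le> ennreal C" using green_one_bounded by blast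
  have "green (\<lambda>y. ennreal (f y)) x \<le> ennreal B * green (\<lambda>_. 1) x"
    by (rule green_le_const) (use assms in \<open>auto intro: ennreal_leI\<close>)
  also have "\<dots> \<le> ennreal B * ennreal C" by (intro mult_left_mono C(2)) auto
  also have "\<dots> < top" by (simp add: ennreal_mult_less_top)
  finally show ?thesis .
qed

section \<open>Accessible sets and Lyapunov functions\<close>

text \<open>
  Condition (ii) restated for the extended Green operator and the zero extension of \<open>\<phi>\<close>.
\<close>

lemma lyapunov_zero_extension:
  assumes \<phi>C0: "\<phi> \<in> C0 D" and \<theta>: "\<theta> > 0" and \<phi>pos: "\<And>x. x \<in> D \<Longrightarrow> \<phi> x > 0"
    and ly: "\<And>x. x \<in> D \<Longrightarrow> green_op Pr X D \<phi> x \<ge> \<theta> * \<phi> x"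
  obtains p B where "p \<in> borel_measurable borel" "\<And>y. 0 \<le> p y" "B > 0" "\<And>y. p y \<le> B"
    "\<And>y. y \<in> D \<Longrightarrow> p y = \<phi> y" "\<And>y. y \<notin> D \<Longrightarrow> p y = 0"
    "\<And>x. ennreal (\<theta> * p x) \<le> green (\<lambda>y. ennreal (p y)) x"
proof -
  define p where "p y = indicator D y * \<phi> y" for y
  have \<phi>c: "continuous_on D \<phi>" by (rule C0_continuous_on[OF \<phi>C0])
  have pm: "p \<in> borel_measurable borel"
    using borel_measurable_continuous_on_indicator[OF D_borel \<phi>c] by (simp add: p_def[abs_def])
  have p0: "0 \<le> p y" for y using \<phi>pos[of y] by (cases "y \<in> D") (auto simp: p_def)
  obtain B where B: "B > 0" "\<And>x. x \<in> D \<Longrightarrow> \<bar>\<phi> x\<bar> \<le> B" using C0_bounded[OF \<phi>C0] by blast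
  have pB: "p y \<le> B" for y using B(1) B(2)[of y] by (cases "y \<in> D") (auto simp: p_def)
  have \<phi>Cb: "\<phi> \<in> Cb D" using \<phi>c B unfolding Cb_def bounded_iff by auto
  have eq: "green_op Pr X D \<phi> x = enn2real (green (\<lambda>y. ennreal (p y)) x)" for x
    unfolding p_def by (rule green_op_eq[OF \<phi>Cb]) (use \<phi>pos in \<open>auto intro: less_imp_le\<close>)
  have lyg: "ennreal (\<theta> * p x) \<le> green (\<lambda>y. ennreal (p y)) x" for x
  proof (cases "x \<in> D")
    case True
    have "ennreal (\<theta> * p x) \<le> ennreal (enn2real (green (\<lambda>y. ennreal (p y)) x))"
      using ly[OF True] True unfolding eq by (intro ennreal_leI) (simp add: p_def)
    also have "\<dots> = green (\<lambda>y. ennreal (p y)) x" using green_finite[OF pm pB, of x] by simp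
    finally show ?thesis .
  qed (simp add: p_def)
  show thesis by (rule that[OF pm p0 B(1) pB _ _ lyg]) (simp_all add: p_def)
qed

text \<open>
  (i) implies (ii). Let \<open>f\<close> be a cut-off around \<open>closure (U \<inter> K)\<close> with compact support \<open>C'\<close> in \<open>D\<close>. Then
  \<open>\<phi> = G f\<close> is positive since \<open>U\<close> is accessible, and \<open>f \<le> \<phi> / \<theta>\<close> with \<open>\<theta>\<close> the minimum of \<open>\<phi>\<close> on \<open>C'\<close>.
  Applying \<open>G\<close> gives \<open>\<theta> \<phi> \<le> G \<phi>\<close>.
\<close>

lemma lyapunov_if_accessible:
  assumes U: "open U" "\<forall>x\<in>D. D_accessible Pr X D U x" "closure (U \<inter> K) \<subseteq> D"
  shows "\<exists>\<phi>\<in>C0 D. \<exists>\<theta>>0. (\<forall>x\<in>D. \<phi> x > 0) \<and> (\<forall>x\<in>D. green_op Pr X D \<phi> x \<ge> \<theta> * \<phi> x)"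
proof -
  define C where "C = closure (U \<inter> K)"
  have CK: "C \<subseteq> K" using U(3) D_subset by (auto simp: C_def)
  have Cc: "compact C" using compact_Int_closed[OF K_compact, of C] CK by (simp add: C_def Int_absorb1)
  have acc: "\<exists>t\<ge>0. measure (kern t x) U > 0" if "x \<in> D" for x
  proof -
    obtain t where t: "0 \<le> t" "killed_kernel Pr X D t x U > 0" using U(2) \<open>x \<in> D\<close> unfolding D_accessible_def by blast
    have "U \<in> sets borel" using U(1) by simp
    then show ?thesis using killed_kernel_eq[OF t(1), of U x] t by auto
  qed
  have UDC: "U \<inter> D \<subseteq> C" unfolding C_def using D_subset closure_subset by fastforce
  have Cne: "C \<noteq> {}"
  proof
    assume "C = {}"
    obtain x where x: "x \<in> D" using D_nonempty by blast
    obtain t where t: "0 \<le> t" "measure (kern t x) U > 0" using acc x by blast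
    have "emeasure (kern t x) U = (\<integral>\<^sup>+y. indicator U y \<partial>kern t x)" using U(1) by simp
    also have "\<dots> \<le> (\<integral>\<^sup>+y. 0 \<partial>kern t x)"
    proof (rule kern_mono[OF _ t(1)])
      show "indicator U \<in> borel_measurable borel" using U(1) by simp
    qed (use UDC \<open>C = {}\<close> in \<open>auto simp: indicator_def\<close>)
    finally show False using t(2) by (simp add: measure_def)
  qed
  obtain O' where O': "open O'" "D = K \<inter> O'" by (rule D_eq_open)
  have "C \<subseteq> O'" using U(3) O'(2) by (auto simp: C_def)
  then obtain e where e: "e > 0" "(\<Union>x\<in>C. ball x e) \<subseteq> O'"
    using compact_subset_open_imp_ball_epsilon_subset[OF Cc O'(1)] by blast
  define \<rho> where "\<rho> = e / 2"
  have \<rho>: "\<rho> > 0" "\<rho> < e" using e by (auto simp: \<rho>_def)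
  define C' where "C' = K \<inter> {y. infdist y C \<le> \<rho>}"
  have C'c: "compact C'" unfolding C'_def
    by (intro compact_Int_closed K_compact closed_Collect_le continuous_intros)
  have C'D: "C' \<subseteq> D"
  proof
    fix y assume y: "y \<in> C'"
    then have "infdist y C < e" using \<rho> by (auto simp: C'_def)
    then obtain c where "c \<in> C" "dist y c < e" using infdist_less_ex Cne by blast
    then have "y \<in> O'" using e(2) by (force simp: dist_commute)
    then show "y \<in> D" using y O'(2) by (auto simp: C'_def)
  qed
  have CC': "C \<subseteq> C'" using CK \<rho>(1) by (auto simp: C'_def)
  define f where "f = bump C \<rho>"
  have fm[measurable]: "f \<in> borel_measurable borel" unfolding f_def by (rule borel_measurable_continuous_onI[OF bump_continuous])
  have fc: "continuous_on D f" unfolding f_def by (rule bump_continuous)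
  have f0: "0 \<le> f y" and f1: "f y \<le> 1" for y using bump_bounds(1)[of C \<rho> y] bump_bounds(2)[OF \<rho>(1), of C y] by (auto simp: f_def)
  define \<phi> where "\<phi> x = enn2real (green (\<lambda>y. ennreal (f y)) x)" for x
  have gm[measurable]: "green (\<lambda>y. ennreal (f y)) \<in> borel_measurable borel" by (rule green_measurable) measurable
  have \<phi>m[measurable]: "\<phi> \<in> borel_measurable borel" unfolding \<phi>_def by measurable
  have \<phi>C0: "\<phi> \<in> C0 D" unfolding \<phi>_def by (rule green_C0(1)[OF fm fc f0 f1])
  have gfin: "green (\<lambda>y. ennreal (f y)) x < top" for x by (rule green_finite[OF fm f1])
  have \<phi>e: "ennreal (\<phi> x) = green (\<lambda>y. ennreal (f y)) x" for x using gfin by (simp add: \<phi>_def)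
  have \<phi>0: "0 \<le> \<phi> x" for x by (simp add: \<phi>_def)
  have \<phi>pos: "\<phi> x > 0" if x: "x \<in> D" for x
  proof -
    obtain t where t: "0 \<le> t" "measure (kern t x) U > 0" using acc x by blast
    have "0 < emeasure (kern t x) U" using t(2) by (metis measure_def enn2real_0 less_irrefl not_gr_zero)
    also have "\<dots> = (\<integral>\<^sup>+y. indicator U y \<partial>kern t x)" using U(1) by simp
    also have "\<dots> \<le> (\<integral>\<^sup>+y. ennreal (f y) \<partial>kern t x)"
    proof (rule kern_mono[OF _ t(1)])
      show "indicator U \<in> borel_measurable borel" using U(1) by simp
      show "(\<lambda>y. ennreal (f y)) \<in> borel_measurable borel" by measurable
    qed (use UDC in \<open>auto simp: indicator_def f_def bump_eq_1\<close>)
    also have "\<dots> = ennreal (survive t f x)" by (rule nn_integral_kern_eq_survive(1)[OF t(1) fm f0 f1])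
    finally have "survive t f x > 0" by simp
    then have "green (\<lambda>y. ennreal (f y)) x > 0" by (rule green_pos[OF fm f0 f1 fc t(1)])
    then show ?thesis using \<phi>e[of x] by (metis ennreal_less_zero_iff)
  qed
  have C'ne: "C' \<noteq> {}" using Cne CC' by blast
  have \<phi>c: "continuous_on D \<phi>" by (rule C0_continuous_on[OF \<phi>C0])
  obtain z where z: "z \<in> C'" "\<And>y. y \<in> C' \<Longrightarrow> \<phi> z \<le> \<phi> y"
    using continuous_attains_inf[OF C'c C'ne continuous_on_subset[OF \<phi>c C'D]] by blast
  have cpos: "\<phi> z > 0" using \<phi>pos z(1) C'D by blast
  obtain B where B: "B > 0" "\<And>x. x \<in> D \<Longrightarrow> \<bar>\<phi> x\<bar> \<le> B" using C0_bounded[OF \<phi>C0] by blast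
  have fle: "\<phi> z * f y \<le> \<phi> y" if "y \<in> D" for y
  proof (cases "y \<in> C'")
    case True
    have "\<phi> z * f y \<le> \<phi> z * 1" using f1 \<phi>0 by (intro mult_left_mono) auto
    then show ?thesis using z(2)[OF True] by simp
  next
    case False
    then have "\<rho> \<le> infdist y C" using that D_subset by (auto simp: C'_def)
    then have "f y = 0" unfolding f_def by (rule bump_eq_0[OF \<rho>(1)])
    then show ?thesis using \<phi>0 by simp
  qed
  have B': "\<phi> y \<le> B" if "y \<in> D" for y using B(2)[OF that] by simp
  have main: "\<phi> z * \<phi> x \<le> green_op Pr X D \<phi> x" for x
  proof -
    have "ennreal (\<phi> z * \<phi> x) = ennreal (\<phi> z) * green (\<lambda>y. ennreal (f y)) x"
      using \<phi>0 by (simp add: ennreal_mult \<phi>e)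
    also have "\<dots> = green (\<lambda>y. ennreal (\<phi> z) * ennreal (f y)) x"
      by (rule green_cmult[symmetric]) measurable
    also have "\<dots> \<le> green (\<lambda>y. ennreal (\<phi> y)) x"
      by (rule green_mono) (use fle \<phi>0 f0 in \<open>auto simp: ennreal_mult[symmetric] intro!: ennreal_leI\<close>)
    also have "\<dots> = ennreal (green_op Pr X D \<phi> x)"
      using green_C0(2)[OF \<phi>m \<phi>c \<phi>0 B', of x] green_finite[OF \<phi>m B', of x] by simp
    finally show ?thesis
      using green_C0(2)[OF \<phi>m \<phi>c \<phi>0 B', of x] by (simp add: ennreal_le_iff)
  qed
  show ?thesis using \<phi>C0 \<phi>pos cpos main by blast
qed

text \<open>
  (ii) implies (i), by a maximum principle. Choose \<open>m\<close> such that \<open>G 1 \<le> \<theta> / 2\<close> where \<open>\<phi> \<le> m\<close>; this is possible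
  because \<open>G 1\<close> vanishes at the boundary. Let \<open>U\<close> be the region \<open>\<phi> > \<epsilon>\<close> for small \<open>\<epsilon>\<close> and \<open>b\<close> the set of points from
  which the process does not visit \<open>U\<close>. On \<open>b\<close> one has \<open>\<theta> \<phi> \<le> G \<phi> \<le> \<epsilon> G 1\<close>, hence \<open>\<phi> \<le> m\<close>. The process
  started in \<open>b\<close> remains in \<open>b\<close>, so \<open>\<theta> \<phi> \<le> G \<phi> \<le> (sup \<phi> over b) * G 1 \<le> (sup \<phi> over b) * \<theta> / 2\<close> on \<open>b\<close>, which
  contradicts positivity of \<open>\<phi>\<close> unless \<open>b\<close> is empty.
\<close>

lemma accessible_if_lyapunov:
  assumes \<phi>C0: "\<phi> \<in> C0 D" and \<theta>: "\<theta> > 0" and \<phi>pos: "\<And>x. x \<in> D \<Longrightarrow> \<phi> x > 0"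
    and ly: "\<And>x. x \<in> D \<Longrightarrow> green_op Pr X D \<phi> x \<ge> \<theta> * \<phi> x"
  shows "\<exists>U. open U \<and> (\<forall>x\<in>D. D_accessible Pr X D U x) \<and> closure (U \<inter> K) \<subseteq> D"
proof -
  have \<phi>c: "continuous_on D \<phi>" by (rule C0_continuous_on[OF \<phi>C0])
  obtain p where pm[measurable]: "p \<in> borel_measurable borel" and p0: "\<And>y. 0 \<le> p y"
    and pD: "\<And>y. y \<in> D \<Longrightarrow> p y = \<phi> y" and pout: "\<And>y. y \<notin> D \<Longrightarrow> p y = 0"
    and lyp: "\<And>x. ennreal (\<theta> * p x) \<le> green (\<lambda>y. ennreal (p y)) x"
    by (rule lyapunov_zero_extension[OF \<phi>C0 \<theta> \<phi>pos ly]) blast+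
  have lyg: "ennreal (\<theta> * \<phi> x) \<le> green (\<lambda>y. ennreal (p y)) x" if "x \<in> D" for x
    using lyp[of x] pD[OF that] by simp
  obtain C where C: "C > 0" "\<And>x. green (\<lambda>_. 1) x \<le> ennreal C" using green_one_bounded by blast
  have g1: "(\<lambda>x. enn2real (green (\<lambda>_. 1) x)) \<in> C0 D"
    using green_C0(1)[of "\<lambda>_. 1" 1] by simp
  obtain C1 where C1: "compact C1" "C1 \<subseteq> D" "\<And>x. x \<in> D - C1 \<Longrightarrow> \<bar>enn2real (green (\<lambda>_. 1) x)\<bar> \<le> \<theta> / 2"
    using C0_small_off_compact[OF g1, of "\<theta> / 2"] \<theta> by auto
  obtain m where m: "m > 0" "\<And>y. y \<in> C1 \<Longrightarrow> m < \<phi> y"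
  proof (cases "C1 = {}")
    case True
    then show thesis using that[of 1] by auto
  next
    case False
    obtain z where z: "z \<in> C1" "\<And>y. y \<in> C1 \<Longrightarrow> \<phi> z \<le> \<phi> y"
      using continuous_attains_inf[OF C1(1) False continuous_on_subset[OF \<phi>c C1(2)]] by blast
    have zp: "\<phi> z > 0" using \<phi>pos z(1) C1(2) by blast
    have "\<phi> z / 2 < \<phi> y" if "y \<in> C1" for y using z(2)[OF that] zp by linarith
    then show thesis using that[of "\<phi> z / 2"] zp by auto
  qed
  (* This makes \<epsilon> G 1 / \<theta> at most m. *)
  define \<epsilon> where "\<epsilon> = m * \<theta> / C"
  have \<epsilon>: "\<epsilon> > 0" using m \<theta> C by (simp add: \<epsilon>_def)
  define W where "W = {x \<in> D. \<epsilon> < \<phi> x}"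
  have "openin (top_of_set D) W"
  proof -
    have "W = D \<inter> \<phi> -` {\<epsilon><..}" by (auto simp: W_def)
    then show ?thesis using continuous_openin_preimage_gen[OF \<phi>c open_greaterThan] by simp
  qed
  then have "openin (top_of_set K) W" using D_open openin_trans by blast
  then obtain U where U: "open U" "W = K \<inter> U" unfolding openin_open by blast
  have cl: "closure (U \<inter> K) \<subseteq> D"
  proof -
    obtain C2 where C2: "compact C2" "C2 \<subseteq> D" "\<And>x. x \<in> D - C2 \<Longrightarrow> \<bar>\<phi> x\<bar> \<le> \<epsilon>"
      using C0_small_off_compact[OF \<phi>C0 \<epsilon>] by blast
    have "W \<subseteq> C2" using C2(3) by (force simp: W_def)
    then have "closure W \<subseteq> C2" using compact_imp_closed[OF C2(1)] by (rule closure_minimal)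
    then show ?thesis using U(2) C2(2) by (simp add: Int_commute)
  qed
  have "D_accessible Pr X D U x" if x: "x \<in> D" for x
  proof (rule ccontr)
    assume na: "\<not> D_accessible Pr X D U x"
    have kU: "emeasure (kern t x) U = 0" if t: "0 \<le> t" for t
    proof -
      interpret subprob_space "kern t x" by (rule subprob_kern)
      have "\<not> measure (kern t x) U > 0"
        using na killed_kernel_eq[OF t borel_open[OF U(1)], of x] t unfolding D_accessible_def by auto
      then have "measure (kern t x) U = 0" using measure_nonneg[of "kern t x" U] by linarith
      then show ?thesis by (simp add: emeasure_eq_measure)
    qed
    (* \<psi> is supported where \<phi> exceeds \<epsilon>, so its Green potential vanishes exactly at the starting points that
       do not see U. *)
    define \<psi> where "\<psi> y = indicator D y * max 0 (p y - \<epsilon>)" for y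
    have \<psi>m[measurable]: "\<psi> \<in> borel_measurable borel" unfolding \<psi>_def by measurable
    have \<psi>0: "0 \<le> \<psi> y" for y by (simp add: \<psi>_def)
    have \<psi>U: "\<psi> y = 0" if "y \<notin> U" for y
    proof (cases "y \<in> D")
      case True
      then have "\<phi> y \<le> \<epsilon>" using that U(2) D_subset unfolding W_def by force
      then show ?thesis using pD[OF True] by (simp add: \<psi>_def)
    qed (simp add: \<psi>_def)
    have "(\<integral>\<^sup>+y. ennreal (\<psi> y) \<partial>kern t x) = 0" if "0 \<le> t" for t
    proof -
      have "AE y in kern t x. y \<notin> U" using kU[OF that] U(1) by (intro AE_not_in) (auto simp: null_sets_def)
      then have "AE y in kern t x. ennreal (\<psi> y) = 0" by eventually_elim (simp add: \<psi>U)
      then have "(\<integral>\<^sup>+y. ennreal (\<psi> y) \<partial>kern t x) = (\<integral>\<^sup>+y. 0 \<partial>kern t x)" by (rule nn_integral_cong_AE)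
      then show ?thesis by simp
    qed
    then have "(\<lambda>t. indicator {0..} t * (\<integral>\<^sup>+y. ennreal (\<psi> y) \<partial>kern t x)) = (\<lambda>_. 0)" by (auto simp: indicator_def)
    then have gx: "green (\<lambda>y. ennreal (\<psi> y)) x = 0" unfolding green_def by simp
    define b where "b = {y \<in> D. green (\<lambda>y. ennreal (\<psi> y)) y = 0}"
    have xb: "x \<in> b" using x gx by (simp add: b_def)
    have bm: "\<phi> y \<le> m" if y: "y \<in> b" for y
    proof -
      have "green (\<lambda>y. ennreal (p y)) y \<le> green (\<lambda>y. ennreal (\<psi> y) + ennreal \<epsilon> * 1) y"
      proof (rule green_mono)
        fix w assume "w \<in> D"
        then have "p w \<le> \<psi> w + \<epsilon>" by (auto simp: \<psi>_def)
        then have "ennreal (p w) \<le> ennreal (\<psi> w + \<epsilon>)" by (rule ennreal_leI)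
        then show "ennreal (p w) \<le> ennreal (\<psi> w) + ennreal \<epsilon> * 1" using \<psi>0 \<epsilon> by simp
      qed measurable
      also have "\<dots> = green (\<lambda>y. ennreal (\<psi> y)) y + green (\<lambda>_. ennreal \<epsilon> * 1) y"
        by (rule green_add) measurable
      also have "green (\<lambda>_. ennreal \<epsilon> * 1) y = ennreal \<epsilon> * green (\<lambda>_. 1) y"
        by (rule green_cmult) simp
      also have "green (\<lambda>y. ennreal (\<psi> y)) y + ennreal \<epsilon> * green (\<lambda>_. 1) y = ennreal \<epsilon> * green (\<lambda>_. 1) y"
        using y by (simp add: b_def)
      also have "\<dots> \<le> ennreal \<epsilon> * ennreal C" using C(2) by (intro mult_left_mono) auto
      also have "\<dots> = ennreal (\<theta> * m)" using \<epsilon> C by (simp add: ennreal_mult[symmetric] \<epsilon>_def mult.commute)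
      finally have "ennreal (\<theta> * \<phi> y) \<le> ennreal (\<theta> * m)" using lyg[of y] y by (auto simp: b_def)
      then show ?thesis using \<theta> m by (simp add: ennreal_le_iff)
    qed
    define s where "s = Sup (\<phi> ` b)"
    have bdd: "bdd_above (\<phi> ` b)" using bm by (auto intro!: bdd_aboveI[of _ m])
    have s: "\<phi> y \<le> s" if "y \<in> b" for y unfolding s_def using that bdd by (intro cSup_upper) auto
    have sp: "s > 0" using s[OF xb] \<phi>pos[OF x] by linarith
    have half: "\<phi> y \<le> s / 2" if y: "y \<in> b" for y
    proof -
      have yD: "y \<in> D" using y by (simp add: b_def)
      (* The process started in b stays in b: the potential of \<psi> vanishes along it. *)
      have k: "(\<integral>\<^sup>+w. ennreal (p w) \<partial>kern t y) \<le> (\<integral>\<^sup>+w. ennreal s * 1 \<partial>kern t y)" if t: "0 \<le> t" for t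
      proof (rule nn_integral_mono_AE)
        have "(\<integral>\<^sup>+w. green (\<lambda>y. ennreal (\<psi> y)) w \<partial>kern t y) \<le> green (\<lambda>y. ennreal (\<psi> y)) y"
          unfolding kern_green[OF t, of "\<lambda>y. ennreal (\<psi> y)", simplified]
          unfolding green_def using t by (intro nn_integral_mono mult_right_mono) (auto simp: indicator_def)
        then have "(\<integral>\<^sup>+w. green (\<lambda>y. ennreal (\<psi> y)) w \<partial>kern t y) = 0" using y by (simp add: b_def)
        then have "AE w in kern t y. green (\<lambda>y. ennreal (\<psi> y)) w = 0"
          by (subst (asm) nn_integral_0_iff_AE) (auto intro!: measurable_kern green_measurable)
        then show "AE w in kern t y. ennreal (p w) \<le> ennreal s * 1"
        proof eventually_elim
          case (elim w)
          show ?case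
          proof (cases "w \<in> D")
            case True
            then show ?thesis using s[of w] elim by (simp add: b_def pD ennreal_leI)
          qed (simp add: pout)
        qed
      qed
      have "ennreal (\<theta> * \<phi> y) \<le> green (\<lambda>y. ennreal (p y)) y" by (rule lyg[OF yD])
      also have "\<dots> \<le> green (\<lambda>_. ennreal s * 1) y"
        unfolding green_def using k by (intro nn_integral_mono) (auto simp: indicator_def)
      also have "\<dots> = ennreal s * green (\<lambda>_. 1) y" by (rule green_cmult) simp
      also have "green (\<lambda>_. 1) y \<le> ennreal (\<theta> / 2)"
      proof -
        have "y \<notin> C1" using bm[OF y] m(2)[of y] by linarith
        then have "enn2real (green (\<lambda>_. 1) y) \<le> \<theta> / 2" using C1(3)[of y] yD by auto
        moreover have "green (\<lambda>_. 1) y < top" using C(2)[of y] by (simp add: le_less_trans)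
        ultimately show ?thesis by (metis ennreal_enn2real ennreal_leI)
      qed
      then have "ennreal s * green (\<lambda>_. 1) y \<le> ennreal s * ennreal (\<theta> / 2)" by (intro mult_left_mono) auto
      also have "\<dots> = ennreal (\<theta> * (s / 2))" using sp \<theta> by (simp add: ennreal_mult[symmetric] mult.commute)
      finally have "\<theta> * \<phi> y \<le> \<theta> * (s / 2)" using sp \<theta> by (simp add: ennreal_le_iff)
      then show ?thesis using \<theta> by simp
    qed
    have "Sup (\<phi> ` b) \<le> s / 2" by (rule cSup_least) (use half xb in auto)
    then have "s \<le> s / 2" by (simp add: s_def)
    with sp show False by simp
  qed
  then show ?thesis using U(1) cl by blast
qed

section \<open>The spectral radius of the Green operator\<close>

abbreviation green_pow :: "nat \<Rightarrow> ('a \<Rightarrow> ennreal) \<Rightarrow> 'a \<Rightarrow> ennreal" where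
  "green_pow n f \<equiv> (green ^^ n) f"

lemma green_pow_measurable: "f \<in> borel_measurable borel \<Longrightarrow> green_pow n f \<in> borel_measurable borel"
  by (induction n) (auto intro: green_measurable)

lemma green_pow_add:
  "f \<in> borel_measurable borel \<Longrightarrow> g \<in> borel_measurable borel \<Longrightarrow>
    green_pow n (\<lambda>y. f y + g y) = (\<lambda>x. green_pow n f x + green_pow n g x)"
  by (induction n) (auto simp: green_add green_pow_measurable)

lemma green_pow_cmult:
  "f \<in> borel_measurable borel \<Longrightarrow> green_pow n (\<lambda>y. c * f y) = (\<lambda>x. c * green_pow n f x)"
  by (induction n) (auto simp: green_cmult green_pow_measurable)

lemma green_pow_mono:
  assumes "\<And>y. f y \<le> g y" "f \<in> borel_measurable borel" "g \<in> borel_measurable borel"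
  shows "green_pow n f x \<le> green_pow n g x"
proof (induction n arbitrary: x)
  case (Suc n)
  show ?case by (simp, rule green_mono) (use Suc assms green_pow_measurable in auto)
qed (use assms in simp)

lemma green_pow_incseq:
  assumes "incseq f" "\<And>i. f i \<in> borel_measurable borel"
  shows "incseq (\<lambda>i. green_pow n (f i))"
  using assms by (auto simp: incseq_def le_fun_def intro!: green_pow_mono)

lemma green_pow_SUP:
  assumes f: "\<And>i::nat. f i \<in> borel_measurable borel" and inc: "incseq f"
  shows "green_pow n (\<lambda>y. SUP i. f i y) = (\<lambda>x. SUP i. green_pow n (f i) x)"
proof (induction n)
  case (Suc n)
  show ?case
    by (simp add: Suc fun_eq_iff) (intro allI green_SUP green_pow_measurable green_pow_incseq f inc)
qed simp

lemma green_sum: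
  assumes "\<And>i::nat. f i \<in> borel_measurable borel"
  shows "green (\<lambda>y. \<Sum>i<n. f i y) x = (\<Sum>i<n. green (f i) x)"
proof (induction n)
  case 0
  show ?case using green_cmult[of "\<lambda>_. 0" 0 x] by simp
next
  case (Suc n)
  have "green (\<lambda>y. (\<Sum>i<n. f i y) + f n y) x = green (\<lambda>y. \<Sum>i<n. f i y) x + green (f n) x"
    by (rule green_add) (use assms in auto)
  then show ?case by (simp add: Suc)
qed

lemma green_suminf:
  assumes f: "\<And>i::nat. f i \<in> borel_measurable borel"
  shows "green (\<lambda>y. \<Sum>i. f i y) x = (\<Sum>i. green (f i) x)"
proof -
  have "green (\<lambda>y. SUP n. \<Sum>i<n. f i y) x = (SUP n. green (\<lambda>y. \<Sum>i<n. f i y) x)"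
    by (rule green_SUP) (use f in \<open>auto simp: incseq_def le_fun_def intro!: sum_mono2\<close>)
  then show ?thesis by (simp add: suminf_eq_SUP green_sum[OF f])
qed

text \<open>
  For \<open>z = 1 / l\<close> this is \<open>l\<close> times the resolvent of the Green operator at \<open>l\<close>.
\<close>

definition neumann :: "real \<Rightarrow> ('a \<Rightarrow> ennreal) \<Rightarrow> 'a \<Rightarrow> ennreal" where
  "neumann z f x = (\<Sum>n. ennreal (z ^ n) * green_pow n f x)"

lemma neumann_measurable: "f \<in> borel_measurable borel \<Longrightarrow> neumann z f \<in> borel_measurable borel"
  unfolding neumann_def[abs_def] using green_pow_measurable by measurable

lemma neumann_add:
  "f \<in> borel_measurable borel \<Longrightarrow> g \<in> borel_measurable borel \<Longrightarrow>
    neumann z (\<lambda>y. f y + g y) x = neumann z f x + neumann z g x"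
  by (simp add: neumann_def green_pow_add distrib_left suminf_add[symmetric])

lemma neumann_cmult:
  "f \<in> borel_measurable borel \<Longrightarrow> neumann z (\<lambda>y. c * f y) x = c * neumann z f x"
  by (simp add: neumann_def green_pow_cmult mult.left_commute)

lemma neumann_SUP:
  assumes f: "\<And>i::nat. f i \<in> borel_measurable borel" and inc: "incseq f"
  shows "neumann z (\<lambda>y. SUP i. f i y) x = (SUP i. neumann z (f i) x)"
proof -
  have i: "incseq (\<lambda>i. ennreal (z ^ n) * green_pow n (f i) x)" for n
    using green_pow_incseq[OF inc f, of n] by (auto simp: incseq_def le_fun_def intro!: mult_left_mono)
  show ?thesis unfolding neumann_def green_pow_SUP[OF f inc] SUP_mult_left_ennreal
    by (rule ennreal_suminf_SUP_eq[OF i])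
qed

lemma neumann_green:
  assumes z: "0 \<le> z"
  shows "neumann z f x = f x + ennreal z * neumann z (green f) x"
proof -
  let ?a = "\<lambda>n. ennreal (z ^ n) * green_pow n f x"
  have "ennreal z * neumann z (green f) x = (\<Sum>n. ?a (Suc n))"
    unfolding neumann_def ennreal_suminf_cmult[symmetric]
    by (simp add: funpow_swap1 ennreal_mult z mult.assoc)
  moreover have "(\<Sum>n. ?a n) = ?a 0 + (\<Sum>n. ?a (Suc n))"
  proof (rule LIMSEQ_unique)
    have "(\<lambda>n. \<Sum>i<Suc n. ?a i) \<longlonglongrightarrow> (\<Sum>n. ?a n)"
      using summable_LIMSEQ[OF summableI, of ?a] by (rule LIMSEQ_Suc)
    then show "(\<lambda>n. ?a 0 + (\<Sum>i<n. ?a (Suc i))) \<longlonglongrightarrow> (\<Sum>n. ?a n)" by (simp only: sum.lessThan_Suc_shift)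
    show "(\<lambda>n. ?a 0 + (\<Sum>i<n. ?a (Suc i))) \<longlonglongrightarrow> ?a 0 + (\<Sum>n. ?a (Suc n))"
      by (intro tendsto_add tendsto_const summable_LIMSEQ summableI)
  qed
  ultimately show ?thesis by (simp add: neumann_def)
qed

lemma green_neumann:
  assumes "f \<in> borel_measurable borel"
  shows "green (neumann z f) x = neumann z (green f) x"
proof -
  have "green (neumann z f) x = (\<Sum>n. green (\<lambda>y. ennreal (z ^ n) * green_pow n f y) x)"
    unfolding neumann_def[abs_def] by (rule green_suminf) (use assms green_pow_measurable in auto)
  also have "\<dots> = neumann z (green f) x"
    unfolding neumann_def by (simp add: green_cmult green_pow_measurable assms funpow_swap1)
  finally show ?thesis .
qed

text \<open>
  The infimum of these numbers is the spectral radius of the Green operator on bounded functions.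
\<close>

definition growth_rates :: "real set" where
  "growth_rates = {l. l > 0 \<and> (\<exists>B. \<forall>n x. green_pow n (\<lambda>_. 1) x \<le> ennreal (B * l ^ n))}"

lemma growth_rates_nonempty: "growth_rates \<noteq> {}"
proof -
  obtain C where C: "C > 0" "\<And>x. green (\<lambda>_. 1) x \<le> ennreal C" using green_one_bounded by blast
  have "green_pow n (\<lambda>_. 1) x \<le> ennreal (C ^ n)" for n x
  proof (induction n arbitrary: x)
    case (Suc n)
    have "green_pow (Suc n) (\<lambda>_. 1) x \<le> green (\<lambda>_. ennreal (C ^ n) * 1) x"
      using Suc by (simp, intro green_mono) (auto simp: green_pow_measurable)
    also have "\<dots> = ennreal (C ^ n) * green (\<lambda>_. 1) x" by (rule green_cmult) simp
    also have "\<dots> \<le> ennreal (C ^ n) * ennreal C" by (intro mult_left_mono C(2)) auto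
    finally show ?case using C(1) by (simp add: ennreal_mult[symmetric] mult.commute)
  qed simp
  then have "C \<in> growth_rates" unfolding growth_rates_def using C(1) by (auto intro!: exI[of _ 1])
  then show ?thesis by blast
qed

text \<open>
  Iterating \<open>\<theta> \<phi> \<le> G \<phi>\<close> bounds the growth of the powers of \<open>G\<close> from below, so under condition (ii) the
  spectral radius is positive.
\<close>

lemma growth_rates_ge:
  assumes \<phi>C0: "\<phi> \<in> C0 D" and \<theta>: "\<theta> > 0" and \<phi>pos: "\<And>x. x \<in> D \<Longrightarrow> \<phi> x > 0"
    and ly: "\<And>x. x \<in> D \<Longrightarrow> green_op Pr X D \<phi> x \<ge> \<theta> * \<phi> x" and l: "l \<in> growth_rates"
  shows "\<theta> \<le> l"
proof (rule ccontr)
  assume "\<not> \<theta> \<le> l"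
  obtain p B where pm[measurable]: "p \<in> borel_measurable borel" and p0: "\<And>y. 0 \<le> p y"
    and B: "B > 0" and pB: "\<And>y. p y \<le> B" and pD: "\<And>y. y \<in> D \<Longrightarrow> p y = \<phi> y"
    and lyp: "\<And>x. ennreal (\<theta> * p x) \<le> green (\<lambda>y. ennreal (p y)) x"
    by (rule lyapunov_zero_extension[OF \<phi>C0 \<theta> \<phi>pos ly]) blast+
  have lyg: "ennreal \<theta> * ennreal (p x) \<le> green (\<lambda>y. ennreal (p y)) x" for x
    using lyp[of x] \<theta> p0[of x] by (simp add: ennreal_mult)
  have pow: "ennreal (\<theta> ^ n) * ennreal (p x) \<le> green_pow n (\<lambda>y. ennreal (p y)) x" for n x
  proof (induction n arbitrary: x)
    case (Suc n)
    have "ennreal (\<theta> ^ Suc n) * ennreal (p x) = ennreal (\<theta> ^ n) * (ennreal \<theta> * ennreal (p x))"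
      using \<theta> by (simp add: ennreal_mult[symmetric] p0 mult.left_commute mult.commute)
    also have "\<dots> \<le> ennreal (\<theta> ^ n) * green (\<lambda>y. ennreal (p y)) x" by (intro mult_left_mono lyg) auto
    also have "\<dots> = green (\<lambda>y. ennreal (\<theta> ^ n) * ennreal (p y)) x" by (rule green_cmult[symmetric]) measurable
    also have "\<dots> \<le> green (green_pow n (\<lambda>y. ennreal (p y))) x"
      by (rule green_mono) (use Suc in \<open>auto intro!: green_pow_measurable\<close>)
    finally show ?case by simp
  qed simp
  obtain x where x: "x \<in> D" using D_nonempty by blast
  have px: "p x > 0" using \<phi>pos[OF x] pD[OF x] by simp
  obtain A where A: "\<And>n x. green_pow n (\<lambda>_. 1) x \<le> ennreal (A * l ^ n)" and lp: "l > 0"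
    using l unfolding growth_rates_def by blast
  have A0: "A > 0" using A[of 0 x] by (auto intro: ccontr simp: ennreal_neg not_less)
  have "\<theta> ^ n * p x \<le> B * (A * l ^ n)" for n
  proof -
    have "ennreal (\<theta> ^ n) * ennreal (p x) \<le> green_pow n (\<lambda>y. ennreal B * 1) x"
      by (rule order_trans[OF pow green_pow_mono]) (use pB in \<open>auto intro: ennreal_leI\<close>)
    also have "\<dots> = ennreal B * green_pow n (\<lambda>_. 1) x" by (simp only: green_pow_cmult[OF borel_measurable_const])
    also have "\<dots> \<le> ennreal B * ennreal (A * l ^ n)" by (intro mult_left_mono A) auto
    finally show ?thesis using \<theta> px B A0 lp by (simp add: ennreal_mult[symmetric] ennreal_le_iff)
  qed
  then have bd: "(\<theta> / l) ^ n \<le> B * A / p x" for n using lp px by (simp add: power_divide field_simps)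
  have "1 < \<theta> / l" using \<open>\<not> \<theta> \<le> l\<close> lp by simp
  then obtain n where "B * A / p x < (\<theta> / l) ^ n" using real_arch_pow by blast
  with bd[of n] show False by simp
qed

text \<open>
  The resolvent blows up at the spectral radius \<open>r\<close>. If \<open>u = neumann (1 / l) 1\<close> were bounded by \<open>M\<close>, then
  \<open>G u = l (u - 1) \<le> l (1 - 1 / M) u\<close>, and \<open>l (1 - 1 / M)\<close> would be a growth rate; for \<open>l = r (1 + 1 / M)\<close> it is
  below \<open>r\<close>.
\<close>

lemma neumann_one_large:
  assumes r: "r = Inf growth_rates" "r > 0" and M: "M > 1"
  obtains x where "x \<in> D" "ennreal M < neumann (1 / (r * (1 + 1 / M))) (\<lambda>_. 1) x"
proof -
  define l where "l = r * (1 + 1 / M)"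
  have l: "l > 0" using r(2) M by (auto simp: l_def intro!: mult_pos_pos add_pos_pos)
  define u where "u = neumann (1 / l) (\<lambda>_. 1)"
  have um: "u \<in> borel_measurable borel" unfolding u_def by (rule neumann_measurable) simp
  have u_eq: "u x = 1 + ennreal (1 / l) * green u x" for x
  proof -
    have "u x = 1 + ennreal (1 / l) * neumann (1 / l) (green (\<lambda>_. 1)) x"
      unfolding u_def by (rule neumann_green) (use l in simp)
    also have "neumann (1 / l) (green (\<lambda>_. 1)) x = green u x"
      unfolding u_def by (rule green_neumann[symmetric]) simp
    finally show ?thesis .
  qed
  have "\<exists>x. ennreal M < u x"
  proof (rule ccontr)
    assume "\<not> ?thesis"
    then have uM: "u x \<le> ennreal M" for x by (simp add: not_less)
    (* The candidate for a growth rate below r. *)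
    define k where "k = l * (1 - 1 / M)"
    have k0: "k > 0" using l M by (simp add: k_def)
    have gu: "green u x \<le> ennreal k * u x" for x
    proof -
      have ufin: "u x < top" using uM[of x] by (simp add: le_less_trans)
      have gfin: "green u x < top"
      proof (rule ccontr)
        assume "\<not> green u x < top"
        then have "green u x = top" by (metis less_top)
        then have "u x = top" using u_eq[of x] l by (simp add: ennreal_mult_top)
        with ufin show False by simp
      qed
      obtain a where a: "0 \<le> a" "u x = ennreal a" using ufin by (cases "u x" rule: ennreal_cases) auto
      obtain b where b: "0 \<le> b" "green u x = ennreal b" using gfin by (cases "green u x" rule: ennreal_cases) auto
      have "ennreal a = ennreal (1 + 1 / l * b)"
        using u_eq[of x] a b l by (simp add: ennreal_mult[symmetric] flip: ennreal_1 ennreal_plus)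
      then have ab: "a = 1 + b / l" using a(1) b(1) l by (simp add: field_simps)
      have aM: "a \<le> M" using uM[of x] a M by (simp add: ennreal_le_iff)
      have "b = l * (a - 1)" using ab l by (simp add: field_simps)
      also have "\<dots> \<le> l * (a - a / M)" using aM M l by (intro mult_left_mono) (auto simp: field_simps)
      also have "\<dots> = k * a" by (simp add: k_def algebra_simps)
      finally show ?thesis using a b k0 by (simp add: ennreal_mult[symmetric] ennreal_leI)
    qed
    have pw: "green_pow n (\<lambda>_. 1) x \<le> ennreal (k ^ n) * u x" for n x
    proof (induction n arbitrary: x)
      case 0
      show ?case using u_eq[of x] by simp
    next
      case (Suc n)
      have "green_pow (Suc n) (\<lambda>_. 1) x \<le> green (\<lambda>y. ennreal (k ^ n) * u y) x"
        using Suc um by (simp, intro green_mono) (auto simp: green_pow_measurable)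
      also have "\<dots> = ennreal (k ^ n) * green u x" by (rule green_cmult[OF um])
      also have "\<dots> \<le> ennreal (k ^ n) * (ennreal k * u x)" by (intro mult_left_mono gu) auto
      also have "\<dots> = ennreal (k ^ Suc n) * u x" using k0 by (simp add: ennreal_mult mult.assoc mult.left_commute)
      finally show ?case .
    qed
    have "green_pow n (\<lambda>_. 1) x \<le> ennreal (M * k ^ n)" for n x
    proof -
      have "green_pow n (\<lambda>_. 1) x \<le> ennreal (k ^ n) * ennreal M" by (rule order_trans[OF pw mult_left_mono[OF uM]]) auto
      then show ?thesis using k0 M by (simp add: ennreal_mult[symmetric] mult.commute)
    qed
    then have "k \<in> growth_rates" using k0 unfolding growth_rates_def by blast
    then have "r \<le> k" unfolding r(1) by (rule cInf_lower) (auto simp: growth_rates_def intro!: bdd_belowI[of _ 0])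
    also have "k = r * (1 - (1 / M) ^ 2)" by (simp add: k_def l_def algebra_simps power2_eq_square)
    also have "\<dots> < r * 1" using r(2) M by (intro mult_strict_left_mono) auto
    finally show False by simp
  qed
  then obtain x where x: "ennreal M < u x" by blast
  have "x \<in> D"
  proof (rule ccontr)
    assume "x \<notin> D"
    then have "u x = 1" using u_eq[of x] green_started_outside[OF _ um] by simp
    with x M show False by (simp add: ennreal_less_iff flip: ennreal_1)
  qed
  then show thesis using x that unfolding u_def l_def by blast
qed

lemma neumann_one_finite:
  assumes r: "r = Inf growth_rates" and l: "r < l" "0 < r"
  shows "neumann (1 / l) (\<lambda>_. 1) x < top"
proof -
  have "\<exists>l'\<in>growth_rates. l' < l"
    using l(1) growth_rates_nonempty cInf_lessD[of growth_rates l] unfolding r by blast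
  then obtain l' B where l': "l' > 0" "l' < l" "\<And>n x. green_pow n (\<lambda>_. 1) x \<le> ennreal (B * l' ^ n)"
    unfolding growth_rates_def by blast
  have l0: "l > 0" using l by simp
  have sm: "summable (\<lambda>n. max 0 B * (l' / l) ^ n)" using l' l0 by (intro summable_mult summable_geometric) auto
  have "neumann (1 / l) (\<lambda>_. 1) x \<le> (\<Sum>n. ennreal (max 0 B * (l' / l) ^ n))"
    unfolding neumann_def
  proof (rule suminf_le[OF _ summableI summableI])
    fix n
    have "ennreal ((1 / l) ^ n) * green_pow n (\<lambda>_. 1) x \<le> ennreal ((1 / l) ^ n) * ennreal (max 0 B * l' ^ n)"
      using l' by (intro mult_left_mono order_trans[OF l'(3)] ennreal_leI mult_right_mono) auto
    also have "\<dots> = ennreal (max 0 B * (l' / l) ^ n)"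
      using l0 l' by (simp add: ennreal_mult[symmetric] power_divide)
    finally show "ennreal ((1 / l) ^ n) * green_pow n (\<lambda>_. 1) x \<le> ennreal (max 0 B * (l' / l) ^ n)" .
  qed
  also have "\<dots> < top" using sm l' l0 by (subst suminf_ennreal2) auto
  finally show ?thesis .
qed

section \<open>Eigenmeasures and quasi-stationary distributions\<close>

text \<open>
  The row of the resolvent at a point where it has large mass \<open>c\<close>, normalised to a probability measure,
  is an eigenmeasure up to a defect of size \<open>l / c\<close>.
\<close>

lemma approximate_eigenmeasure:
  assumes r: "r = Inf growth_rates" "r > 0" and M: "M > 1"
  obtains \<nu> x c where "prob_space \<nu>" "sets \<nu> = sets borel" "AE y in \<nu>. y \<in> K" "c > M"
    "\<And>f. f \<in> borel_measurable borel \<Longrightarrow>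
      (\<integral>\<^sup>+y. green f y \<partial>\<nu>) + ennreal (r * (1 + 1 / M) / c) * f x = ennreal (r * (1 + 1 / M)) * (\<integral>\<^sup>+y. f y \<partial>\<nu>)"
proof -
  define l where "l = r * (1 + 1 / M)"
  have "r / M > 0" using r(2) M by simp
  then have l: "l > 0" "r < l" using r(2) by (auto simp: l_def distrib_left)
  obtain x where x: "x \<in> D" "ennreal M < neumann (1 / l) (\<lambda>_. 1) x" using neumann_one_large[OF r M] unfolding l_def by blast
  obtain c where c: "0 \<le> c" "neumann (1 / l) (\<lambda>_. 1) x = ennreal c"
    using neumann_one_finite[OF r(1) l(2) r(2), of x] by (cases "neumann (1 / l) (\<lambda>_. 1) x" rule: ennreal_cases) auto
  have cM: "c > M" using x(2) c M by (simp add: ennreal_less_iff)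
  have c0: "c > 0" using cM M by simp
  define L where "L f = ennreal (1 / c) * neumann (1 / l) f x" for f
  obtain \<nu> where s: "sets \<nu> = sets (borel :: 'a measure)" and L: "\<And>f. f \<in> borel_measurable borel \<Longrightarrow> (\<integral>\<^sup>+y. f y \<partial>\<nu>) = L f"
  proof (rule additive_functional_is_nn_integral[of "borel :: 'a measure" L])
    show "L (\<lambda>x. f x + g x) = L f + L g" if "f \<in> borel_measurable borel" "g \<in> borel_measurable borel" for f g
      unfolding L_def using that by (simp add: neumann_add distrib_left)
    show "L (\<lambda>x. c * f x) = c * L f" if "f \<in> borel_measurable borel" for f c
      unfolding L_def using that by (simp add: neumann_cmult mult.left_commute)
    show "L (\<lambda>x. SUP i. f i x) = (SUP i. L (f i))" if "\<And>i::nat. f i \<in> borel_measurable borel" "incseq f" for f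
      unfolding L_def using that by (simp add: neumann_SUP SUP_mult_left_ennreal)
    show "L f = L g" if "\<And>x. x \<in> space borel \<Longrightarrow> f x = g x" for f g
      by (rule arg_cong[where f=L]) (use that in auto)
  qed blast
  have sp: "space \<nu> = UNIV" using sets_eq_imp_space_eq[OF s] by simp
  have id: "(\<integral>\<^sup>+y. green f y \<partial>\<nu>) + ennreal (l / c) * f x = ennreal l * (\<integral>\<^sup>+y. f y \<partial>\<nu>)" if f: "f \<in> borel_measurable borel" for f
  proof -
    have "ennreal l * (\<integral>\<^sup>+y. f y \<partial>\<nu>) = ennreal l * (ennreal (1 / c) * (f x + ennreal (1 / l) * neumann (1 / l) (green f) x))"
      unfolding L[OF f] L_def by (subst neumann_green) (use l in auto)
    also have "\<dots> = ennreal (l / c) * f x + (ennreal l * ennreal (1 / l)) * (ennreal (1 / c) * neumann (1 / l) (green f) x)"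
      using l c0 by (simp add: distrib_left mult.assoc[symmetric] ennreal_mult[symmetric])
    also have "ennreal l * ennreal (1 / l) = 1" using l by (simp add: ennreal_mult[symmetric])
    finally show ?thesis unfolding L[OF green_measurable[OF f]] L_def by (simp add: add.commute)
  qed
  show thesis
  proof (rule that[of \<nu> c x])
    have "emeasure \<nu> (space \<nu>) = (\<integral>\<^sup>+y. 1 \<partial>\<nu>)" by simp
    also have "\<dots> = 1" using L[of "\<lambda>_. 1"] c0 c(2) by (simp add: L_def ennreal_mult[symmetric])
    finally show "prob_space \<nu>" by (rule prob_spaceI)
    have "emeasure \<nu> (- K) = (\<integral>\<^sup>+y. indicator (- K) y \<partial>\<nu>)" using s by simp
    also have "\<dots> = L (indicator (- K))" by (rule L) simp
    also have "\<dots> = 0"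
    proof -
      have g0: "green (indicator (- K)) = (\<lambda>_. 0)"
      proof
        fix y
        have "green (indicator (- K)) y = green (\<lambda>_. 0 * 1) y" by (rule green_cong) (use D_subset in auto)
        also have "\<dots> = 0 * green (\<lambda>_. 1) y" by (rule green_cmult) simp
        finally show "green (indicator (- K)) y = 0" by simp
      qed
      have "neumann (1 / l) (indicator (- K)) x = indicator (- K) x + ennreal (1 / l) * neumann (1 / l) (\<lambda>_. 0 * 1) x"
        using neumann_green[of "1 / l" "indicator (- K)" x] l g0 by simp
      also have "neumann (1 / l) (\<lambda>_. 0 * 1) x = 0 * neumann (1 / l) (\<lambda>_. 1) x" by (rule neumann_cmult) simp
      finally show ?thesis using x(1) D_subset by (auto simp: L_def)
    qed
    finally have "- K \<in> null_sets \<nu>" using s by (auto simp: null_sets_def)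
    then show "AE y in \<nu>. y \<in> K" by (auto dest: AE_not_in)
  qed (use s cM id in \<open>auto simp: l_def\<close>)
qed

text \<open>
  A weak limit of approximate eigenmeasures. The eigenvalue equation passes to the limit because \<open>G\<close> maps
  continuous functions on \<open>K\<close> to continuous functions on \<open>K\<close>; this is the place where the hypothesis
  \<open>G (C\<^sub>b(D)) \<subseteq> C\<^sub>0(D)\<close> replaces compactness of \<open>G\<close>.
\<close>

lemma eigenmeasure_on_continuous:
  assumes r: "r = Inf growth_rates" "r > 0"
  obtains \<nu> where "prob_space \<nu>" "sets \<nu> = sets borel" "AE y in \<nu>. y \<in> K"
    "\<And>f B. continuous_on K f \<Longrightarrow> (\<And>y. 0 \<le> f y) \<Longrightarrow> (\<And>y. f y \<le> B) \<Longrightarrow> f \<in> borel_measurable borel \<Longrightarrow>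
      (\<integral>\<^sup>+y. green (\<lambda>z. ennreal (f z)) y \<partial>\<nu>) = ennreal r * (\<integral>\<^sup>+y. ennreal (f y) \<partial>\<nu>)"
proof -
  (* Any sequence above 1 that tends to infinity would do. *)
  define M where "M j = real j + 2" for j
  have M1: "M j > 1" for j by (simp add: M_def)
  define l where "l j = r * (1 + 1 / M j)" for j
  define Q where "Q j \<nu> x c \<longleftrightarrow> prob_space \<nu> \<and> sets \<nu> = sets borel \<and> (AE y in \<nu>. y \<in> K) \<and> c > M j \<and>
    (\<forall>f\<in>borel_measurable borel. (\<integral>\<^sup>+y. green f y \<partial>\<nu>) + ennreal (l j / c) * f x = ennreal (l j) * (\<integral>\<^sup>+y. f y \<partial>\<nu>))"
    for j \<nu> x c
  have "\<exists>\<nu> x c. Q j \<nu> x c" for j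
  proof (rule approximate_eigenmeasure[OF r M1[of j]])
    fix \<nu> x c
    assume "prob_space \<nu>" "sets \<nu> = sets borel" "AE y in \<nu>. y \<in> K" "M j < c"
      "\<And>f. f \<in> borel_measurable borel \<Longrightarrow>
        (\<integral>\<^sup>+y. green f y \<partial>\<nu>) + ennreal (r * (1 + 1 / M j) / c) * f x = ennreal (r * (1 + 1 / M j)) * (\<integral>\<^sup>+y. f y \<partial>\<nu>)"
    then have "Q j \<nu> x c" unfolding Q_def l_def by simp
    then show ?thesis by blast
  qed
  then obtain \<nu> x c where Q: "\<And>j. Q j (\<nu> j) (x j) (c j)" by metis
  have \<nu>: "\<And>j. prob_space (\<nu> j)" "\<And>j. sets (\<nu> j) = sets borel" "\<And>j. AE y in \<nu> j. y \<in> K"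
    and cM: "\<And>j. c j > M j"
    and id: "\<And>j f. f \<in> borel_measurable borel \<Longrightarrow> (\<integral>\<^sup>+y. green f y \<partial>\<nu> j) + ennreal (l j / c j) * f (x j) = ennreal (l j) * (\<integral>\<^sup>+y. f y \<partial>\<nu> j)"
    using Q unfolding Q_def by auto
  have Kne: "K \<noteq> {}" using D_nonempty D_subset by blast
  show thesis
  proof (rule compact_weak_sequential_compactness[OF K_compact Kne \<nu>])
    fix s :: "nat \<Rightarrow> nat" and N
    assume s: "strict_mono s" and N: "prob_space N" "sets N = sets borel" "AE y in N. y \<in> K"
      and lim: "\<And>f :: 'a \<Rightarrow> real. continuous_on K f \<Longrightarrow>
         (\<lambda>j. \<integral>y. indicator K y * f y \<partial>\<nu> (s j)) \<longlonglongrightarrow> (\<integral>y. indicator K y * f y \<partial>N)"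
    have Mlim: "(\<lambda>j. 1 / M (s j)) \<longlonglongrightarrow> 0"
    proof -
      have "(\<lambda>j. 1 / M j) \<longlonglongrightarrow> 0"
        unfolding M_def by (intro tendsto_divide_0[OF tendsto_const] filterlim_at_top_imp_at_infinity
            filterlim_tendsto_add_at_top[OF _ filterlim_real_sequentially, of "\<lambda>_. 2" 2, simplified add.commute]) simp
      from LIMSEQ_subseq_LIMSEQ[OF this s] show ?thesis by (simp add: o_def)
    qed
    have llim: "(\<lambda>j. l (s j)) \<longlonglongrightarrow> r"
      using tendsto_mult[OF tendsto_const tendsto_add[OF tendsto_const Mlim], of r 1] by (simp add: l_def)
    show thesis
    proof (rule that[OF N])
      fix f :: "'a \<Rightarrow> real" and B
      assume fc: "continuous_on K f" and f0: "\<And>y. 0 \<le> f y" and fB: "\<And>y. f y \<le> B" and fm[measurable]: "f \<in> borel_measurable borel"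
      define g where "g y = enn2real (green (\<lambda>z. ennreal (f z)) y)" for y
      have gm[measurable]: "green (\<lambda>z. ennreal (f z)) \<in> borel_measurable borel" by (rule green_measurable) measurable
      have gme[measurable]: "g \<in> borel_measurable borel" unfolding g_def by measurable
      have fcD: "continuous_on D f" using fc D_subset by (rule continuous_on_subset)
      have gC0: "g \<in> C0 D" unfolding g_def by (rule green_C0(1)[OF fm fcD f0 fB])
      have gout: "g y = 0" if "y \<notin> D" for y unfolding g_def using green_started_outside[OF that] by simp
      have "continuous_on K (\<lambda>y. if y \<in> D then g y else 0)" by (rule C0_zero_extension_continuous[OF D_open gC0])
      also have "(\<lambda>y. if y \<in> D then g y else 0) = g" using gout by auto
      finally have gc: "continuous_on K g" .
      have gfin: "green (\<lambda>z. ennreal (f z)) y = ennreal (g y)" for y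
        unfolding g_def using green_finite[OF fm fB, of y] by simp
      obtain A where A: "A > 0" "\<And>y. y \<in> D \<Longrightarrow> \<bar>g y\<bar> \<le> A" using C0_bounded[OF gC0] by blast
      have gA: "0 \<le> g y" "g y \<le> A" for y using A(1) A(2)[of y] gout[of y] by (cases "y \<in> D"; simp add: g_def)+
      have conv: "(\<integral>\<^sup>+y. ennreal (h y) \<partial>m) = ennreal (\<integral>y. indicator K y * h y \<partial>m)" "0 \<le> (\<integral>y. indicator K y * h y \<partial>m)"
        if m: "prob_space m" "sets m = sets borel" "AE y in m. y \<in> K"
          and h: "h \<in> borel_measurable borel" "\<And>y. 0 \<le> h y" "\<And>y. h y \<le> b" for m :: "'a measure" and h b
      proof -
        interpret prob_space m by (rule m)
        note [measurable_cong] = m(2)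
        note [measurable] = h(1)
        have int: "integrable m h" by (rule integrable_const_bound[of _ b]) (use h in auto)
        have "(\<integral>\<^sup>+y. ennreal (h y) \<partial>m) = ennreal (\<integral>y. h y \<partial>m)" by (rule nn_integral_eq_integral[OF int]) (use h in auto)
        also have "(\<integral>y. h y \<partial>m) = (\<integral>y. indicator K y * h y \<partial>m)"
          by (rule integral_cong_AE) (use m(3) in \<open>auto elim!: eventually_mono\<close>)
        finally show "(\<integral>\<^sup>+y. ennreal (h y) \<partial>m) = ennreal (\<integral>y. indicator K y * h y \<partial>m)" .
        show "0 \<le> (\<integral>y. indicator K y * h y \<partial>m)" using h by (intro integral_nonneg_AE) auto
      qed
      have l0: "l j > 0" for j using r M1[of j] by (simp add: l_def add_pos_pos)
      have c0: "c j > 0" for j using cM[of j] M1[of j] by linarith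
      have real_id: "(\<integral>y. indicator K y * g y \<partial>\<nu> j) + l j / c j * f (x j) = l j * (\<integral>y. indicator K y * f y \<partial>\<nu> j)" for j
      proof -
        have "ennreal ((\<integral>y. indicator K y * g y \<partial>\<nu> j) + l j / c j * f (x j)) =
            (\<integral>\<^sup>+y. green (\<lambda>z. ennreal (f z)) y \<partial>\<nu> j) + ennreal (l j / c j) * ennreal (f (x j))"
          unfolding gfin conv(1)[OF \<nu> gme gA] using conv(2)[OF \<nu> gme gA] l0[of j] c0[of j] f0
          by (simp add: ennreal_mult[symmetric] flip: ennreal_plus)
        also have "\<dots> = ennreal (l j) * (\<integral>\<^sup>+y. ennreal (f y) \<partial>\<nu> j)" by (rule id) measurable
        also have "\<dots> = ennreal (l j * (\<integral>y. indicator K y * f y \<partial>\<nu> j))"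
          unfolding conv(1)[OF \<nu> fm f0 fB] using conv(2)[OF \<nu> fm f0 fB] l0[of j] by (simp add: ennreal_mult)
        finally have e: "ennreal ((\<integral>y. indicator K y * g y \<partial>\<nu> j) + l j / c j * f (x j)) = ennreal (l j * (\<integral>y. indicator K y * f y \<partial>\<nu> j))" .
        have "0 \<le> (\<integral>y. indicator K y * g y \<partial>\<nu> j) + l j / c j * f (x j)" "0 \<le> l j * (\<integral>y. indicator K y * f y \<partial>\<nu> j)"
          using conv(2)[OF \<nu> gme gA, of j] conv(2)[OF \<nu> fm f0 fB, of j] l0[of j] c0[of j] f0[of "x j"] by auto
        then show ?thesis using e ennreal_inj by blast
      qed
      have small: "(\<lambda>j. l (s j) / c (s j) * f (x (s j))) \<longlonglongrightarrow> 0"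
      proof (rule tendsto_sandwich[of "\<lambda>_. 0" _ _ "\<lambda>j. l (s j) * (1 / M (s j)) * B"])
        show "(\<lambda>j. l (s j) * (1 / M (s j)) * B) \<longlonglongrightarrow> 0"
          using tendsto_mult[OF tendsto_mult[OF llim Mlim] tendsto_const[of B]] by simp
        show "\<forall>\<^sub>F j in sequentially. 0 \<le> l (s j) / c (s j) * f (x (s j))"
          using l0 c0 f0 by (intro always_eventually allI mult_nonneg_nonneg divide_nonneg_nonneg) (auto intro: less_imp_le)
        show "\<forall>\<^sub>F j in sequentially. l (s j) / c (s j) * f (x (s j)) \<le> l (s j) * (1 / M (s j)) * B"
        proof (intro always_eventually allI mult_mono fB)
          fix j
          show "l (s j) / c (s j) \<le> l (s j) * (1 / M (s j))"
            using cM[of "s j"] l0[of "s j"] M1[of "s j"] by (simp add: frac_le)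
          show "0 \<le> l (s j) * (1 / M (s j))" using l0[of "s j"] M1[of "s j"] by simp
        qed (use f0 in auto)
      qed simp
      have "(\<lambda>j. (\<integral>y. indicator K y * g y \<partial>\<nu> (s j)) + l (s j) / c (s j) * f (x (s j))) \<longlonglongrightarrow> (\<integral>y. indicator K y * g y \<partial>N) + 0"
        by (intro tendsto_add lim[OF gc] small)
      moreover have "(\<lambda>j. l (s j) * (\<integral>y. indicator K y * f y \<partial>\<nu> (s j))) \<longlonglongrightarrow> r * (\<integral>y. indicator K y * f y \<partial>N)"
        by (intro tendsto_mult lim[OF fc] llim)
      ultimately have eq: "(\<integral>y. indicator K y * g y \<partial>N) = r * (\<integral>y. indicator K y * f y \<partial>N)"
        unfolding real_id using LIMSEQ_unique by fastforce
      show "(\<integral>\<^sup>+y. green (\<lambda>z. ennreal (f z)) y \<partial>N) = ennreal r * (\<integral>\<^sup>+y. ennreal (f y) \<partial>N)"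
        unfolding gfin conv(1)[OF N gme gA] conv(1)[OF N fm f0 fB] eq
        using conv(2)[OF N fm f0 fB] r(2) by (simp add: ennreal_mult)
    qed
  qed
qed

text \<open>
  Both sides are integrals against finite measures that agree on continuous functions, hence on closed
  sets, hence on Borel sets.
\<close>

lemma eigenmeasure_on_borel:
  assumes \<nu>: "prob_space \<nu>" "sets \<nu> = sets borel" "AE y in \<nu>. y \<in> K" and r: "r > 0"
    and eigen: "\<And>f B. continuous_on K f \<Longrightarrow> (\<And>y. 0 \<le> f y) \<Longrightarrow> (\<And>y. f y \<le> B) \<Longrightarrow> f \<in> borel_measurable borel \<Longrightarrow>
      (\<integral>\<^sup>+y. green (\<lambda>z. ennreal (f z)) y \<partial>\<nu>) = ennreal r * (\<integral>\<^sup>+y. ennreal (f y) \<partial>\<nu>)"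
    and f: "f \<in> borel_measurable borel"
  shows "(\<integral>\<^sup>+y. green f y \<partial>\<nu>) = ennreal r * (\<integral>\<^sup>+y. f y \<partial>\<nu>)"
proof -
  interpret prob_space \<nu> by (rule \<nu>)
  have m\<nu>: "h \<in> borel_measurable \<nu>" if "h \<in> borel_measurable borel" for h :: "'a \<Rightarrow> ennreal"
    using that measurable_cong_sets[OF \<nu>(2) refl] by blast
  have g\<nu>: "green h \<in> borel_measurable \<nu>" if "h \<in> borel_measurable borel" for h
    using m\<nu>[OF green_measurable[OF that]] .
  define L1 where "L1 f = (\<integral>\<^sup>+y. green f y \<partial>\<nu>)" for f
  define L2 where "L2 f = ennreal r * (\<integral>\<^sup>+y. f y \<partial>\<nu>)" for f
  obtain m1 where s1: "sets m1 = sets (borel :: 'a measure)" and m1: "\<And>f. f \<in> borel_measurable borel \<Longrightarrow> (\<integral>\<^sup>+y. f y \<partial>m1) = L1 f"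
  proof (rule additive_functional_is_nn_integral[of "borel :: 'a measure" L1])
    show "L1 (\<lambda>x. f x + g x) = L1 f + L1 g" if "f \<in> borel_measurable borel" "g \<in> borel_measurable borel" for f g
    proof -
      have "green (\<lambda>x. f x + g x) = (\<lambda>x. green f x + green g x)" using that by (intro ext green_add)
      then show ?thesis unfolding L1_def using that by (simp add: nn_integral_add g\<nu>)
    qed
    show "L1 (\<lambda>x. c * f x) = c * L1 f" if "f \<in> borel_measurable borel" for f c
    proof -
      have "green (\<lambda>x. c * f x) = (\<lambda>x. c * green f x)" using that by (intro ext green_cmult)
      then show ?thesis unfolding L1_def using that by (simp add: nn_integral_cmult g\<nu>)
    qed
    show "L1 (\<lambda>x. SUP i. f i x) = (SUP i. L1 (f i))" if f: "\<And>i::nat. f i \<in> borel_measurable borel" "incseq f" for f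
    proof -
      have "incseq (\<lambda>i. green (f i))"
        using f by (auto simp: incseq_def le_fun_def intro!: green_mono)
      moreover have "green (\<lambda>x. SUP i. f i x) = (\<lambda>x. SUP i. green (f i) x)" using f by (intro ext green_SUP)
      ultimately show ?thesis unfolding L1_def using nn_integral_monotone_convergence_SUP[OF _ g\<nu>[OF f(1)]] by simp
    qed
    show "L1 f = L1 g" if "\<And>x. x \<in> space borel \<Longrightarrow> f x = g x" for f g
      by (rule arg_cong[where f=L1]) (use that in auto)
  qed blast
  obtain m2 where s2: "sets m2 = sets (borel :: 'a measure)" and m2: "\<And>f. f \<in> borel_measurable borel \<Longrightarrow> (\<integral>\<^sup>+y. f y \<partial>m2) = L2 f"
  proof (rule additive_functional_is_nn_integral[of "borel :: 'a measure" L2])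
    show "L2 (\<lambda>x. f x + g x) = L2 f + L2 g" if "f \<in> borel_measurable borel" "g \<in> borel_measurable borel" for f g
      unfolding L2_def using that by (simp add: nn_integral_add m\<nu> distrib_left)
    show "L2 (\<lambda>x. c * f x) = c * L2 f" if "f \<in> borel_measurable borel" for f c
      unfolding L2_def using that by (simp add: nn_integral_cmult m\<nu> mult.left_commute)
    show "L2 (\<lambda>x. SUP i. f i x) = (SUP i. L2 (f i))" if f: "\<And>i::nat. f i \<in> borel_measurable borel" "incseq f" for f
      unfolding L2_def SUP_mult_left_ennreal[symmetric]
      by (subst nn_integral_monotone_convergence_SUP[OF f(2) m\<nu>[OF f(1)]]) simp
    show "L2 f = L2 g" if "\<And>x. x \<in> space borel \<Longrightarrow> f x = g x" for f g
      by (rule arg_cong[where f=L2]) (use that in auto)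
  qed blast
  have cont: "L1 (\<lambda>y. ennreal (h y)) = L2 (\<lambda>y. ennreal (h y))"
    if "continuous_on UNIV h" "\<And>y. 0 \<le> h y" "\<And>y. h y \<le> 1" for h
    unfolding L1_def L2_def
    by (rule eigen[of h 1]) (use that in \<open>auto intro: continuous_on_subset borel_measurable_continuous_onI\<close>)
  have fin: "(\<integral>\<^sup>+y. 1 \<partial>m2) < top" 
    using m2[of "\<lambda>_. 1"] by (simp add: L2_def emeasure_space_1)
  have one: "L1 (\<lambda>_. 1) = L2 (\<lambda>_. 1)" using cont[of "\<lambda>_. 1"] by simp
  have fin1: "(\<integral>\<^sup>+y. 1 \<partial>m1) < top" using fin m1[of "\<lambda>_. 1"] m2[of "\<lambda>_. 1"] one by simp
  have "m1 = m2"
  proof (rule measure_eqI_generator_eq[of "Collect closed" UNIV m1 m2 "\<lambda>_. UNIV"])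
    have gen: "sets borel = sigma_sets UNIV (Collect (closed :: 'a set \<Rightarrow> bool))"
      by (subst borel_eq_closed) (simp add: sets_measure_of)
    show "sets m1 = sigma_sets UNIV (Collect closed)" "sets m2 = sigma_sets UNIV (Collect closed)"
      using s1 s2 gen by auto
    show "Int_stable (Collect (closed :: 'a set \<Rightarrow> bool))" by (auto simp: Int_stable_def)
    have sp: "space m1 = UNIV" "space m2 = UNIV" using sets_eq_imp_space_eq[OF s1] sets_eq_imp_space_eq[OF s2] by auto
    show "emeasure m1 UNIV \<noteq> \<infinity>" using fin1 sp by simp
    fix A :: "'a set" assume "A \<in> Collect closed"
    then have A: "closed A" by simp
    show "emeasure m1 A = emeasure m2 A"
    proof (cases "A = {}")
      case False
      let ?b = "\<lambda>n. bump A (1 / real (Suc n))"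
      have bm: "(\<lambda>y. ennreal (?b n y)) \<in> borel_measurable borel" for n
        using borel_measurable_continuous_onI[OF bump_continuous] by measurable
      have b01: "0 \<le> ?b n y" "?b n y \<le> 1" for n y using bump_bounds(1)[of A "1 / real (Suc n)" y] bump_bounds(2)[of "1 / real (Suc n)" A y] by auto
      have lim: "(\<lambda>n. \<integral>\<^sup>+y. ennreal (?b n y) \<partial>m) \<longlonglongrightarrow> emeasure m A"
        if m: "sets m = sets borel" "(\<integral>\<^sup>+y. 1 \<partial>m) < top" for m
      proof -
        have mm: "h \<in> borel_measurable m" if "h \<in> borel_measurable borel" for h :: "'a \<Rightarrow> ennreal"
          using that measurable_cong_sets[OF m(1) refl] by blast
        have "(\<lambda>n. \<integral>\<^sup>+y. ennreal (?b n y) \<partial>m) \<longlonglongrightarrow> (\<integral>\<^sup>+y. indicator A y \<partial>m)"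
        proof (rule nn_integral_dominated_convergence[where w="\<lambda>_. 1"])
          show "AE y in m. (\<lambda>n. ennreal (?b n y)) \<longlonglongrightarrow> indicator A y"
            using tendsto_ennrealI[OF bump_tendsto_indicator[OF A False]] by (auto simp: ennreal_indicator)
          show "AE y in m. ennreal (?b n y) \<le> 1" for n using b01 by (auto simp: ennreal_le_1)
          show "(\<lambda>y. ennreal (?b n y)) \<in> borel_measurable m" for n by (rule mm[OF bm])
          show "(indicator A :: 'a \<Rightarrow> ennreal) \<in> borel_measurable m" by (rule mm) (use A in simp)
          show "(\<integral>\<^sup>+y. 1 \<partial>m) < \<infinity>" using m(2) by simp
        qed simp_all
        also have "(\<integral>\<^sup>+y. indicator A y \<partial>m) = emeasure m A"
          by (rule nn_integral_indicator) (use A m(1) in simp)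
        finally show ?thesis .
      qed
      have b_eq: "(\<integral>\<^sup>+y. ennreal (?b n y) \<partial>m1) = (\<integral>\<^sup>+y. ennreal (?b n y) \<partial>m2)" for n
        unfolding m1[OF bm] m2[OF bm] by (rule cont[OF bump_continuous b01])
      show ?thesis by (rule LIMSEQ_unique[OF lim[OF s1 fin1, unfolded b_eq] lim[OF s2 fin]])
    qed simp
  qed auto
  then show ?thesis using m1[OF f] m2[OF f] by (simp add: L1_def L2_def)
qed

text \<open>
  With \<open>\<alpha> s\<close> the mass that \<open>\<nu> P\<^sub>s\<close> gives to \<open>A\<close>, the eigenvalue equation for the function \<open>P\<^sub>u 1\<^sub>A\<close> reads
  \<open>r * \<alpha> u = (\<integral>s\<ge>u. \<alpha> s)\<close>, so \<open>\<alpha>\<close> is exponential; the equation for \<open>1\<^sub>A\<close> itself gives \<open>\<alpha> 0 = \<nu> A\<close>. As \<open>G\<close>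
  vanishes on functions supported off \<open>D\<close>, the measure \<open>\<nu>\<close> is carried by \<open>D\<close>.
\<close>

lemma QSD_if_eigenmeasure:
  assumes \<nu>: "prob_space \<nu>" "sets \<nu> = sets borel" and r: "r > 0"
    and eigen: "\<And>f. f \<in> borel_measurable borel \<Longrightarrow> (\<integral>\<^sup>+y. green f y \<partial>\<nu>) = ennreal r * (\<integral>\<^sup>+y. f y \<partial>\<nu>)"
  shows "QSD Pr X D (restrict_space \<nu> D)"
proof -
  interpret prob_space \<nu> by (rule \<nu>)
  have sp: "space \<nu> = UNIV" using sets_eq_imp_space_eq[OF \<nu>(2)] by simp
  note [measurable_cong] = \<nu>(2)
  have D\<nu>: "D \<in> sets \<nu>" using \<nu>(2) by simp
  have "(\<integral>\<^sup>+y. green (indicator (- D)) y \<partial>\<nu>) = 0"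
  proof -
    have "green (indicator (- D)) y = 0" for y
    proof -
      have "green (indicator (- D)) y = green (\<lambda>_. 0 * 1) y" by (rule green_cong) auto
      also have "\<dots> = 0 * green (\<lambda>_. 1) y" by (rule green_cmult) simp
      finally show ?thesis by simp
    qed
    then show ?thesis by simp
  qed
  then have "ennreal r * emeasure \<nu> (- D) = 0" using eigen[of "indicator (- D)"] \<nu>(2) by simp
  then have D0: "emeasure \<nu> (- D) = 0" using r by simp
  then have AED: "AE y in \<nu>. y \<in> D"
    using \<nu>(2) AE_not_in[of "- D" \<nu>] by (simp add: null_sets_def)
  have D1: "emeasure \<nu> D = 1" using AED prob_eq_1[OF D\<nu>] by (simp add: emeasure_eq_measure)
  have sr: "sets (restrict_space \<nu> D) = sets (restrict_space borel D)"
    by (rule sets_restrict_space_cong[OF \<nu>(2)])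
  have main: "(\<integral>x. killed_kernel Pr X D t x A \<partial>restrict_space \<nu> D) = exp (- (1 / r) * t) * measure (restrict_space \<nu> D) A"
    if t: "0 \<le> t" and A: "A \<in> sets (restrict_space \<nu> D)" for t A
  proof -
    have AB: "A \<in> sets borel" "A \<subseteq> D" using A D_borel unfolding sr by (auto simp: sets_restrict_space_iff)
    have ia[measurable]: "(indicator A :: 'a \<Rightarrow> ennreal) \<in> borel_measurable borel" using AB(1) by simp
    define q where "q s x = (\<integral>\<^sup>+y. indicator A y \<partial>kern s x)" for s x
    have q_em: "q s x = emeasure (kern s x) A" for s x using AB(1) by (simp add: q_def)
    have q1: "q s x \<le> 1" for s x using emeasure_kern_le_1 by (simp add: q_em)
    have qm2: "(\<lambda>p. q (fst p) (snd p)) \<in> borel_measurable (borel \<Otimes>\<^sub>M borel)"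
      unfolding q_def by (rule nn_integral_kern_measurable[OF ia])
    have qm[measurable]: "q s \<in> borel_measurable borel" for s
      unfolding q_def[abs_def] by (rule nn_integral_kern_measurable1[OF ia])
    define \<alpha> where "\<alpha> s = (\<integral>\<^sup>+x. q s x \<partial>\<nu>)" for s
    have am[measurable]: "\<alpha> \<in> borel_measurable borel"
      unfolding \<alpha>_def[abs_def]
    proof (rule borel_measurable_nn_integral)
      have "(\<lambda>p. q (fst p) (snd p)) \<in> borel_measurable (borel \<Otimes>\<^sub>M \<nu>)"
        using qm2 measurable_cong_sets[OF sets_pair_measure_cong[OF refl \<nu>(2)] refl] by blast
      then show "(\<lambda>(s, x). q s x) \<in> borel_measurable (borel \<Otimes>\<^sub>M \<nu>)" by (simp add: case_prod_beta')
    qed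
    have a1: "\<alpha> s \<le> 1" for s
    proof -
      have "\<alpha> s \<le> (\<integral>\<^sup>+x. 1 \<partial>\<nu>)" unfolding \<alpha>_def by (intro nn_integral_mono q1)
      then show ?thesis by (simp add: emeasure_space_1)
    qed
    have swap: "(\<integral>\<^sup>+x. (\<integral>\<^sup>+s. indicator {u..} s * q s x \<partial>lborel) \<partial>\<nu>) = (\<integral>\<^sup>+s. indicator {u..} s * \<alpha> s \<partial>lborel)" for u
      unfolding \<alpha>_def q_def by (rule kern_tonelli[OF ia \<nu>(2) sigma_finite_measure_axioms])
    have tail: "ennreal r * \<alpha> u = (\<integral>\<^sup>+s. indicator {u..} s * \<alpha> s \<partial>lborel)" if "0 \<le> u" for u
    proof -
      have "ennreal r * \<alpha> u = (\<integral>\<^sup>+x. green (q u) x \<partial>\<nu>)" unfolding \<alpha>_def by (rule eigen[symmetric]) (rule qm)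
      also have "\<dots> = (\<integral>\<^sup>+x. (\<integral>\<^sup>+s. indicator {u..} s * q s x \<partial>lborel) \<partial>\<nu>)"
        unfolding q_def by (intro nn_integral_cong green_kern[OF that ia])
      finally show ?thesis unfolding swap .
    qed
    have "ennreal r * emeasure \<nu> A = (\<integral>\<^sup>+x. green (indicator A) x \<partial>\<nu>)"
      using eigen[OF ia] AB(1) \<nu>(2) by simp
    also have "\<dots> = (\<integral>\<^sup>+s. indicator {0..} s * \<alpha> s \<partial>lborel)"
      unfolding green_def using swap[of 0] unfolding q_def .
    also have "\<dots> = ennreal r * \<alpha> 0" by (rule tail[symmetric]) simp
    finally have "emeasure \<nu> A = \<alpha> 0" using r by (simp add: ennreal_mult_cancel_left)
    then have a0: "measure \<nu> A = enn2real (\<alpha> 0)" by (simp add: measure_def)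
    define a where "a s = enn2real (\<alpha> s)" for s
    have ea: "ennreal (a s) = \<alpha> s" for s using a1[of s] by (simp add: a_def le_less_trans)
    have a0': "0 \<le> a s" for s by (simp add: a_def)
    have ameas[measurable]: "a \<in> borel_measurable borel" unfolding a_def[abs_def] by measurable
    have nn: "(\<integral>\<^sup>+s. ennreal (indicator {u..} s *\<^sub>R a s) \<partial>lborel) = ennreal (r * a u)" if "0 \<le> u" for u
    proof -
      have "(\<integral>\<^sup>+s. ennreal (indicator {u..} s *\<^sub>R a s) \<partial>lborel) = (\<integral>\<^sup>+s. indicator {u..} s * \<alpha> s \<partial>lborel)"
        by (intro nn_integral_cong) (auto simp: indicator_def ea)
      then show ?thesis using tail[OF that] r a0' by (simp add: ea[symmetric] ennreal_mult)
    qed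
    have "a t = exp (- t / r) * a 0"
    proof (rule exponential_from_tail_integral[OF _ r _ t])
      show "set_integrable lborel {0..} a" unfolding set_integrable_def
        by (rule integrableI_nonneg) (use nn[of 0] a0' in auto)
      fix u :: real assume u: "0 \<le> u"
      have "(LBINT s:{u..}. a s) = enn2real (\<integral>\<^sup>+s. ennreal (indicator {u..} s *\<^sub>R a s) \<partial>lborel)"
        unfolding set_lebesgue_integral_def by (rule integral_eq_nn_integral) (use a0' in auto)
      then show "r * a u = (LBINT s:{u..}. a s)" unfolding nn[OF u] using r a0' by simp
    qed
    moreover have "(\<integral>x. killed_kernel Pr X D t x A \<partial>restrict_space \<nu> D) = a t"
    proof -
      have kk: "killed_kernel Pr X D t x A = enn2real (q t x)" for x
        by (simp add: killed_kernel_eq[OF t AB(1)] q_em measure_def)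
      have "(\<integral>x. killed_kernel Pr X D t x A \<partial>restrict_space \<nu> D) = (\<integral>x. indicator D x *\<^sub>R killed_kernel Pr X D t x A \<partial>\<nu>)"
        by (rule integral_restrict_space) (use D\<nu> sp in simp)
      also have "\<dots> = (\<integral>x. enn2real (q t x) \<partial>\<nu>)"
        unfolding kk by (rule integral_cong_AE) (use AED D\<nu> in \<open>auto elim!: eventually_mono\<close>)
      also have "\<dots> = enn2real (\<integral>\<^sup>+x. ennreal (enn2real (q t x)) \<partial>\<nu>)" by (rule integral_eq_nn_integral) auto
      also have "(\<integral>\<^sup>+x. ennreal (enn2real (q t x)) \<partial>\<nu>) = \<alpha> t"
        unfolding \<alpha>_def
      proof (rule nn_integral_cong)
        show "ennreal (enn2real (q t x)) = q t x" for x using q1[of t x] by (simp add: le_less_trans)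
      qed
      finally show ?thesis by (simp add: a_def)
    qed
    moreover have "measure (restrict_space \<nu> D) A = a 0"
      using a0 AB D\<nu> sp by (simp add: a_def measure_restrict_space)
    ultimately show ?thesis by simp
  qed
  have "prob_space (restrict_space \<nu> D)"
    by (rule prob_spaceI) (use D1 D\<nu> sp in \<open>simp add: space_restrict_space emeasure_restrict_space\<close>)
  moreover have "1 / r > 0" using r by simp
  ultimately show ?thesis unfolding QSD_def using sr main by blast
qed

theorem QSD_exists_if_lyapunov:
  assumes \<phi>: "\<phi> \<in> C0 D" "\<theta> > 0" "\<And>x. x \<in> D \<Longrightarrow> \<phi> x > 0"
    "\<And>x. x \<in> D \<Longrightarrow> green_op Pr X D \<phi> x \<ge> \<theta> * \<phi> x"
  shows "\<exists>\<mu>. QSD Pr X D \<mu>"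
proof -
  define r where "r = Inf growth_rates"
  have "\<theta> \<le> r" unfolding r_def using growth_rates_nonempty growth_rates_ge[OF \<phi>] by (intro cInf_greatest) auto
  with \<phi>(2) have r: "r > 0" by simp
  show ?thesis
  proof (rule eigenmeasure_on_continuous[OF r_def r])
    fix \<nu>
    assume \<nu>: "prob_space \<nu>" "sets \<nu> = sets borel" "AE y in \<nu>. y \<in> K"
      and eigen: "\<And>f B. continuous_on K f \<Longrightarrow> (\<And>y. 0 \<le> f y) \<Longrightarrow> (\<And>y. f y \<le> B) \<Longrightarrow> f \<in> borel_measurable borel \<Longrightarrow>
        (\<integral>\<^sup>+y. green (\<lambda>z. ennreal (f z)) y \<partial>\<nu>) = ennreal r * (\<integral>\<^sup>+y. ennreal (f y) \<partial>\<nu>)"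
    have "QSD Pr X D (restrict_space \<nu> D)"
      by (rule QSD_if_eigenmeasure[OF \<nu>(1,2) r]) (rule eigenmeasure_on_borel[OF \<nu> r eigen])
    then show ?thesis by blast
  qed
qed

end

theorem theorem2p9:
  fixes P :: "real \<Rightarrow> 'a::{metric_space, second_countable_topology} \<Rightarrow> 'a measure"
    and \<Omega> :: "'w measure"
    and F :: "real \<Rightarrow> 'w measure"
    and Pr :: "'a \<Rightarrow> 'w measure"
    and X :: "real \<Rightarrow> 'w \<Rightarrow> 'a"
    and D K :: "'a set"
  assumes locally_compact: "locally compact (UNIV :: 'a set)"
    and semigroup: "markov_feller_semigroup P"
    and process: "cadlag_markov_process P \<Omega> F Pr X"
    and D_nonempty: "D \<noteq> {}"
    and K_def: "K = closure D"
    and K_compact: "compact K"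
    and D_open: "openin (top_of_set K) D"
    and accessible: "\<forall>x\<in>K. \<exists>t\<ge>0. measure (P t x) (UNIV - K) > 0"
    and green_Cb: "\<forall>f\<in>Cb D. green_op Pr X D f \<in> C0 D"
  defines "cond_i \<equiv> \<exists>U. open U \<and> (\<forall>x\<in>D. D_accessible Pr X D U x) \<and> closure (U \<inter> K) \<subseteq> D"
    and "cond_ii \<equiv> \<exists>\<phi>\<in>C0 D. \<exists>\<theta>>0. (\<forall>x\<in>D. \<phi> x > 0) \<and> (\<forall>x\<in>D. green_op Pr X D \<phi> x \<ge> \<theta> * \<phi> x)"
  shows "(cond_i \<longleftrightarrow> cond_ii) \<and> (cond_i \<or> cond_ii \<longrightarrow> (\<exists>\<mu>. QSD Pr X D \<mu>))"
proof -
  interpret markov_feller_semigroup P by (rule semigroup)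
  interpret cadlag_markov_process P \<Omega> F Pr X by (rule process)
  interpret regular_killed_process P \<Omega> F Pr X D K
    by unfold_locales (use locally_compact K_compact D_open D_nonempty accessible green_Cb in auto)
  have i_ii: cond_ii if cond_i
    using that lyapunov_if_accessible unfolding cond_i_def cond_ii_def by blast
  have ii_i: cond_i if cond_ii
    using that accessible_if_lyapunov unfolding cond_i_def cond_ii_def by blast
  have "\<exists>\<mu>. QSD Pr X D \<mu>" if cond_ii
    using that QSD_exists_if_lyapunov unfolding cond_ii_def by blast
  with i_ii ii_i show ?thesis by blast
qed

end
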